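(* Let $(Y_t)_{t\in\mathbb{Z}}$ be a strongly stationary and ergodic $\mathcal{Y}$-valued process, let $Q$ be a family of probabilistic kernels on $\mathcal{X}$ parametrized by $y\in\mathcal{Y}$, and let $X$ be a process in the environment $Y$ with kernels $Q$ (see context). Assume the following. (i) (Drift) There are a measurable $V:\mathcal{X}\to\mathbb{R}_+$, a non-decreasing sequence $A_n\in\mathfrak{A}$, $n\in\mathbb{N}$, with $A_0\neq\emptyset$ and $\mathcal{Y}=\bigcup_{n}A_n$, a non-increasing $\lambda:\mathbb{N}\to(0,1/3]$ and a non-decreasing $K:\mathbb{N}\to[1,\infty)$ such that, with $\Vert y\Vert:=\min\{n:\ y\in A_n\}$, for all $x\in\mathcal{X}$, $y\in\mathcal{Y}$, $$\int_{\mathcal{X}}V(z)\,Q(y,x,dz)\le(1-\lambda(\Vert y\Vert))V(x)+K(\Vert y\Vert).$$ (ii) (Minorization) With $C(R):=\{x\in\mathcal{X}:V(x)\le R\}$ and $R(n):=8K(n)/\lambda(n)$, there are a non-increasing $\alpha:\mathbb{N}\to(0,1/3]$ and probability measures $\nu_n$ on $\mathfrak{B}$, $n\in\mathbb{N}$, such that for all $y\in\mathcal{Y}$, $x\in C(R(\Vert y\Vert))$ and $A\in\mathfrak{B}$, $$Q(y,x,A)\ge\alpha(\Vert y\Vert)\,\nu_{\Vert y\Vert}(A).$$ (iii) (Maximal process) There are a non-decreasing $g:\mathbb{N}\to\mathbb{N}$ and a non-increasing $\ell:\mathbb{N}\to[0,1]$ such that $P(\max_{1\le i\le t}\Vert Y_i\Vert\ge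 g(t))\le\ell(t)$ for all $t\ge1$. (iv) $E[V(X_0)+V(X_1)]<\infty$. (v) $r_3(0)+r_4(0)<\infty$, where $$r_3(0):=\sum_{k=0}^\infty e^{-k\alpha(g(k))\lambda(g(k))/2},\qquad r_4(0):=\sum_{k=0}^\infty\ell(k).$$ (vi) $\pi(t)/t\to0$ as $t\to\infty$, where $\pi(t):=\dfrac{|\ln(\lambda(g(t)))|}{\alpha(g(t))\lambda(g(t))}$. Then for each bounded measurable $\phi:\mathcal{X}\to\mathbb{R}$, $$\frac{\phi(X_1)+\dots+\phi(X_t)}{t}\to\int_{\mathcal{X}}\phi(z)\,\mu_*(dz),\quad t\to\infty,$$ in $L^p$ for all $p\ge1$, where $\mu_*$ is the probability on $\mathcal{X}$ which is the limit of $\mathrm{Law}(X_t)$ as $t\to\infty$ in total variation.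
   Context: $\mathbb{N}=\{0,1,2,\dots\}$, $\mathbb{R}_+=[0,\infty)$. $\mathcal{Y}$ and $\mathcal{X}$ are Polish spaces with Borel sigma-fields $\mathfrak{A}$ and $\mathfrak{B}$ respectively. All random variables live on a probability space $(\Omega,\mathcal{F},P)$ (enlarged if necessary). A family of probabilistic kernels parametrized by $y\in\mathcal{Y}$ is a map $Q:\mathcal{Y}\times\mathcal{X}\times\mathfrak{B}\to[0,1]$ such that $Q(\cdot,\cdot,A)$ is $\mathfrak{A}\otimes\mathfrak{B}$-measurable for each $A\in\mathfrak{B}$ and $Q(y,x,\cdot)$ is a probability on $\mathfrak{B}$ for all $y,x$. A process $X$ in the environment $Y$ with kernels $Q$ is an $\mathcal{X}$-valued process $(X_t)_{t\in\mathbb{N}}$ such that for all $t\ge0$ and $A\in\mathfrak{B}$, $$P(X_{t+1}\in A\mid\mathcal{F}_t)=Q(Y_t,X_t,A)\quad P\text{-a.s.},\qquad \mathcal{F}_t:=\sigma(Y_j,\ j\in\mathbb{Z};\ X_j,\ 0\le j\le t).$$ The existence of the total variation limit $\mu_*$ of $\mathrm{Law}(X_t)$ is a separate theorem under hypotheses (i)-(v) (for which $R(n)=4K(n)/\lambda(n)$ in (ii) suffices). *)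

theory Defs
  imports "HOL-Probability.Probability"
begin

section \<open>Processes in a random environment\<close>

definition strongly_stationary :: "'w measure \<Rightarrow> (int \<Rightarrow> 'w \<Rightarrow> 'y::topological_space) \<Rightarrow> bool" where
  "strongly_stationary M Y \<longleftrightarrow>
     (\<forall>k. distr M (Pi\<^sub>M UNIV (\<lambda>_. borel)) (\<lambda>\<omega> t. Y (t + k) \<omega>)
        = distr M (Pi\<^sub>M UNIV (\<lambda>_. borel)) (\<lambda>\<omega> t. Y t \<omega>))"

text \<open>Ergodicity of the left shift on the two-sided path space under the law of the process.\<close>

definition ergodic_process :: "'w measure \<Rightarrow> (int \<Rightarrow> 'w \<Rightarrow> 'y::topological_space) \<Rightarrow> bool" where
  "ergodic_process M Y \<longleftrightarrow>
     (\<forall>B \<in> sets (Pi\<^sub>M (UNIV :: int set) (\<lambda>_. borel :: 'y measure)).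
        (\<lambda>y t. y (t + 1)) -` B = B \<longrightarrow>
        measure M {\<omega> \<in> space M. (\<lambda>t. Y t \<omega>) \<in> B} \<in> {0, 1})"

definition prob_kernels :: "('y::topological_space \<Rightarrow> 'x::topological_space \<Rightarrow> 'x measure) \<Rightarrow> bool" where
  "prob_kernels Q \<longleftrightarrow>
     (\<forall>y x. prob_space (Q y x) \<and> sets (Q y x) = sets borel) \<and>
     (\<forall>A \<in> sets borel. (\<lambda>(y, x). measure (Q y x) A) \<in> borel_measurable (borel \<Otimes>\<^sub>M borel))"

text \<open>The sigma-field generated by the whole environment and by the process up to time \<open>t\<close>.\<close>

definition env_filtration ::
  "'w measure \<Rightarrow> (int \<Rightarrow> 'w \<Rightarrow> 'y::topological_space) \<Rightarrow> (nat \<Rightarrow> 'w \<Rightarrow> 'x::topological_space) \<Rightarrow> nat \<Rightarrow> 'w measure"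
where
  "env_filtration M Y X t = sigma (space M)
     ({Y j -` B \<inter> space M | j B. B \<in> sets borel} \<union>
      {X j -` B \<inter> space M | j B. j \<le> t \<and> B \<in> sets borel})"

definition process_in_environment ::
  "'w measure \<Rightarrow> (int \<Rightarrow> 'w \<Rightarrow> 'y::topological_space) \<Rightarrow> (nat \<Rightarrow> 'w \<Rightarrow> 'x::topological_space)
     \<Rightarrow> ('y \<Rightarrow> 'x \<Rightarrow> 'x measure) \<Rightarrow> bool"
where
  "process_in_environment M Y X Q \<longleftrightarrow>
     (\<forall>t. X t \<in> borel_measurable M) \<and>
     (\<forall>t. \<forall>A \<in> sets borel. AE \<omega> in M.
        real_cond_exp M (env_filtration M Y X t) (\<lambda>\<omega>'. indicator A (X (Suc t) \<omega>')) \<omega>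
          = measure (Q (Y (int t) \<omega>) (X t \<omega>)) A)"

definition env_norm :: "(nat \<Rightarrow> 'y set) \<Rightarrow> 'y \<Rightarrow> nat" where
  "env_norm A y = (LEAST n. y \<in> A n)"

text \<open>Some authors use twice this quantity; convergence to \<open>0\<close> is the same.\<close>

definition tv_dist :: "'x measure \<Rightarrow> 'x measure \<Rightarrow> real" where
  "tv_dist \<mu> \<nu> = (SUP A\<in>sets \<mu>. \<bar>measure \<mu> A - measure \<nu> A\<bar>)"

text \<open>The integrability clauses say that all functions involved belong to \<open>L\<^sup>p\<close>; they prevent
  the norm from being \<open>0\<close> by the default value of the Bochner integral.\<close>

definition tendsto_Lp :: "'w measure \<Rightarrow> real \<Rightarrow> (nat \<Rightarrow> 'w \<Rightarrow> real) \<Rightarrow> ('w \<Rightarrow> real) \<Rightarrow> bool" where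
  "tendsto_Lp M p f h \<longleftrightarrow>
     (\<forall>n. f n \<in> borel_measurable M \<and> integrable M (\<lambda>\<omega>. \<bar>f n \<omega>\<bar> powr p)) \<and>
     h \<in> borel_measurable M \<and> integrable M (\<lambda>\<omega>. \<bar>h \<omega>\<bar> powr p) \<and>
     (\<lambda>n. (\<integral>\<omega>. \<bar>f n \<omega> - h \<omega>\<bar> powr p \<partial>M) powr (1 / p)) \<longlonglongrightarrow> 0"

end

theory Submission
  imports Defs
begin

text \<open>Let \<open>u\<^sub>T y x\<close> be the mean of \<open>\<phi> (X\<^sub>T)\<close> for the chain started at \<open>x\<close> in the environment \<open>y\<close>.
  Over a block of times in which the environment stays below a level \<open>N\<close>, two states with
  \<open>V \<le> L\<close> are brought closer: for a pair outside the small set the drift makes \<open>V x + V x'\<close> decay,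
  and inside it the minorization gives a contraction with a constant depending only on \<open>N\<close>.
  The functions \<open>V (X\<^sub>i)\<close> are tight because the laws of \<open>X\<^sub>i\<close> converge in total variation,
  so iterating over blocks yields
  \<open>\<bar>u\<^sub>T y x - u\<^sub>T y x'\<bar> \<le> \<epsilon> + h y x + h y x'\<close> with an error \<open>h\<close> of mean at most \<open>\<epsilon>\<close>
  along the process, uniformly in time. The errors enter as sums of functions of one state, so no
  coupling of two chains has to be built.

  Averaging over the law of \<open>X\<^sub>0\<close> given the environment replaces \<open>u\<^sub>T\<close> by a function
  \<open>\<Psi>\<close> of the environment. The differences between \<open>\<phi> (X\<^bsub>i+T\<^esub>)\<close> and the value of \<open>\<Psi>\<close> at the
  environment seen from time \<open>i\<close> are then almost uncorrelated at distance at least \<open>T\<close>, and the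
  averages of \<open>\<Psi>\<close> converge by the ergodic theorem.\<close>

section \<open>The ergodic theorem\<close>

text \<open>The obstacle is a circularity. The contraction of a block is governed by
  \<open>\<alpha> N\<close>, while the level \<open>N\<close> must be taken large, depending on the
  tolerated error, to make bad blocks rare. As \<open>\<alpha> N\<close> may be tiny, many blocks
  are then needed and their errors could accumulate. The way out is to charge a bad block only with
  the contraction that it fails to deliver, \<open>\<alpha> N / 2\<close> times the current
  oscillation bound. These charges telescope to at most the initial oscillation whatever
  \<open>N\<close> is, so the tolerance can be fixed before \<open>N\<close>. The transition
  operator carries the charges along, and the Markov property turns their means into means at later
  times of the actual process; this is why every tail bound has to be uniform in time. Since
  \<open>X 0\<close> may depend on the whole environment, past and future, the reference state is
  drawn from a conditional law given the environment, whose existence rests on the state space being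
  Polish. The same choice makes the mean of the environment function equal to the mean of \<phi> at
  a later time, which identifies the limit.\<close>

locale measure_preserving = prob_space +
  fixes T :: "'a \<Rightarrow> 'a"
  assumes T_measurable [measurable]: "T \<in> measurable M M"
    and T_preserves: "distr M M T = M"
begin

lemma Tn_measurable [measurable]: "T ^^ n \<in> measurable M M"
proof (induction n)
  case (Suc n)
  then show ?case
    unfolding funpow.simps by (rule measurable_comp[OF _ T_measurable])
qed (simp add: id_def)

lemma integral_T:
  fixes f :: "'a \<Rightarrow> real"
  assumes "f \<in> borel_measurable M"
  shows "(\<integral>y. f (T y) \<partial>M) = (\<integral>y. f y \<partial>M)"
  using integral_distr[OF T_measurable assms] by (simp add: T_preserves)

definition birkhoff_sum :: "('a \<Rightarrow> real) \<Rightarrow> nat \<Rightarrow> 'a \<Rightarrow> real" where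
  "birkhoff_sum f n y = (\<Sum>i<n. f ((T ^^ i) y))"

lemma birkhoff_sum_measurable [measurable]:
  assumes [measurable]: "f \<in> borel_measurable M"
  shows "birkhoff_sum f n \<in> borel_measurable M"
  unfolding birkhoff_sum_def by measurable

lemma birkhoff_sum_Suc: "birkhoff_sum f (Suc n) y = f y + birkhoff_sum f n (T y)"
  unfolding birkhoff_sum_def
  by (simp only: sum.lessThan_Suc_shift funpow_Suc_right o_apply) simp

lemma birkhoff_sum_T: "birkhoff_sum f n (T y) = birkhoff_sum f n y - f y + f ((T ^^ n) y)"
proof -
  have "birkhoff_sum f (Suc n) y = birkhoff_sum f n y + f ((T ^^ n) y)"
    by (simp add: birkhoff_sum_def)
  then show ?thesis using birkhoff_sum_Suc[of f n y] by simp
qed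

lemma abs_birkhoff_sum_le:
  assumes "\<And>y. \<bar>f y\<bar> \<le> C"
  shows "\<bar>birkhoff_sum f n y\<bar> \<le> real n * C"
proof -
  have "\<bar>birkhoff_sum f n y\<bar> \<le> (\<Sum>i<n. \<bar>f ((T ^^ i) y)\<bar>)"
    unfolding birkhoff_sum_def by (rule sum_abs)
  also have "\<dots> \<le> (\<Sum>i<n. C)" by (intro sum_mono assms)
  finally show ?thesis by simp
qed

lemma integrable_bounded:
  fixes f :: "'a \<Rightarrow> real"
  assumes "f \<in> borel_measurable M" "\<And>y. \<bar>f y\<bar> \<le> C"
  shows "integrable M f"
  using assms by (intro integrable_const_bound[where B = C]) auto

text \<open>Garsia's argument: with \<open>m = max(0, S\<^sub>1, \<dots>, S\<^sub>n)\<close> one has \<open>f \<ge> m - m \<circ> T\<close>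
  wherever \<open>m > 0\<close>.\<close>
lemma maximal_ergodic:
  assumes f [measurable]: "f \<in> borel_measurable M" and bd: "\<And>y. \<bar>f y\<bar> \<le> C"
  shows "0 \<le> (\<integral>y. f y * indicator {y. \<exists>k\<le>n. 0 < birkhoff_sum f k y} y \<partial>M)"
proof -
  define m where "m y = Max ((\<lambda>k. birkhoff_sum f k y) ` {..n})" for y
  have m_ge: "birkhoff_sum f k y \<le> m y" if "k \<le> n" for k y
    unfolding m_def using that by (intro Max_ge) auto
  have m_nonneg: "0 \<le> m y" for y using m_ge[of 0 y] by (simp add: birkhoff_sum_def)
  have m_attained: "\<exists>k\<le>n. m y = birkhoff_sum f k y" for y
  proof -
    have "m y \<in> (\<lambda>k. birkhoff_sum f k y) ` {..n}" unfolding m_def by (intro Max_in) auto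
    then show ?thesis by auto
  qed
  have C: "0 \<le> C" using bd[of undefined] by linarith
  have m_bd: "\<bar>m y\<bar> \<le> real n * C" for y
  proof -
    obtain k where k: "k \<le> n" "m y = birkhoff_sum f k y" using m_attained by blast
    have "\<bar>m y\<bar> \<le> real k * C" using abs_birkhoff_sum_le[of f C k y, OF bd] k by simp
    also have "\<dots> \<le> real n * C" using k C by (intro mult_right_mono) auto
    finally show ?thesis .
  qed
  have m_meas [measurable]: "m \<in> borel_measurable M"
    unfolding m_def by measurable
  have pt: "m y - m (T y) \<le> f y * indicator {y. \<exists>k\<le>n. 0 < birkhoff_sum f k y} y" for y
  proof (cases "\<exists>k\<le>n. 0 < birkhoff_sum f k y")
    case True
    then have "0 < m y" using m_ge by (meson less_le_trans)
    obtain k where k: "k \<le> n" "m y = birkhoff_sum f k y" using m_attained by blast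
    with \<open>0 < m y\<close> obtain j where j: "k = Suc j"
      by (cases k) (auto simp: birkhoff_sum_def)
    then have "m y \<le> f y + m (T y)"
      using k m_ge[of j "T y"] by (simp add: birkhoff_sum_Suc)
    with True show ?thesis by simp
  next
    case False
    then have "m y \<le> 0" using m_attained[of y] by (auto simp: not_less)
    then show ?thesis using False m_nonneg[of "T y"] by simp
  qed
  have int_m: "integrable M m" "integrable M (\<lambda>y. m (T y))"
    by (auto intro!: integrable_bounded[where C = "real n * C"] m_bd)
  have [measurable]: "{y \<in> space M. \<exists>k\<le>n. 0 < birkhoff_sum f k y} \<in> sets M"
    by measurable
  have meas: "(\<lambda>y. f y * indicator {y. \<exists>k\<le>n. 0 < birkhoff_sum f k y} y) \<in> borel_measurable M"
    by (simp add: indicator_def)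
  have "0 = (\<integral>y. m y - m (T y) \<partial>M)"
    using int_m by (simp add: integral_T)
  also have "\<dots> \<le> (\<integral>y. f y * indicator {y. \<exists>k\<le>n. 0 < birkhoff_sum f k y} y \<partial>M)"
  proof (intro integral_mono pt)
    show "integrable M (\<lambda>y. f y * indicator {y. \<exists>k\<le>n. 0 < birkhoff_sum f k y} y)"
      using meas C by (intro integrable_bounded[where C = C]) (auto simp: indicator_def bd)
  qed (use int_m in simp)
  finally show ?thesis .
qed

end

locale ergodic_system = measure_preserving +
  assumes ergodic: "\<And>B. B \<in> sets M \<Longrightarrow> T -` B \<inter> space M = B \<Longrightarrow> measure M B = 0 \<or> measure M B = 1"
begin

text \<open>The set where the limsup exceeds \<open>c\<close> is invariant, hence of measure 0 or 1
  by ergodicity. Were it of measure 1, the sets in the maximal inequality for \<open>f - c\<close>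
  would exhaust almost all of the space, and that inequality would force the mean of
  \<open>f\<close> to be at least \<open>c\<close>.\<close>

lemma limsup_birkhoff_average_le:
  assumes f [measurable]: "f \<in> borel_measurable M" and bd: "\<And>y. \<bar>f y\<bar> \<le> C"
    and c: "(\<integral>y. f y \<partial>M) < c"
  shows "AE y in M. limsup (\<lambda>n. ereal (birkhoff_sum f n y / real n)) \<le> ereal c"
proof -
  have C: "0 \<le> C" using bd[of undefined] by linarith
  define B where "B = {y \<in> space M. limsup (\<lambda>n. ereal (birkhoff_sum f n y / real n)) > ereal c}"
  have B_meas [measurable]: "B \<in> sets M" unfolding B_def by measurable
  have inv: "limsup (\<lambda>n. ereal (birkhoff_sum f n (T y) / real n))
      = limsup (\<lambda>n. ereal (birkhoff_sum f n y / real n))" for y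
  proof -
    \<comment> \<open>Sums started at \<open>y\<close> and at \<open>T y\<close> differ only in
      their two end terms.\<close>
    have lim: "(\<lambda>n. (f ((T ^^ n) y) - f y) / real n) \<longlonglongrightarrow> 0"
    proof (rule Lim_null_comparison)
      show "\<forall>\<^sub>F n in sequentially. norm ((f ((T ^^ n) y) - f y) / real n) \<le> 2 * C / real n"
      proof (intro always_eventually allI)
        fix n
        have "\<bar>f ((T ^^ n) y) - f y\<bar> \<le> 2 * C"
          using bd[of "(T ^^ n) y"] bd[of y] by linarith
        then show "norm ((f ((T ^^ n) y) - f y) / real n) \<le> 2 * C / real n"
          by (simp add: divide_right_mono)
      qed
      show "(\<lambda>n. 2 * C / real n) \<longlonglongrightarrow> 0" by (rule lim_const_over_n)
    qed
    have "(\<lambda>n. ereal (birkhoff_sum f n (T y) / real n))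
        = (\<lambda>n. ereal ((f ((T ^^ n) y) - f y) / real n) + ereal (birkhoff_sum f n y / real n))"
      by (auto simp: birkhoff_sum_T diff_divide_distrib add_divide_distrib)
    then show ?thesis
      using ereal_limsup_lim_add[of "\<lambda>n. ereal ((f ((T ^^ n) y) - f y) / real n)" 0
          "\<lambda>n. ereal (birkhoff_sum f n y / real n)"] lim
      by (simp add: zero_ereal_def)
  qed
  have "T -` B \<inter> space M = B"
    using measurable_space[OF T_measurable] by (auto simp: B_def inv)
  then have "measure M B = 0 \<or> measure M B = 1" by (intro ergodic) auto
  moreover have "measure M B \<noteq> 1"
  proof
    assume "measure M B = 1"
    then have AE_B: "AE y in M. y \<in> B" by (simp add: prob_eq_1)
    define h where "h y = f y - c" for y
    have h_meas [measurable]: "h \<in> borel_measurable M" by (simp add: h_def[abs_def])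
    have h_bd: "\<bar>h y\<bar> \<le> C + \<bar>c\<bar>" for y
      using bd[of y] by (simp add: h_def)
    define E where "E n = {y. \<exists>k\<le>n. 0 < birkhoff_sum h k y}" for n
    have E_meas [measurable]: "(\<lambda>y. h y * indicator (E n) y) \<in> borel_measurable M" for n
    proof -
      have [measurable]: "{y \<in> space M. \<exists>k\<le>n. 0 < birkhoff_sum h k y} \<in> sets M" by measurable
      show ?thesis by (simp add: indicator_def E_def)
    qed
    have h_sum: "birkhoff_sum h n y = birkhoff_sum f n y - real n * c" for n y
      by (simp add: birkhoff_sum_def h_def sum_subtractf)
    have "(\<lambda>n. \<integral>y. h y * indicator (E n) y \<partial>M) \<longlonglongrightarrow> (\<integral>y. h y \<partial>M)"
    proof (rule integral_dominated_convergence[where w = "\<lambda>_. C + \<bar>c\<bar>"])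
      show "AE y in M. (\<lambda>n. h y * indicator (E n) y) \<longlonglongrightarrow> h y"
        using AE_B
      proof eventually_elim
        case (elim y)
        then have "ereal c < limsup (\<lambda>n. ereal (birkhoff_sum f n y / real n))"
          by (simp add: B_def)
        \<comment> \<open>The tail supremum starts at 1: for \<open>k = 0\<close> the quotient is 0
          by the convention for division, which exceeds a negative \<open>c\<close>, whereas the
          empty sum of \<open>h\<close> is not positive.\<close>
        then obtain k where k: "k \<ge> 1" "ereal c < ereal (birkhoff_sum f k y / real k)"
          using less_INF_D[of "ereal c" "\<lambda>n. SUP k\<in>{n..}. ereal (birkhoff_sum f k y / real k)" UNIV 1]
          unfolding limsup_INF_SUP by (auto simp: less_SUP_iff)
        then have "0 < birkhoff_sum h k y" by (simp add: h_sum field_simps)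
        then have "\<forall>n\<ge>k. h y * indicator (E n) y = h y"
          by (auto simp: E_def indicator_def)
        then show ?case
          by (intro tendsto_eventually) (auto simp: eventually_sequentially)
      qed
      show "AE y in M. norm (h y * indicator (E n) y) \<le> C + \<bar>c\<bar>" for n
        using h_bd C by (intro always_eventually allI) (auto simp: indicator_def)
    qed auto
    then have "0 \<le> (\<integral>y. h y \<partial>M)"
      using maximal_ergodic[OF h_meas h_bd] unfolding E_def
      by (intro LIMSEQ_le_const) auto
    moreover have "(\<integral>y. h y \<partial>M) = (\<integral>y. f y \<partial>M) - c"
      unfolding h_def using integrable_bounded[OF f bd] by (simp add: prob_space)
    ultimately show False using c by simp
  qed
  ultimately have "measure M B = 0" by blast
  then have "AE y in M. y \<notin> B"
    using AE_iff_measurable[OF B_meas, of "\<lambda>y. y \<notin> B"] sets.sets_into_space[OF B_meas]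
    by (auto simp: emeasure_eq_measure)
  then show ?thesis by (auto simp: B_def not_less)
qed

text \<open>Applying the limsup bound to \<open>f\<close> and to \<open>- f\<close>, with countably
  many thresholds decreasing to the respective means, yields almost sure convergence. Boundedness
  then gives convergence in mean by domination.\<close>

theorem birkhoff_average_L1:
  assumes f [measurable]: "f \<in> borel_measurable M" and bd: "\<And>y. \<bar>f y\<bar> \<le> C"
  shows "(\<lambda>n. \<integral>y. \<bar>birkhoff_sum f n y / real n - (\<integral>z. f z \<partial>M)\<bar> \<partial>M) \<longlonglongrightarrow> 0"
proof -
  have C: "0 \<le> C" using bd[of undefined] by linarith
  define m where "m = (\<integral>z. f z \<partial>M)"
  have upper: "AE y in M. \<forall>k. limsup (\<lambda>n. ereal (birkhoff_sum f n y / real n))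
      \<le> ereal (m + 1 / real (Suc k))"
    unfolding AE_all_countable m_def
    by (intro allI limsup_birkhoff_average_le[OF f bd]) auto
  have lower: "AE y in M. \<forall>k. limsup (\<lambda>n. ereal (birkhoff_sum (\<lambda>y. - f y) n y / real n))
      \<le> ereal (- m + 1 / real (Suc k))"
    unfolding AE_all_countable m_def
    by (intro allI limsup_birkhoff_average_le[where C = C]) (auto simp: bd)
  have conv: "AE y in M. (\<lambda>n. birkhoff_sum f n y / real n) \<longlonglongrightarrow> m"
    using upper lower
  proof eventually_elim
    case (elim y)
    have neg: "birkhoff_sum (\<lambda>y. - f y) n y = - birkhoff_sum f n y" for n
      by (simp add: birkhoff_sum_def sum_negf)
    show ?case
    proof (rule LIMSEQ_I)
      fix r :: real assume "0 < r"
      then obtain k where k: "1 / real (Suc k) < r"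
        using reals_Archimedean[OF \<open>0 < r\<close>] by (auto simp: inverse_eq_divide)
      have "limsup (\<lambda>n. ereal (birkhoff_sum f n y / real n)) < ereal (m + r)"
        by (rule le_less_trans[OF elim(1)[rule_format, of k]]) (use k in auto)
      then have 1: "\<forall>\<^sub>F n in sequentially. birkhoff_sum f n y / real n < m + r"
        by (auto dest: Limsup_lessD)
      have "limsup (\<lambda>n. ereal (birkhoff_sum (\<lambda>y. - f y) n y / real n)) < ereal (- m + r)"
        by (rule le_less_trans[OF elim(2)[rule_format, of k]]) (use k in auto)
      then have 2: "\<forall>\<^sub>F n in sequentially. - (birkhoff_sum f n y / real n) < - m + r"
        by (auto simp: neg dest!: Limsup_lessD)
      have "\<forall>\<^sub>F n in sequentially. norm (birkhoff_sum f n y / real n - m) < r"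
        using 1 2 by eventually_elim auto
      then show "\<exists>no. \<forall>n\<ge>no. norm (birkhoff_sum f n y / real n - m) < r"
        by (simp add: eventually_sequentially)
    qed
  qed
  have avg_bd: "\<bar>birkhoff_sum f n y / real n\<bar> \<le> C" for n y
    using abs_birkhoff_sum_le[of f C n y, OF bd] C
    by (cases "n = 0") (auto simp: abs_divide field_simps)
  have "(\<lambda>n. \<integral>y. \<bar>birkhoff_sum f n y / real n - m\<bar> \<partial>M) \<longlonglongrightarrow> (\<integral>y. 0 \<partial>M)"
  proof (rule integral_dominated_convergence[where w = "\<lambda>_. C + \<bar>m\<bar>"])
    show "AE y in M. (\<lambda>n. \<bar>birkhoff_sum f n y / real n - m\<bar>) \<longlonglongrightarrow> 0"
      using conv by eventually_elim (simp add: tendsto_rabs_zero LIM_zero)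
    show "AE y in M. norm \<bar>birkhoff_sum f n y / real n - m\<bar> \<le> C + \<bar>m\<bar>" for n
    proof (intro always_eventually allI)
      fix y
      show "norm \<bar>birkhoff_sum f n y / real n - m\<bar> \<le> C + \<bar>m\<bar>"
        using avg_bd[of n y] unfolding real_norm_def by linarith
    qed
  qed auto
  then show ?thesis by (simp add: m_def)
qed

end

section \<open>Disintegration over a Polish space\<close>

lemma ternary_expansion_shift:
  fixes b :: "nat \<Rightarrow> bool"
  defines "s \<equiv> \<lambda>i. \<Sum>j. of_bool (b (j + i)) / 3 ^ Suc j :: real"
  shows "3 * s i = of_bool (b i) + s (Suc i)" "0 \<le> s i" "s i \<le> 1 / 2"
proof -
  have geo: "(\<lambda>j. (1 / 3) * (1 / 3) ^ j :: real) sums ((1 / 3) * (1 / (1 - 1 / 3)))"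
    by (intro sums_mult geometric_sums) simp
  have le: "of_bool (b (j + i)) / 3 ^ Suc j \<le> (1 / 3) * (1 / 3 :: real) ^ j" for i j
    by (simp add: power_divide)
  have summable: "summable (\<lambda>j. of_bool (b (j + i)) / 3 ^ Suc j :: real)" for i
    using sums_summable[OF geo] by (rule summable_comparison_test') (use le in auto)
  show "0 \<le> s i" unfolding s_def using summable by (intro suminf_nonneg) auto
  show "s i \<le> 1 / 2"
  proof -
    have "s i \<le> (\<Sum>j. (1 / 3) * (1 / 3) ^ j)"
      unfolding s_def by (rule suminf_le[OF le summable sums_summable[OF geo]])
    also have "\<dots> = 1 / 2" using sums_unique[OF geo] by simp
    finally show ?thesis .
  qed
  have "s i = (\<Sum>j. of_bool (b (Suc j + i)) / 3 ^ Suc (Suc j)) + of_bool (b i) / 3"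
    using suminf_split_head[OF summable[of i]] by (simp add: s_def)
  also have "(\<Sum>j. of_bool (b (Suc j + i)) / 3 ^ Suc (Suc j)) = s (Suc i) / 3"
    using suminf_divide[OF summable[of "Suc i"], of 3] by (simp add: s_def field_simps)
  finally show "3 * s i = of_bool (b i) + s (Suc i)" by simp
qed

text \<open>Base 3 with digits 0 and 1 keeps every tail at most 1/2, so no carry can occur and the
  integer part of a scaled code shows its last digit modulo 3. In base 2 a tail could reach 1 and
  the digits would be ambiguous.\<close>

lemma ternary_digit:
  fixes b :: "nat \<Rightarrow> bool"
  shows "\<lfloor>3 ^ Suc i * (\<Sum>j. of_bool (b j) / 3 ^ Suc j :: real)\<rfloor> mod 3 = of_bool (b i)"
proof -
  define s where "s i = (\<Sum>j. of_bool (b (j + i)) / 3 ^ Suc j :: real)" for i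
  note s = ternary_expansion_shift[of b, folded s_def]
  have step: "\<exists>m :: int. 3 ^ i * s 0 = of_int m + s i" for i
  proof (induction i)
    case 0 show ?case by (intro exI[of _ 0]) simp
  next
    case (Suc i)
    then obtain m :: int where "3 ^ i * s 0 = of_int m + s i" by blast
    then have "3 ^ Suc i * s 0 = of_int (3 * m + of_bool (b i)) + s (Suc i)"
      using s(1)[of i] by (simp add: algebra_simps)
    then show ?case by blast
  qed
  obtain m :: int where "3 ^ i * s 0 = of_int m + s i" using step by blast
  then have "3 ^ Suc i * s 0 = of_int (3 * m + of_bool (b i)) + s (Suc i)"
    using s(1)[of i] by (simp add: algebra_simps)
  then have "\<lfloor>3 ^ Suc i * s 0\<rfloor> = 3 * m + of_bool (b i)"
    using s(2)[of "Suc i"] s(3)[of "Suc i"] by (intro floor_unique) linarith+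
  then show ?thesis by (simp add: s_def)
qed

text \<open>A point is coded by the set of balls of radius \<open>1 / Suc n\<close> around a dense sequence that
  contain it; the decoding map reads off an approximating sequence and takes its limit.\<close>
lemma polish_retract_of_real:
  obtains c :: "'x::polish_space \<Rightarrow> real" and r :: "real \<Rightarrow> 'x"
  where "c \<in> borel_measurable borel" "r \<in> borel_measurable borel"
    "\<And>x. r (c x) = x" "\<And>x. 0 \<le> c x" "\<And>x. c x \<le> 1"
proof -
  obtain D :: "'x set" where D: "countable D" "\<And>X. open X \<Longrightarrow> X \<noteq> {} \<Longrightarrow> \<exists>d\<in>D. d \<in> X"
    using countable_dense_exists by blast
  have "D \<noteq> {}" using D(2)[of UNIV] by auto
  define e where "e = from_nat_into D"
  have dense: "\<exists>k. dist x (e k) < 1 / real (Suc n)" for x n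
    using D(2)[of "ball x (1 / real (Suc n))"] from_nat_into_surj[OF D(1)]
    by (auto simp: e_def)
  define near where "near i x \<longleftrightarrow> dist x (e (snd (prod_decode i))) < 1 / real (Suc (fst (prod_decode i)))" for i x
  define c where "c x = (\<Sum>j. of_bool (near j x) / 3 ^ Suc j :: real)" for x
  define digit where "digit i z \<longleftrightarrow> \<lfloor>3 ^ Suc i * z\<rfloor> mod 3 = 1" for i and z :: real
  define approx where "approx n z = e (LEAST k. digit (prod_encode (n, k)) z)" for n z
  \<comment> \<open>Off the range of \<open>c\<close> the decoded points need not converge.
    Replacing a sequence that is not Cauchy by a constant one makes \<open>r\<close> a limit of
    measurable functions on the whole line.\<close>
  define approx' where "approx' n z = (if Cauchy (\<lambda>n. approx n z) then approx n z else e 0)" for n z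
  define r where "r z = lim (\<lambda>n. approx' n z)" for z
  have digit_c: "digit i (c x) \<longleftrightarrow> near i x" for i x
    unfolding digit_def c_def ternary_digit by simp
  have approx_c: "dist x (approx n (c x)) < 1 / real (Suc n)" for n x
  proof -
    have "\<exists>k. digit (prod_encode (n, k)) (c x)"
      using dense[of x n] by (simp add: digit_c near_def)
    from LeastI_ex[OF this] show ?thesis
      unfolding approx_def by (simp add: digit_c near_def)
  qed
  have lim_c: "(\<lambda>n. approx n (c x)) \<longlonglongrightarrow> x" for x
  proof (rule metric_LIMSEQ_I)
    fix \<epsilon> :: real assume "0 < \<epsilon>"
    then obtain N where N: "inverse (real (Suc N)) < \<epsilon>" using reals_Archimedean by blast
    have "dist (approx n (c x)) x < \<epsilon>" if "n \<ge> N" for n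
    proof -
      have "dist (approx n (c x)) x < 1 / real (Suc n)"
        using approx_c[of x n] by (simp add: dist_commute)
      also have "\<dots> \<le> inverse (real (Suc N))"
        using that by (simp add: inverse_eq_divide frac_le)
      finally show ?thesis using N by simp
    qed
    then show "\<exists>no. \<forall>n\<ge>no. dist (approx n (c x)) x < \<epsilon>" by blast
  qed
  have r_c: "r (c x) = x" for x
    using lim_c[of x] LIMSEQ_imp_Cauchy[OF lim_c[of x]]
    by (simp add: r_def approx'_def limI)
  have [measurable]: "Measurable.pred borel (near i)" for i
    unfolding near_def[abs_def] by measurable
  have c_meas: "c \<in> borel_measurable borel"
    unfolding c_def[abs_def] by measurable
  have digit_meas [measurable]: "Measurable.pred borel (digit i)" for i
    unfolding digit_def[abs_def] by measurable
  have least_meas [measurable]: "(\<lambda>z. LEAST k. digit (prod_encode (n, k)) z) \<in> measurable borel (count_space UNIV)" for n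
    by measurable
  have approx_meas [measurable]: "approx n \<in> borel_measurable borel" for n
    unfolding approx_def[abs_def] by measurable
  have [measurable]: "{z \<in> space borel. Cauchy (\<lambda>n. approx n z)} \<in> sets borel"
    by measurable
  have approx'_meas [measurable]: "approx' n \<in> borel_measurable borel" for n
    unfolding approx'_def[abs_def] by measurable
  have r_meas: "r \<in> borel_measurable borel"
  proof (rule borel_measurable_LIMSEQ_metric[OF approx'_meas])
    fix z
    have "Cauchy (\<lambda>n. approx' n z)"
      by (cases "Cauchy (\<lambda>n. approx n z)")
         (auto simp: approx'_def intro!: LIMSEQ_imp_Cauchy[OF tendsto_const])
    then show "(\<lambda>n. approx' n z) \<longlonglongrightarrow> r z"
      unfolding r_def using Cauchy_convergent_iff convergent_LIMSEQ_iff by blast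
  qed
  have "0 \<le> c x" "c x \<le> 1" for x
    using ternary_expansion_shift(2,3)[of "\<lambda>j. near j x" 0] by (auto simp: c_def)
  with that[OF c_meas r_meas r_c] show ?thesis by blast
qed

section \<open>Conditional laws through quantile functions\<close>

lemma AE_le_of_set_nn_integral_le:
  assumes [measurable]: "f \<in> borel_measurable M" "g \<in> borel_measurable M"
    and fin: "(\<integral>\<^sup>+x. f x \<partial>M) < \<infinity>"
    and le: "\<And>A. A \<in> sets M \<Longrightarrow> (\<integral>\<^sup>+x. f x * indicator A x \<partial>M) \<le> (\<integral>\<^sup>+x. g x * indicator A x \<partial>M)"
  shows "AE x in M. f x \<le> g x"
proof -
  \<comment> \<open>The set on which the inequality fails is itself a test set. On it the positive
    difference has integral 0; finiteness of the integral of \<open>f\<close> keeps the subtraction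
    in \<open>ennreal\<close> meaningful.\<close>
  define A where "A = {x \<in> space M. g x < f x}"
  have [measurable]: "A \<in> sets M" unfolding A_def by measurable
  have gA_le: "(\<integral>\<^sup>+x. g x * indicator A x \<partial>M) \<le> (\<integral>\<^sup>+x. f x \<partial>M)"
    by (intro nn_integral_mono) (auto simp: A_def indicator_def)
  have "(\<integral>\<^sup>+x. f x * indicator A x - g x * indicator A x \<partial>M)
      = (\<integral>\<^sup>+x. f x * indicator A x \<partial>M) - (\<integral>\<^sup>+x. g x * indicator A x \<partial>M)"
    using le_less_trans[OF gA_le fin]
    by (intro nn_integral_diff) (auto simp: A_def indicator_def)
  also have "\<dots> = 0" using le_less_trans[OF gA_le fin] le[of A] by (simp add: diff_eq_0_iff_ennreal less_top)
  finally have "AE x in M. f x * indicator A x - g x * indicator A x = 0"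
    by (subst (asm) nn_integral_0_iff_AE) auto
  moreover have "AE x in M. f x \<noteq> \<infinity>"
    using fin by (intro nn_integral_PInf_AE) auto
  ultimately show ?thesis
    using AE_space
  proof eventually_elim
    case (elim x)
    show ?case
    proof (rule ccontr)
      assume "\<not> f x \<le> g x"
      with elim have "x \<in> A" by (simp add: A_def)
      with elim have "f x - g x = 0" by simp
      with elim \<open>\<not> f x \<le> g x\<close> show False by (simp add: diff_eq_0_iff_ennreal less_top)
    qed
  qed
qed

context prob_space begin

text \<open>\<open>G\<close> is the quantile function of the conditional law, so the kernel is obtained as an image of
  the uniform distribution and its measurability comes for free.\<close>
lemma real_disintegration:
  assumes W [measurable]: "W \<in> measurable M N" and Z [measurable]: "Z \<in> borel_measurable M"
    and Z01: "\<And>\<omega>. 0 \<le> Z \<omega>" "\<And>\<omega>. Z \<omega> \<le> 1"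
  defines "U \<equiv> uniform_measure lborel {0..1::real}"
  obtains G :: "'b \<Rightarrow> real \<Rightarrow> real"
  where "(\<lambda>(y, u). G y u) \<in> borel_measurable (N \<Otimes>\<^sub>M borel)"
    "distr M (N \<Otimes>\<^sub>M borel) (\<lambda>\<omega>. (W \<omega>, Z \<omega>))
       = distr (distr M N W \<Otimes>\<^sub>M U) (N \<Otimes>\<^sub>M borel) (\<lambda>(y, u). (y, G y u))"
proof -
  define P where "P = distr M N W"
  interpret P: prob_space P unfolding P_def by (rule prob_space_distr) simp
  have [measurable_cong, simp]: "sets P = sets N" and [simp]: "space P = space N"
    by (simp_all add: P_def)
  interpret U: prob_space U
    unfolding U_def by (rule prob_space_uniform_measure) auto
  have sets_U [measurable_cong, simp]: "sets U = sets borel" and [simp]: "space U = UNIV"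
    by (simp_all add: U_def)
  interpret PU: pair_prob_space P U ..
  \<comment> \<open>The density of this measure with respect to the law of \<open>W\<close> is the
    conditional distribution function of \<open>Z\<close> at \<open>q\<close> given
    \<open>W\<close>, obtained from the Radon-Nikodym theorem for each \<open>q\<close>
    separately.\<close>
  define \<kappa> where "\<kappa> q = distr (density M (indicator {\<omega> \<in> space M. Z \<omega> \<le> q})) N W" for q
  define F where "F q = RN_deriv P (\<kappa> q)" for q
  have F_meas [measurable]: "F q \<in> borel_measurable N" for q
    unfolding F_def using borel_measurable_RN_deriv[of P] by (simp cong: measurable_cong_sets)
  have emeasure_\<kappa>: "emeasure (\<kappa> q) B = emeasure M {\<omega> \<in> space M. W \<omega> \<in> B \<and> Z \<omega> \<le> q}"
    if [measurable]: "B \<in> sets N" for q B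
  proof -
    have "emeasure (\<kappa> q) B = (\<integral>\<^sup>+\<omega>. indicator {\<omega> \<in> space M. Z \<omega> \<le> q} \<omega> * indicator (W -` B \<inter> space M) \<omega> \<partial>M)"
      by (simp add: \<kappa>_def emeasure_distr emeasure_density)
    also have "\<dots> = (\<integral>\<^sup>+\<omega>. indicator {\<omega> \<in> space M. W \<omega> \<in> B \<and> Z \<omega> \<le> q} \<omega> \<partial>M)"
      by (intro nn_integral_cong) (auto simp: indicator_def)
    finally show ?thesis by simp
  qed
  have emeasure_P: "emeasure P B = emeasure M {\<omega> \<in> space M. W \<omega> \<in> B}" if "B \<in> sets N" for B
    using that by (simp add: P_def emeasure_distr vimage_def Int_def conj_commute)
  have F_int: "(\<integral>\<^sup>+y. F q y * indicator B y \<partial>P) = emeasure M {\<omega> \<in> space M. W \<omega> \<in> B \<and> Z \<omega> \<le> q}"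
    if [measurable]: "B \<in> sets N" for q B
  proof -
    have "absolutely_continuous P (\<kappa> q)"
      unfolding absolutely_continuous_def
    proof
      fix A assume A: "A \<in> null_sets P"
      then have [measurable]: "A \<in> sets N" by auto
      have "emeasure (\<kappa> q) A \<le> emeasure P A"
        unfolding emeasure_\<kappa>[OF \<open>A \<in> sets N\<close>] emeasure_P[OF \<open>A \<in> sets N\<close>]
        by (intro emeasure_mono) auto
      with A show "A \<in> null_sets (\<kappa> q)"
        by (auto simp: null_sets_def \<kappa>_def)
    qed
    then have "density P (F q) = \<kappa> q"
      unfolding F_def by (intro P.density_RN_deriv) (simp_all add: \<kappa>_def)
    then have "emeasure (density P (F q)) B = emeasure (\<kappa> q) B" by simp
    then show ?thesis by (simp add: emeasure_density emeasure_\<kappa>)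
  qed
  have F_fin: "(\<integral>\<^sup>+y. F q y \<partial>P) < \<infinity>" for q
  proof -
    have "(\<integral>\<^sup>+y. F q y \<partial>P) = (\<integral>\<^sup>+y. F q y * indicator (space N) y \<partial>P)"
      by (intro nn_integral_cong) auto
    then show ?thesis by (simp add: F_int emeasure_eq_measure)
  qed
  have F_mono: "AE y in P. F p y \<le> F q y" if "p \<le> q" for p q
    using F_fin that by (intro AE_le_of_set_nn_integral_le) (auto simp: F_int intro!: emeasure_mono)
  have F_le_1: "AE y in P. F q y \<le> 1" for q
    using F_fin by (intro AE_le_of_set_nn_integral_le)
      (auto simp: F_int emeasure_P intro!: emeasure_mono)
  \<comment> \<open>The subgraph of the conditional distribution function: its section over almost
    every \<open>y\<close> has uniform mass \<open>F p y\<close>. For \<open>c \<le> 1\<close> the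
    quantile is below \<open>c\<close> exactly when the point lies in \<open>H q\<close> for some
    rational \<open>q < c\<close> of the unit interval.\<close>
  define H where "H p = {(y, u). ennreal u \<le> F p y}" for p
  have emeasure_H: "emeasure (P \<Otimes>\<^sub>M U) {z \<in> space (P \<Otimes>\<^sub>M U). fst z \<in> B \<and> z \<in> H p}
      = emeasure M {\<omega> \<in> space M. W \<omega> \<in> B \<and> Z \<omega> \<le> p}" if [measurable]: "B \<in> sets N" for B p
  proof -
    have "emeasure (P \<Otimes>\<^sub>M U) {z \<in> space (P \<Otimes>\<^sub>M U). fst z \<in> B \<and> z \<in> H p}
        = (\<integral>\<^sup>+y. \<integral>\<^sup>+u. indicator {z \<in> space (P \<Otimes>\<^sub>M U). fst z \<in> B \<and> z \<in> H p} (y, u) \<partial>U \<partial>P)"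
      by (intro U.emeasure_pair_measure) (unfold H_def, measurable)
    also have "\<dots> = (\<integral>\<^sup>+y. F p y * indicator B y \<partial>P)"
    proof (rule nn_integral_cong_AE)
      show "AE y in P. (\<integral>\<^sup>+u. indicator {z \<in> space (P \<Otimes>\<^sub>M U). fst z \<in> B \<and> z \<in> H p} (y, u) \<partial>U)
          = F p y * indicator B y"
        using F_le_1[of p] AE_space
      proof eventually_elim
        case (elim y)
        have "F p y \<noteq> \<infinity>" using elim by (auto simp: top_unique)
        then obtain a where a: "F p y = ennreal a" "0 \<le> a"
          by (cases "F p y") auto
        with elim have "a \<le> 1" by simp
        have "(\<integral>\<^sup>+u. indicator {z \<in> space (P \<Otimes>\<^sub>M U). fst z \<in> B \<and> z \<in> H p} (y, u) \<partial>U)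
            = (\<integral>\<^sup>+u. indicator B y * indicator {..a} u \<partial>U)"
          using elim a by (intro nn_integral_cong)
            (auto simp: indicator_def H_def space_pair_measure ennreal_le_iff)
        also have "\<dots> = indicator B y * emeasure U {..a}" by (simp add: nn_integral_cmult)
        also have "emeasure U {..a} = ennreal a"
        proof -
          have "{0..1} \<inter> {..a} = {0..a}" using a \<open>a \<le> 1\<close> by auto
          then show ?thesis using a divide_ennreal[of a 1] by (simp add: U_def)
        qed
        finally show ?case using a by (simp add: mult.commute)
      qed
    qed
    finally show ?thesis by (simp add: F_int)
  qed
  \<comment> \<open>Rational levels keep the infimum countable, hence jointly measurable in both
    arguments. The fallback 1 is the upper bound of \<open>Z\<close>.\<close>
  define G where "G y u = (INF q\<in>\<rat> \<inter> {0..1}. if ennreal u \<le> F q y then q else 1)" for y and u :: real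
  have bdd: "bdd_below ((\<lambda>q. if ennreal u \<le> F q y then q else 1) ` (\<rat> \<inter> {0..1::real}))" for y u
    by (rule bdd_belowI[of _ 0]) auto
  have ne: "\<rat> \<inter> {0..1::real} \<noteq> {}" by (auto intro: exI[of _ 0])
  have G_meas: "(\<lambda>(y, u). G y u) \<in> borel_measurable (N \<Otimes>\<^sub>M borel)"
    unfolding G_def case_prod_beta
    by (intro borel_measurable_cINF bdd countable_Int1 countable_rat) measurable
  have [measurable]: "(\<lambda>z. G (fst z) (snd z)) \<in> borel_measurable (P \<Otimes>\<^sub>M U)"
    using G_meas measurable_cong_sets[OF sets_pair_measure_cong[OF \<open>sets P = sets N\<close> sets_U] refl]
    by (simp add: split_beta')
  have G_less: "G y u < c \<longleftrightarrow> (\<exists>q\<in>\<rat> \<inter> {0..1}. q < c \<and> (y, u) \<in> H q)" if "c \<le> 1" for y u c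
    unfolding G_def using that by (subst cINF_less_iff[OF ne bdd]) (auto simp: H_def split: if_splits)
  have G_less_all: "G y u < c" if "1 < c" for y u c
    unfolding G_def using that
    by (subst cINF_less_iff[OF ne bdd]) (auto intro!: bexI[of _ 1])
  have key: "emeasure (P \<Otimes>\<^sub>M U) {z \<in> space (P \<Otimes>\<^sub>M U). fst z \<in> B \<and> G (fst z) (snd z) < c}
      = emeasure M {\<omega> \<in> space M. W \<omega> \<in> B \<and> Z \<omega> < c}" if B [measurable]: "B \<in> sets N" for B c
  proof -
    consider "1 < c" | "c \<le> 0" | "0 < c" "c \<le> 1" by linarith
    then show ?thesis
    proof cases
      case 1
      have "Z \<omega> < c" for \<omega> using Z01(2)[of \<omega>] 1 by simp
      moreover have "{z \<in> space (P \<Otimes>\<^sub>M U). fst z \<in> B} = B \<times> space U"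
        using sets.sets_into_space[OF B] by (auto simp: space_pair_measure)
      ultimately show ?thesis
        using 1 by (simp add: G_less_all U.emeasure_pair_measure_Times emeasure_P
            U.emeasure_space_1[simplified])
    next
      case 2
      have "\<not> Z \<omega> < c" for \<omega> using Z01(1)[of \<omega>] 2 by simp
      moreover have "\<not> G y u < c" for y u using 2 by (auto simp: G_less)
      ultimately show ?thesis by simp
    next
      case 3
      \<comment> \<open>These are rational levels approaching \<open>c\<close> from below. Their
        running maxima \<open>p'\<close> increase, so that continuity from below applies to both
        measures.\<close>
      have "\<exists>p\<in>\<rat>. max 0 (c - 1 / real (Suc n)) < p \<and> p < c" for n
        using Rats_dense_in_real[of "max 0 (c - 1 / real (Suc n))" c] 3 by auto
      then obtain p where p: "\<And>n. p n \<in> \<rat>" "\<And>n. max 0 (c - 1 / real (Suc n)) < p n" "\<And>n. p n < c"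
        by metis
      define p' where "p' n = Max (p ` {..n})" for n
      have p'_in: "p' n \<in> p ` {..n}" for n unfolding p'_def by (intro Max_in) auto
      have p': "p' n \<in> \<rat> \<inter> {0..1}" "p' n < c" for n
        using p'_in[of n] p 3(2) by (auto simp: less_eq_real_def max_def split: if_splits) (smt (verit, best) p)+
      have p'_gt: "c - 1 / real (Suc n) < p' n" for n
      proof -
        have "p n \<le> p' n" unfolding p'_def by (intro Max_ge) auto
        then show ?thesis using p(2)[of n] by simp
      qed
      have inc: "p' m \<le> p' n" if "m \<le> n" for m n
        unfolding p'_def using that by (intro Max_mono) auto
      have ex_gt: "\<exists>n. q < p' n" if "q < c" for q
      proof -
        obtain n where "inverse (real (Suc n)) < c - q"
          using reals_Archimedean[of "c - q"] \<open>q < c\<close> by (meson diff_gt_0_iff_gt)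
        then show ?thesis using p'_gt[of n] by (auto simp: inverse_eq_divide intro!: exI[of _ n])
      qed
      \<comment> \<open>For each pair of levels, monotonicity holds only almost surely; rational
        levels leave countably many exceptional null sets.\<close>
      have mono: "AE z in P \<Otimes>\<^sub>M U. \<forall>q\<in>\<rat>. \<forall>q'\<in>\<rat>. q \<le> q' \<longrightarrow> z \<in> H q \<longrightarrow> z \<in> H q'"
      proof -
        have "AE y in P. \<forall>q\<in>\<rat>. \<forall>q'\<in>\<rat>. q \<le> q' \<longrightarrow> F q y \<le> F q' y"
          using F_mono by (auto simp: AE_ball_countable countable_rat)
        then have "AE z in P \<Otimes>\<^sub>M U. \<forall>q\<in>\<rat>. \<forall>q'\<in>\<rat>. q \<le> q' \<longrightarrow> F q (fst z) \<le> F q' (fst z)"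
          using AE_distrD[of fst "P \<Otimes>\<^sub>M U" P "\<lambda>y. \<forall>q\<in>\<rat>. \<forall>q'\<in>\<rat>. q \<le> q' \<longrightarrow> F q y \<le> F q' y"]
          unfolding U.distr_pair_fst by simp
        then show ?thesis
        proof eventually_elim
          case (elim z)
          show ?case
          proof (intro ballI impI)
            fix q q' assume "q \<in> \<rat>" "q' \<in> \<rat>" "q \<le> q'" and z: "z \<in> H q"
            then have "F q (fst z) \<le> F q' (fst z)" using elim by blast
            with z show "z \<in> H q'" by (cases z) (simp add: H_def)
          qed
        qed
      qed
      define S where "S n = {z \<in> space (P \<Otimes>\<^sub>M U). fst z \<in> B \<and> (\<exists>k\<le>n. z \<in> H (p' k))}" for n
      have S_meas [measurable]: "S n \<in> sets (P \<Otimes>\<^sub>M U)" for n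
        unfolding S_def H_def by measurable
      have "emeasure (P \<Otimes>\<^sub>M U) {z \<in> space (P \<Otimes>\<^sub>M U). fst z \<in> B \<and> G (fst z) (snd z) < c}
          = emeasure (P \<Otimes>\<^sub>M U) (\<Union>n. S n)"
      proof (rule emeasure_eq_AE)
        show "AE z in P \<Otimes>\<^sub>M U. z \<in> {z \<in> space (P \<Otimes>\<^sub>M U). fst z \<in> B \<and> G (fst z) (snd z) < c}
            \<longleftrightarrow> z \<in> (\<Union>n. S n)"
          using mono
        proof eventually_elim
          case (elim z)
          have "(\<exists>q\<in>\<rat> \<inter> {0..1}. q < c \<and> z \<in> H q) \<longleftrightarrow> (\<exists>n. z \<in> H (p' n))"
          proof
            assume "\<exists>q\<in>\<rat> \<inter> {0..1}. q < c \<and> z \<in> H q"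
            then obtain q where q: "q \<in> \<rat>" "q < c" "z \<in> H q" by auto
            obtain n where "q < p' n" using ex_gt q by blast
            then show "\<exists>n. z \<in> H (p' n)" using elim q p'(1)[of n] by (intro exI[of _ n]) auto
          qed (use p' in blast)
          then show ?case
            using 3 by (cases z) (auto simp: S_def G_less)
        qed
        show "{z \<in> space (P \<Otimes>\<^sub>M U). fst z \<in> B \<and> G (fst z) (snd z) < c} \<in> sets (P \<Otimes>\<^sub>M U)"
          by measurable
      qed measurable
      also have "\<dots> = (SUP n. emeasure (P \<Otimes>\<^sub>M U) (S n))"
      proof (rule SUP_emeasure_incseq[symmetric])
        show "incseq S" by (rule incseq_SucI) (auto simp: S_def intro: le_SucI)
      qed (use S_meas in blast)
      also have "\<dots> = (SUP n. emeasure M {\<omega> \<in> space M. W \<omega> \<in> B \<and> Z \<omega> \<le> p' n})"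
      proof (intro SUP_cong refl)
        fix n
        have "emeasure (P \<Otimes>\<^sub>M U) (S n)
            = emeasure (P \<Otimes>\<^sub>M U) {z \<in> space (P \<Otimes>\<^sub>M U). fst z \<in> B \<and> z \<in> H (p' n)}"
        proof (rule emeasure_eq_AE)
          show "AE z in P \<Otimes>\<^sub>M U. z \<in> S n
              \<longleftrightarrow> z \<in> {z \<in> space (P \<Otimes>\<^sub>M U). fst z \<in> B \<and> z \<in> H (p' n)}"
            using mono
          proof eventually_elim
            case (elim z)
            have "z \<in> H (p' n)" if "z \<in> H (p' k)" "k \<le> n" for k
              using elim that p'(1) inc by blast
            then show ?case by (auto simp: S_def)
          qed
          show "{z \<in> space (P \<Otimes>\<^sub>M U). fst z \<in> B \<and> z \<in> H (p' n)} \<in> sets (P \<Otimes>\<^sub>M U)"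
            unfolding H_def by measurable
        qed measurable
        then show "emeasure (P \<Otimes>\<^sub>M U) (S n) = emeasure M {\<omega> \<in> space M. W \<omega> \<in> B \<and> Z \<omega> \<le> p' n}"
          by (simp add: emeasure_H)
      qed
      also have "\<dots> = emeasure M (\<Union>n. {\<omega> \<in> space M. W \<omega> \<in> B \<and> Z \<omega> \<le> p' n})"
        by (intro SUP_emeasure_incseq incseq_SucI) (auto intro: order_trans[OF _ inc])
      also have "(\<Union>n. {\<omega> \<in> space M. W \<omega> \<in> B \<and> Z \<omega> \<le> p' n}) = {\<omega> \<in> space M. W \<omega> \<in> B \<and> Z \<omega> < c}"
      proof -
        have "\<exists>n. Z \<omega> \<le> p' n" if "Z \<omega> < c" for \<omega>
          using ex_gt[OF that] less_imp_le by blast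
        then show ?thesis using le_less_trans[OF _ p'(2)] by blast
      qed
      finally show ?thesis .
    qed
  qed
  \<comment> \<open>Rectangles with open half-lines form an intersection-stable generator, and
    \<open>key\<close> is the equality of both laws on them.\<close>
  define E where "E = {B \<times> {..<c} | B c. B \<in> sets N \<and> c \<in> (UNIV :: real set)}"
  have "distr M (N \<Otimes>\<^sub>M borel) (\<lambda>\<omega>. (W \<omega>, Z \<omega>))
       = distr (P \<Otimes>\<^sub>M U) (N \<Otimes>\<^sub>M borel) (\<lambda>(y, u). (y, G y u))"
  proof (rule measure_eqI_generator_eq[where E = E and \<Omega> = "space N \<times> UNIV"
        and A = "\<lambda>n. space N \<times> {..<real n}"])
    show "Int_stable E"
    proof (rule Int_stableI)
      fix a b assume "a \<in> E" "b \<in> E"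
      then obtain B c B' c' where *: "a = B \<times> {..<c}" "b = B' \<times> {..<c'}" "B \<in> sets N" "B' \<in> sets N"
        unfolding E_def by blast
      then have "a \<inter> b = (B \<inter> B') \<times> {..<min c c'}" by auto
      with * show "a \<inter> b \<in> E" unfolding E_def by blast
    qed
    show "E \<subseteq> Pow (space N \<times> UNIV)"
      using sets.sets_into_space by (fastforce simp: E_def)
    have "sets (N \<Otimes>\<^sub>M borel) = sigma_sets (space N \<times> UNIV) E"
    proof
      have E_sub: "E \<subseteq> Pow (space N \<times> UNIV)"
        using sets.sets_into_space by (fastforce simp: E_def)
      define S where "S = sigma (space N \<times> (UNIV :: real set)) E"
      have sets_S: "sets S = sigma_sets (space N \<times> UNIV) E" and space_S: "space S = space N \<times> UNIV"
        unfolding S_def using E_sub by (simp_all add: sets_measure_of space_measure_of)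
      have E_S: "e \<in> sets S" if "e \<in> E" for e
        using that by (simp add: sets_S)
      have "fst \<in> measurable S N"
      proof (rule measurableI)
        fix B assume B: "B \<in> sets N"
        have "fst -` B \<inter> space S = (\<Union>n. B \<times> {..<real n})"
          using sets.sets_into_space[OF B] reals_Archimedean2 by (auto simp: space_S)
        also have "\<dots> \<in> sets S" using B by (intro sets.countable_UN image_subsetI E_S) (auto simp: E_def)
        finally show "fst -` B \<inter> space S \<in> sets S" .
      qed (auto simp: space_S)
      moreover have "snd \<in> borel_measurable S"
        unfolding borel_measurable_iff_less
      proof
        fix a :: real
        have "{w \<in> space S. snd w < a} = space N \<times> {..<a}" by (auto simp: space_S)
        also have "\<dots> \<in> sets S" by (rule E_S) (auto simp: E_def)
        finally show "{w \<in> space S. snd w < a} \<in> sets S" .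
      qed
      ultimately have "(\<lambda>x. x) \<in> measurable S (N \<Otimes>\<^sub>M borel)"
        by (simp add: measurable_pair_iff comp_def)
      then have "x \<inter> space S \<in> sets S" if "x \<in> sets (N \<Otimes>\<^sub>M borel)" for x
        using measurable_sets[of "\<lambda>x. x" S "N \<Otimes>\<^sub>M borel" x] that by simp
      moreover have "x \<inter> space S = x" if "x \<in> sets (N \<Otimes>\<^sub>M borel)" for x
        using sets.sets_into_space[OF that] by (auto simp: space_S space_pair_measure)
      ultimately show "sets (N \<Otimes>\<^sub>M borel) \<subseteq> sigma_sets (space N \<times> UNIV) E"
        unfolding sets_S[symmetric] by auto
      have "E \<subseteq> sets (N \<Otimes>\<^sub>M borel)" by (auto simp: E_def)
      then show "sigma_sets (space N \<times> UNIV) E \<subseteq> sets (N \<Otimes>\<^sub>M (borel :: real measure))"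
        using sets.sigma_sets_subset[of E "N \<Otimes>\<^sub>M (borel :: real measure)"]
        by (simp add: space_pair_measure)
    qed
    then show "sets (distr M (N \<Otimes>\<^sub>M borel) (\<lambda>\<omega>. (W \<omega>, Z \<omega>))) = sigma_sets (space N \<times> UNIV) E"
      "sets (distr (P \<Otimes>\<^sub>M U) (N \<Otimes>\<^sub>M borel) (\<lambda>(y, u). (y, G y u))) = sigma_sets (space N \<times> UNIV) E"
      by simp_all
    show "range (\<lambda>n. space N \<times> {..<real n}) \<subseteq> E" by (auto simp: E_def)
    show "(\<Union>n. space N \<times> {..<real n}) = space N \<times> UNIV"
      using reals_Archimedean2 by auto
    show "emeasure (distr M (N \<Otimes>\<^sub>M borel) (\<lambda>\<omega>. (W \<omega>, Z \<omega>))) (space N \<times> {..<real n}) \<noteq> \<infinity>" for n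
      by (simp add: emeasure_distr emeasure_eq_measure)
    fix X assume "X \<in> E"
    then obtain B c where X: "X = B \<times> {..<c}" and [measurable]: "B \<in> sets N"
      unfolding E_def by blast
    have "emeasure (distr M (N \<Otimes>\<^sub>M borel) (\<lambda>\<omega>. (W \<omega>, Z \<omega>))) X
        = emeasure M {\<omega> \<in> space M. W \<omega> \<in> B \<and> Z \<omega> < c}"
      by (auto simp: X emeasure_distr intro!: arg_cong[where f = "emeasure M"])
    also have "\<dots> = emeasure (P \<Otimes>\<^sub>M U) {z \<in> space (P \<Otimes>\<^sub>M U). fst z \<in> B \<and> G (fst z) (snd z) < c}"
      by (simp add: key)
    also have "\<dots> = emeasure (distr (P \<Otimes>\<^sub>M U) (N \<Otimes>\<^sub>M borel) (\<lambda>(y, u). (y, G y u))) X"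
      using G_meas
      by (subst emeasure_distr)
        (auto simp: X split_beta' intro!: arg_cong[where f = "emeasure (P \<Otimes>\<^sub>M U)"])
    finally show "emeasure (distr M (N \<Otimes>\<^sub>M borel) (\<lambda>\<omega>. (W \<omega>, Z \<omega>))) X
        = emeasure (distr (P \<Otimes>\<^sub>M U) (N \<Otimes>\<^sub>M borel) (\<lambda>(y, u). (y, G y u))) X" .
  qed
  with G_meas show ?thesis by (intro that) (simp_all add: P_def)
qed

text \<open>Code the state as a number in the unit interval, take the conditional quantile of the
  code, and decode. Decoding inverts coding at every point, so the image of the uniform distribution
  under \<open>r\<close> after \<open>G y\<close> is the conditional law of the state
  itself.\<close>

theorem disintegration:
  fixes X :: "'a \<Rightarrow> 'x::polish_space"
  assumes W [measurable]: "W \<in> measurable M N" and X [measurable]: "X \<in> borel_measurable M"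
  obtains \<rho> where "\<rho> \<in> measurable N (subprob_algebra borel)" "\<And>y. prob_space (\<rho> y)"
    "\<And>f. f \<in> borel_measurable (N \<Otimes>\<^sub>M borel) \<Longrightarrow>
       (\<integral>\<^sup>+\<omega>. f (W \<omega>, X \<omega>) \<partial>M) = (\<integral>\<^sup>+\<omega>. \<integral>\<^sup>+x. f (W \<omega>, x) \<partial>\<rho> (W \<omega>) \<partial>M)"
proof -
  obtain c :: "'x \<Rightarrow> real" and r where c [measurable]: "c \<in> borel_measurable borel"
    and r [measurable]: "r \<in> borel_measurable borel"
    and rc: "\<And>x. r (c x) = x" and c01: "\<And>x. 0 \<le> c x" "\<And>x. c x \<le> 1"
    using polish_retract_of_real by blast
  define U where "U = uniform_measure lborel {0..1::real}"
  interpret U: prob_space U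
    unfolding U_def by (rule prob_space_uniform_measure) auto
  have sets_U [measurable_cong, simp]: "sets U = sets borel" and [simp]: "space U = UNIV"
    by (simp_all add: U_def)
  obtain G where G [measurable]: "(\<lambda>(y, u). G y u) \<in> borel_measurable (N \<Otimes>\<^sub>M borel)"
    and G_eq: "distr M (N \<Otimes>\<^sub>M borel) (\<lambda>\<omega>. (W \<omega>, c (X \<omega>)))
       = distr (distr M N W \<Otimes>\<^sub>M U) (N \<Otimes>\<^sub>M borel) (\<lambda>(y, u). (y, G y u))"
    using real_disintegration[OF W, of "\<lambda>\<omega>. c (X \<omega>)"] c01 unfolding U_def by auto
  \<comment> \<open>Off \<open>space N\<close> an arbitrary point mass is used, so that every
    \<open>\<rho> y\<close> is a probability measure.\<close>
  define \<rho> where "\<rho> y = (if y \<in> space N then distr U borel (\<lambda>u. r (G y u)) else return borel (r 0))" for y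
  have G_y [measurable]: "G y \<in> borel_measurable borel" if "y \<in> space N" for y
    using measurable_Pair2[OF G that] by simp
  show ?thesis
  proof (rule that)
    show prob: "prob_space (\<rho> y)" for y
      unfolding \<rho>_def by (auto intro!: U.prob_space_distr prob_space_return)
    show "\<rho> \<in> measurable N (subprob_algebra borel)"
    proof (rule measurable_subprob_algebra)
      fix A :: "'x set" assume [measurable]: "A \<in> sets borel"
      have "(\<lambda>y. \<integral>\<^sup>+u. indicator A (r (G y u)) \<partial>U) \<in> borel_measurable N"
        by measurable
      also have "?this \<longleftrightarrow> (\<lambda>y. emeasure (\<rho> y) A) \<in> borel_measurable N"
      proof (rule measurable_cong)
        fix y assume y [measurable]: "y \<in> space N"
        have \<rho>_y: "\<rho> y = distr U borel (\<lambda>u. r (G y u))" using y by (simp add: \<rho>_def)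
        have "(\<integral>\<^sup>+u. indicator A (r (G y u)) \<partial>U) = (\<integral>\<^sup>+x. indicator A x \<partial>\<rho> y)"
          unfolding \<rho>_y by (rule nn_integral_distr[symmetric]) measurable
        then show "(\<integral>\<^sup>+u. indicator A (r (G y u)) \<partial>U) = emeasure (\<rho> y) A"
          by (simp add: \<rho>_y)
      qed
      finally show "(\<lambda>y. emeasure (\<rho> y) A) \<in> borel_measurable N" .
    qed (simp_all add: prob prob_space_imp_subprob_space, simp add: \<rho>_def)
    fix f :: "'b \<times> 'x \<Rightarrow> ennreal" assume f [measurable]: "f \<in> borel_measurable (N \<Otimes>\<^sub>M borel)"
    have "(\<integral>\<^sup>+\<omega>. f (W \<omega>, X \<omega>) \<partial>M) = (\<integral>\<^sup>+z. f (fst z, r (snd z)) \<partial>distr M (N \<Otimes>\<^sub>M borel) (\<lambda>\<omega>. (W \<omega>, c (X \<omega>))))"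
      by (simp add: nn_integral_distr rc)
    also have "\<dots> = (\<integral>\<^sup>+z. f (fst z, r (G (fst z) (snd z))) \<partial>(distr M N W \<Otimes>\<^sub>M U))"
      unfolding G_eq by (subst nn_integral_distr) (auto simp: split_beta')
    also have "\<dots> = (\<integral>\<^sup>+y. \<integral>\<^sup>+u. f (y, r (G y u)) \<partial>U \<partial>distr M N W)"
      by (subst U.nn_integral_fst[symmetric]) auto
    also have "\<dots> = (\<integral>\<^sup>+\<omega>. \<integral>\<^sup>+u. f (W \<omega>, r (G (W \<omega>) u)) \<partial>U \<partial>M)"
      by (simp add: nn_integral_distr)
    also have "\<dots> = (\<integral>\<^sup>+\<omega>. \<integral>\<^sup>+x. f (W \<omega>, x) \<partial>\<rho> (W \<omega>) \<partial>M)"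
    proof (rule nn_integral_cong)
      fix \<omega> assume "\<omega> \<in> space M"
      then have W_N [measurable]: "W \<omega> \<in> space N" using measurable_space[OF W] by blast
      have "(\<lambda>x. f (W \<omega>, x)) \<in> borel_measurable borel" by measurable
      then show "(\<integral>\<^sup>+u. f (W \<omega>, r (G (W \<omega>) u)) \<partial>U) = (\<integral>\<^sup>+x. f (W \<omega>, x) \<partial>\<rho> (W \<omega>))"
        by (simp add: \<rho>_def nn_integral_distr W_N)
    qed
    finally show "(\<integral>\<^sup>+\<omega>. f (W \<omega>, X \<omega>) \<partial>M) = (\<integral>\<^sup>+\<omega>. \<integral>\<^sup>+x. f (W \<omega>, x) \<partial>\<rho> (W \<omega>) \<partial>M)" .
  qed
qed

end

section \<open>Kernels parametrized by an environment\<close>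

lemma integral_diff_le:
  fixes f w :: "'x::topological_space \<Rightarrow> real"
  assumes p: "prob_space p" "prob_space p'"
    and int: "integrable p f" "integrable p' f" "integrable p w" "integrable p' w"
    and le: "\<And>z z'. f z - f z' \<le> c + w z + w z'"
  shows "(\<integral>z. f z \<partial>p) - (\<integral>z. f z \<partial>p') \<le> c + (\<integral>z. w z \<partial>p) + (\<integral>z. w z \<partial>p')"
proof -
  interpret p: prob_space p by fact
  interpret p': prob_space p' by fact
  \<comment> \<open>The bound separates the two variables, so \<open>z\<close> is integrated out
    with \<open>z'\<close> fixed, and \<open>z'\<close> afterwards; no joint law of \<open>p\<close>
    and \<open>p'\<close> enters.\<close>
  have "(\<integral>z. f z \<partial>p) - c - (\<integral>z. w z \<partial>p) \<le> w z' + f z'" for z'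
  proof -
    have "(\<integral>z. f z \<partial>p) \<le> (\<integral>z. w z + (c + w z' + f z') \<partial>p)"
      by (rule integral_mono) (use int le[of _ z'] in \<open>auto simp: algebra_simps\<close>)
    also have "\<dots> = (\<integral>z. w z \<partial>p) + (c + w z' + f z')"
      using int by (simp add: p.prob_space)
    finally show ?thesis by simp
  qed
  then have "(\<integral>z'. (\<integral>z. f z \<partial>p) - c - (\<integral>z. w z \<partial>p) \<partial>p') \<le> (\<integral>z'. w z' + f z' \<partial>p')"
    using int by (intro integral_mono) auto
  then show ?thesis using int by (simp add: p'.prob_space)
qed

lemma integral_minorized:
  fixes F :: "'x::topological_space \<Rightarrow> real"
  assumes p: "prob_space p" "sets p = sets borel" and n: "prob_space n" "sets n = sets borel"
    and minor: "\<And>B. B \<in> sets borel \<Longrightarrow> c * measure n B \<le> measure p B" and "0 \<le> c"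
    and F: "F \<in> borel_measurable borel" "\<And>z. 0 \<le> F z" "\<And>z. F z \<le> C"
  shows "c * (\<integral>z. F z \<partial>n) \<le> (\<integral>z. F z \<partial>p)"
proof -
  interpret p: prob_space p by fact
  interpret n: prob_space n by fact
  have [measurable_cong]: "sets p = sets borel" "sets n = sets borel" by fact+
  note F(1)[measurable]
  have int: "integrable p F" "integrable n F"
    using F by (auto intro!: p.integrable_const_bound[where B = C] n.integrable_const_bound[where B = C])
  have "scale_measure (ennreal c) n \<le> p"
  proof (subst le_measure)
    show "\<forall>B\<in>sets (scale_measure (ennreal c) n). emeasure (scale_measure (ennreal c) n) B \<le> emeasure p B"
      using minor \<open>0 \<le> c\<close> n
      by (auto simp: n.emeasure_eq_measure p.emeasure_eq_measure ennreal_mult[symmetric] intro!: ennreal_leI)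
  qed (simp add: p n)
  then have "(\<integral>\<^sup>+z. ennreal (F z) \<partial>scale_measure (ennreal c) n) \<le> (\<integral>\<^sup>+z. ennreal (F z) \<partial>p)"
    by (intro nn_integral_mono_measure) (simp_all add: p n)
  then have "ennreal (c * (\<integral>z. F z \<partial>n)) \<le> ennreal (\<integral>z. F z \<partial>p)"
    using int F \<open>0 \<le> c\<close>
    by (simp add: nn_integral_scale_measure nn_integral_eq_integral ennreal_mult)
  then show ?thesis using F by (subst (asm) ennreal_le_iff) auto
qed

text \<open>Both integrals contain \<open>c\<close> times the same integral against \<open>n\<close>; the remaining mass
  \<open>1 - c\<close> is compared through the infimum of \<open>f + h\<close>.\<close>
lemma integral_diff_le_minorized:
  fixes f h :: "'x::topological_space \<Rightarrow> real"
  assumes p: "prob_space p" "sets p = sets borel" and p': "prob_space p'" "sets p' = sets borel"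
    and n: "prob_space n" "sets n = sets borel"
    and minor: "\<And>B. B \<in> sets borel \<Longrightarrow> c * measure n B \<le> measure p B"
      "\<And>B. B \<in> sets borel \<Longrightarrow> c * measure n B \<le> measure p' B" and c: "0 \<le> c"
    and f: "f \<in> borel_measurable borel" "\<And>z. \<bar>f z\<bar> \<le> C"
    and h: "h \<in> borel_measurable borel" "\<And>z. \<bar>h z\<bar> \<le> C'" "\<And>z. 0 \<le> h z"
    and le: "\<And>z z'. f z - f z' \<le> a + h z + h z'"
  shows "(\<integral>z. f z \<partial>p) - (\<integral>z. f z \<partial>p') \<le> (1 - c) * a + (\<integral>z. h z \<partial>p) + (\<integral>z. h z \<partial>p')"
proof -
  interpret p: prob_space p by fact
  interpret p': prob_space p' by fact
  interpret n: prob_space n by fact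
  have [measurable_cong]: "sets p = sets borel" "sets p' = sets borel" "sets n = sets borel" by fact+
  note f(1)[measurable] h(1)[measurable]
  have int: "integrable p f" "integrable p' f" "integrable n f"
    using f by (auto intro!: p.integrable_const_bound[where B = C] p'.integrable_const_bound[where B = C]
      n.integrable_const_bound[where B = C])
  have int_h: "integrable p h" "integrable p' h" "integrable n h"
    using h(2) by (auto intro!: p.integrable_const_bound[where B = C'] p'.integrable_const_bound[where B = C']
      n.integrable_const_bound[where B = C'])
  note int = int int_h
  define d where "d = (INF z. f z + h z)"
  have lower: "- (C + C') \<le> f z + h z" and upper: "f z + h z \<le> C + C'" "- (C + C') \<le> f z - h z" for z
    using f(2)[of z] h(2)[of z] by linarith+
  have d_le: "d \<le> f z + h z" for z
    unfolding d_def by (rule cINF_lower) (auto intro: bdd_belowI2 lower)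
  have d_ge: "f z - h z \<le> a + d" for z
  proof -
    have "f z - h z - a \<le> d"
      unfolding d_def
    proof (rule cINF_greatest)
      show "f z - h z - a \<le> f z' + h z'" for z' using le[of z z'] by simp
    qed simp
    then show ?thesis by simp
  qed
  have d_bd: "d \<le> C + C'" "- (C + C') \<le> d"
    using d_le[of undefined] upper(1)[of undefined] lower unfolding d_def
    by (auto intro!: cINF_greatest)
  have "c * (\<integral>z. a + d - (f z - h z) \<partial>n) \<le> (\<integral>z. a + d - (f z - h z) \<partial>p)"
    by (rule integral_minorized[OF p n minor(1) c, where C = "a + (C + C') + (C + C')"])
      (use d_ge d_bd upper(2) in \<open>auto simp: algebra_simps intro: order_trans add_mono\<close>)
  then have 1: "c * (a + d - ((\<integral>z. f z \<partial>n) - (\<integral>z. h z \<partial>n))) \<le> a + d - ((\<integral>z. f z \<partial>p) - (\<integral>z. h z \<partial>p))"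
    using int by (simp add: p.prob_space n.prob_space)
  have "c * (\<integral>z. f z + h z - d \<partial>n) \<le> (\<integral>z. f z + h z - d \<partial>p')"
    by (rule integral_minorized[OF p' n minor(2) c, where C = "(C + C') + (C + C')"])
      (use d_le d_bd(2) order_trans[OF upper(1)] in \<open>auto simp: diff_le_eq\<close>)
  then have 2: "c * ((\<integral>z. f z \<partial>n) + (\<integral>z. h z \<partial>n) - d) \<le> (\<integral>z. f z \<partial>p') + (\<integral>z. h z \<partial>p') - d"
    using int by (simp add: p'.prob_space n.prob_space)
  \<comment> \<open>When 1 and 2 are added, the integrals of \<open>f\<close> against
    \<open>n\<close> cancel, as does \<open>d\<close>. A nonnegative multiple of the integral of
    \<open>h\<close> against \<open>n\<close> is left over and discarded.\<close>
  have "0 \<le> c * (\<integral>z. h z \<partial>n)" using c h by simp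
  with 1 2 show ?thesis by (simp add: algebra_simps)
qed

section \<open>Path space, shift and transition operator\<close>

abbreviation path_space :: "(int \<Rightarrow> 'y::topological_space) measure" where
  "path_space \<equiv> Pi\<^sub>M UNIV (\<lambda>_. borel)"

definition shift :: "(int \<Rightarrow> 'y) \<Rightarrow> int \<Rightarrow> 'y" where
  "shift y t = y (t + 1)"

lemma shift_measurable [measurable]: "shift \<in> measurable path_space path_space"
  unfolding shift_def[abs_def] by (rule measurable_PiM_single') auto

lemma shift_pow: "(shift ^^ n) y t = y (t + int n)"
  by (induction n arbitrary: y t) (simp_all add: shift_def funpow_Suc_right algebra_simps del: funpow.simps(2))

text \<open>Pushing \<open>L x\<close> forward under the map from \<open>y\<close> to
  \<open>(x, y)\<close> moves the parameter from the integrand into the measure, where measurability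
  of the integral of a fixed function applies.\<close>

lemma integral_measurable_kernel:
  fixes f :: "'a \<Rightarrow> 'b \<Rightarrow> real"
  assumes f [measurable]: "(\<lambda>(x, y). f x y) \<in> borel_measurable (M \<Otimes>\<^sub>M N)"
    and L [measurable]: "L \<in> measurable M (subprob_algebra N)"
  shows "(\<lambda>x. \<integral>y. f x y \<partial>L x) \<in> borel_measurable M"
proof -
  note measurable_distr2 [measurable]
  have "(\<lambda>x. integral\<^sup>L (distr (L x) (M \<Otimes>\<^sub>M N) (\<lambda>y. (x, y))) (\<lambda>(x, y). f x y)) \<in> borel_measurable M"
    by measurable
  then show ?thesis
    by (rule measurable_cong[THEN iffD1, rotated]) (simp add: integral_distr)
qed

definition bounded_measurable :: "((int \<Rightarrow> 'y::topological_space) \<Rightarrow> 'x::topological_space \<Rightarrow> real) \<Rightarrow> bool" where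
  "bounded_measurable f \<longleftrightarrow> (\<lambda>(y, x). f y x) \<in> borel_measurable (path_space \<Otimes>\<^sub>M borel)
     \<and> (\<exists>C. \<forall>y x. \<bar>f y x\<bar> \<le> C)"

text \<open>This is the Markov operator of the skew product of environment and state. Each step also
  shifts the environment, so the powers of one operator describe the time-inhomogeneous chain in a
  fixed environment.\<close>

definition transition ::
  "('y \<Rightarrow> 'x \<Rightarrow> 'x measure) \<Rightarrow> ((int \<Rightarrow> 'y) \<Rightarrow> 'x \<Rightarrow> real) \<Rightarrow> (int \<Rightarrow> 'y) \<Rightarrow> 'x \<Rightarrow> real" where
  "transition Q f y x = (\<integral>z. f (shift y) z \<partial>Q (y 0) x)"

lemma bounded_measurable_section:
  fixes f :: "(int \<Rightarrow> 'y::topological_space) \<Rightarrow> 'x::topological_space \<Rightarrow> real"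
  assumes "bounded_measurable f"
  shows "f y \<in> borel_measurable borel"
proof -
  have "(\<lambda>(y, x). f y x) \<in> borel_measurable (path_space \<Otimes>\<^sub>M borel)"
    using assms by (simp add: bounded_measurable_def)
  from measurable_Pair2[OF this, of y] show ?thesis by (simp add: space_PiM)
qed

locale env_kernels =
  fixes Q :: "'y::polish_space \<Rightarrow> 'x::polish_space \<Rightarrow> 'x measure"
  assumes kernels: "prob_kernels Q"
begin

lemma prob_space_Q: "prob_space (Q y x)" and sets_Q [measurable_cong]: "sets (Q y x) = sets borel"
  using kernels by (auto simp: prob_kernels_def)

lemma Q_measurable [measurable]: "(\<lambda>(y, x). Q y x) \<in> measurable (borel \<Otimes>\<^sub>M borel) (subprob_algebra borel)"
proof (rule measurable_subprob_algebra)
  fix B :: "'x set" assume "B \<in> sets borel"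
  then have "(\<lambda>(y, x). measure (Q y x) B) \<in> borel_measurable (borel \<Otimes>\<^sub>M borel)"
    using kernels by (auto simp: prob_kernels_def)
  then have "(\<lambda>z. ennreal (measure (Q (fst z) (snd z)) B)) \<in> borel_measurable (borel \<Otimes>\<^sub>M borel)"
    by (simp add: split_beta')
  then show "(\<lambda>z. emeasure (case z of (y, x) \<Rightarrow> Q y x) B) \<in> borel_measurable (borel \<Otimes>\<^sub>M borel)"
    by (simp add: split_beta' finite_measure.emeasure_eq_measure[OF prob_space.finite_measure[OF prob_space_Q]])
qed (auto simp: split_beta' sets_Q prob_space_imp_subprob_space[OF prob_space_Q])

lemma integrable_Q:
  assumes "bounded_measurable f"
  shows "integrable (Q y' x) (f y)"
proof -
  obtain C where C: "\<And>y x. \<bar>f y x\<bar> \<le> C" using assms by (auto simp: bounded_measurable_def)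
  show ?thesis
    using bounded_measurable_section[OF assms] C
    by (intro finite_measure.integrable_const_bound[OF prob_space.finite_measure[OF prob_space_Q], where B = C])
       (auto simp: sets_Q cong: measurable_cong_sets)
qed

lemma abs_transition_le:
  assumes f: "bounded_measurable f" and C: "\<And>y x. \<bar>f y x\<bar> \<le> C"
  shows "\<bar>transition Q f y x\<bar> \<le> C"
proof -
  interpret prob_space "Q (y 0) x" by (rule prob_space_Q)
  have "\<bar>transition Q f y x\<bar> \<le> (\<integral>z. \<bar>f (shift y) z\<bar> \<partial>Q (y 0) x)"
    unfolding transition_def by (rule integral_abs_bound)
  also have "\<dots> \<le> (\<integral>z. C \<partial>Q (y 0) x)"
    using integrable_Q[OF f] C by (intro integral_mono) auto
  finally show ?thesis by (simp add: prob_space)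
qed

lemma bounded_measurable_transition:
  assumes f: "bounded_measurable f"
  shows "bounded_measurable (transition Q f)"
proof -
  have [measurable]: "(\<lambda>(y, x). f y x) \<in> borel_measurable (path_space \<Otimes>\<^sub>M borel)"
    and "\<exists>C. \<forall>y x. \<bar>f y x\<bar> \<le> C" using f by (auto simp: bounded_measurable_def)
  then obtain C where C: "\<And>y x. \<bar>f y x\<bar> \<le> C" by blast
  have [measurable]: "(\<lambda>w. Q (fst w 0) (snd w)) \<in> measurable (path_space \<Otimes>\<^sub>M borel) (subprob_algebra borel)"
    using measurable_compose[OF _ Q_measurable, of "\<lambda>w :: (int \<Rightarrow> 'y) \<times> 'x. (fst w 0, snd w)" "path_space \<Otimes>\<^sub>M borel"]
    by simp
  have "(\<lambda>w. \<integral>z. f (shift (fst w)) z \<partial>Q (fst w 0) (snd w)) \<in> borel_measurable (path_space \<Otimes>\<^sub>M borel)"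
    by (rule integral_measurable_kernel[where N = borel]) measurable
  then show ?thesis
    using abs_transition_le[OF f C] by (auto simp: bounded_measurable_def transition_def split_beta')
qed

lemma bounded_measurable_funpow:
  "bounded_measurable f \<Longrightarrow> bounded_measurable ((transition Q ^^ n) f)"
  by (induction n) (auto intro: bounded_measurable_transition)

lemma abs_funpow_le:
  assumes "bounded_measurable f" and "\<And>y x. \<bar>f y x\<bar> \<le> C"
  shows "\<bar>(transition Q ^^ n) f y x\<bar> \<le> C"
  using assms by (induction n arbitrary: y x) (auto intro: abs_transition_le bounded_measurable_funpow)

lemma funpow_nonneg:
  assumes "\<And>y x. 0 \<le> f y x"
  shows "0 \<le> (transition Q ^^ n) f y x"
  using assms by (induction n arbitrary: y x) (auto simp: transition_def)

end

section \<open>Contraction over blocks\<close>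

locale contractive_kernels = env_kernels Q
  for Q :: "'y::polish_space \<Rightarrow> 'x::polish_space \<Rightarrow> 'x measure" +
  fixes V :: "'x \<Rightarrow> real" and lev :: "'y \<Rightarrow> nat" and lam K \<alpha> :: "nat \<Rightarrow> real"
    and \<nu> :: "nat \<Rightarrow> 'x measure"
  assumes V_measurable [measurable]: "V \<in> borel_measurable borel" and V_nonneg: "0 \<le> V x"
    and lev_measurable [measurable]: "lev \<in> measurable borel (count_space UNIV)"
    and lam_antimono: "antimono lam" and lam_bounds: "0 < lam n" "lam n \<le> 1/3"
    and K_ge_1: "1 \<le> K n"
    and drift: "(\<integral>\<^sup>+z. ennreal (V z) \<partial>Q y x) \<le> ennreal ((1 - lam (lev y)) * V x + K (lev y))"
    and \<alpha>_antimono: "antimono \<alpha>" and \<alpha>_bounds: "0 < \<alpha> n" "\<alpha> n \<le> 1/3"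
    and \<nu>: "prob_space (\<nu> n)" "sets (\<nu> n) = sets borel"
    and minorization: "V x \<le> 8 * K (lev y) / lam (lev y) \<Longrightarrow> B \<in> sets borel \<Longrightarrow>
      \<alpha> (lev y) * measure (\<nu> (lev y)) B \<le> measure (Q y x) B"
begin

lemma integrable_V: "integrable (Q y x) V"
  and integral_V_le: "(\<integral>z. V z \<partial>Q y x) \<le> (1 - lam (lev y)) * V x + K (lev y)"
proof -
  have nonneg: "0 \<le> (1 - lam (lev y)) * V x + K (lev y)"
    using lam_bounds[of "lev y"] K_ge_1[of "lev y"] V_nonneg[of x] by simp
  have "(\<integral>\<^sup>+z. ennreal (norm (V z)) \<partial>Q y x) < \<infinity>"
    using drift[of y x] by (simp add: V_nonneg le_less_trans)
  then show int: "integrable (Q y x) V"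
    by (intro integrableI_bounded) (simp_all cong: measurable_cong_sets[OF sets_Q])
  show "(\<integral>z. V z \<partial>Q y x) \<le> (1 - lam (lev y)) * V x + K (lev y)"
    using drift[of y x] nonneg
    by (simp add: nn_integral_eq_integral[OF int] V_nonneg ennreal_le_iff)
qed

context
  fixes f h :: "(int \<Rightarrow> 'y) \<Rightarrow> 'x \<Rightarrow> real"
  assumes f: "bounded_measurable f" and h: "bounded_measurable h" and h_nonneg: "\<And>y x. 0 \<le> h y x"
begin

lemma transition_diff_le:
  assumes "\<And>z z'. f (shift y) z - f (shift y) z' \<le> a + h (shift y) z + h (shift y) z'"
  shows "transition Q f y x - transition Q f y x' \<le> a + transition Q h y x + transition Q h y x'"
  unfolding transition_def
  by (rule integral_diff_le[OF prob_space_Q prob_space_Q]) (auto intro: integrable_Q f h assms)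

text \<open>Because \<open>V\<close> is nonnegative, a small sum puts both states into the small set
  of the current level, and both transition laws then dominate the same multiple of the same
  measure. Passing from the current level to \<open>N\<close> only weakens the contraction.\<close>

lemma transition_diff_le_small:
  assumes small: "V x + V x' \<le> 8 * K (lev (y 0)) / lam (lev (y 0))" and N: "lev (y 0) \<le> N" and "0 \<le> a"
    and le: "\<And>z z'. f (shift y) z - f (shift y) z' \<le> a + h (shift y) z + h (shift y) z'"
  shows "transition Q f y x - transition Q f y x' \<le> (1 - \<alpha> N) * a + transition Q h y x + transition Q h y x'"
proof -
  obtain C where C: "\<And>y x. \<bar>f y x\<bar> \<le> C" using f by (auto simp: bounded_measurable_def)
  obtain C' where C': "\<And>y x. \<bar>h y x\<bar> \<le> C'" using h by (auto simp: bounded_measurable_def)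
  have V: "V x \<le> 8 * K (lev (y 0)) / lam (lev (y 0))" "V x' \<le> 8 * K (lev (y 0)) / lam (lev (y 0))"
    using small V_nonneg[of x] V_nonneg[of x'] by linarith+
  have "transition Q f y x - transition Q f y x'
      \<le> (1 - \<alpha> (lev (y 0))) * a + transition Q h y x + transition Q h y x'"
    unfolding transition_def
    by (rule integral_diff_le_minorized[OF prob_space_Q sets_Q prob_space_Q sets_Q \<nu>,
          OF minorization[OF V(1)] minorization[OF V(2)]])
       (auto intro: bounded_measurable_section f h C C' h_nonneg le less_imp_le[OF \<alpha>_bounds(1)])
  moreover have "(1 - \<alpha> (lev (y 0))) * a \<le> (1 - \<alpha> N) * a"
    using \<open>0 \<le> a\<close> antimonoD[OF \<alpha>_antimono N] by (intro mult_right_mono) auto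
  ultimately show ?thesis by simp
qed

text \<open>Above the threshold the two additive constants \<open>K\<close> use up at most a quarter
  of the decrease of \<open>V x + V x'\<close> by the factor \<open>lam\<close>; this is the origin
  of 3/4.\<close>

lemma transition_diff_le_drift:
  assumes large: "8 * K (lev (y 0)) / lam (lev (y 0)) \<le> V x + V x'" and N: "lev (y 0) \<le> N" and b: "0 \<le> b"
    and le: "\<And>z z'. f (shift y) z - f (shift y) z' \<le> c + b * (V z + V z') + h (shift y) z + h (shift y) z'"
  shows "transition Q f y x - transition Q f y x'
    \<le> c + b * (1 - 3 * lam N / 4) * (V x + V x') + transition Q h y x + transition Q h y x'"
proof -
  let ?n = "lev (y 0)"
  have "transition Q f y x - transition Q f y x' \<le> c
      + (\<integral>z. b * V z + h (shift y) z \<partial>Q (y 0) x) + (\<integral>z. b * V z + h (shift y) z \<partial>Q (y 0) x')"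
    unfolding transition_def
  proof (rule integral_diff_le[OF prob_space_Q prob_space_Q])
    show "f (shift y) z - f (shift y) z' \<le> c + (b * V z + h (shift y) z) + (b * V z' + h (shift y) z')" for z z'
      using le[of z z'] by (simp add: algebra_simps)
  qed (intro integrable_Q f h integrable_V Bochner_Integration.integrable_add integrable_mult_right)+
  also have "\<dots> = c + b * ((\<integral>z. V z \<partial>Q (y 0) x) + (\<integral>z. V z \<partial>Q (y 0) x'))
      + transition Q h y x + transition Q h y x'"
    using integrable_Q[OF h] integrable_V by (simp add: transition_def algebra_simps)
  also have "(\<integral>z. V z \<partial>Q (y 0) x) + (\<integral>z. V z \<partial>Q (y 0) x') \<le> (1 - 3 * lam N / 4) * (V x + V x')"
  proof -
    have "8 * K ?n \<le> lam ?n * (V x + V x')"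
      using large lam_bounds(1)[of ?n] by (simp add: pos_divide_le_eq mult.commute)
    moreover have "lam N * (V x + V x') \<le> lam ?n * (V x + V x')"
      using antimonoD[OF lam_antimono N] V_nonneg by (intro mult_right_mono add_nonneg_nonneg) auto
    moreover have "(\<integral>z. V z \<partial>Q (y 0) x) + (\<integral>z. V z \<partial>Q (y 0) x')
        \<le> (V x + V x') - lam ?n * (V x + V x') + 2 * K ?n"
      using integral_V_le[of "y 0" x] integral_V_le[of "y 0" x'] by (simp add: algebra_simps)
    moreover have "(1 - 3 * lam N / 4) * (V x + V x') = (V x + V x') - 3 / 4 * (lam N * (V x + V x'))"
      by (simp add: field_simps)
    ultimately show ?thesis by linarith
  qed
  finally show ?thesis using b by (simp add: mult_left_mono mult.assoc)
qed

end

text \<open>This fixes the normalization of the \<open>V\<close> term below. Outside the small set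
  \<open>V x + V x'\<close> is at least 24, so the term with coefficient
  \<open>\<alpha> N * a / 24\<close> makes up for the missing contraction
  \<open>\<alpha> N * a\<close>.\<close>

lemma threshold_ge: "24 \<le> 8 * K n / lam n"
proof -
  have "24 * lam n \<le> 8 * K n" using lam_bounds[of n] K_ge_1[of n] by linarith
  then show ?thesis using lam_bounds(1)[of n] by (simp add: pos_le_divide_eq)
qed

text \<open>Either the pair enters a small set within the block, which contracts \<open>a\<close>, or the drift
  inequality makes \<open>V\<close> decay along the whole block.\<close>
lemma block_diff_le:
  assumes f: "bounded_measurable f" and h: "bounded_measurable h" and h_nonneg: "\<And>y x. 0 \<le> h y x"
    and a: "0 \<le> a" and lev: "\<And>i. i \<le> H \<Longrightarrow> lev (y (int i)) \<le> N"
    and le: "\<And>z z'. f ((shift ^^ Suc H) y) z - f ((shift ^^ Suc H) y) z'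
      \<le> a + h ((shift ^^ Suc H) y) z + h ((shift ^^ Suc H) y) z'"
  defines "F \<equiv> \<lambda>n. (transition Q ^^ n) f" and "G \<equiv> \<lambda>n. (transition Q ^^ n) h"
  shows "F (Suc H) y x - F (Suc H) y x' \<le> min a ((1 - \<alpha> N) * a
      + \<alpha> N * a / 24 * (1 - 3 * lam N / 4) ^ H * (V x + V x')) + G (Suc H) y x + G (Suc H) y x'"
  using lev le
\<comment> \<open>The minimum keeps two bounds alive in the induction: entering the small set uses
  the plain bound \<open>a\<close>, staying outside uses the bound with \<open>V\<close>, whose
  coefficient gains one decaying factor per step.\<close>
proof (induction H arbitrary: y x x')
  case 0
  let ?R = "8 * K (lev (y 0)) / lam (lev (y 0))"
  have le0: "f (shift y) z - f (shift y) z' \<le> a + h (shift y) z + h (shift y) z'" for z z'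
    using 0(2) by simp
  have 1: "F (Suc 0) y x - F (Suc 0) y x' \<le> a + G (Suc 0) y x + G (Suc 0) y x'"
    unfolding F_def G_def using transition_diff_le[OF f h h_nonneg le0] by simp
  have "F (Suc 0) y x - F (Suc 0) y x' \<le> (1 - \<alpha> N) * a + \<alpha> N * a / 24 * (V x + V x')
      + G (Suc 0) y x + G (Suc 0) y x'"
  proof (cases "V x + V x' \<le> ?R")
    case True
    have "0 \<le> \<alpha> N * a / 24 * (V x + V x')"
      using a \<alpha>_bounds(1)[of N] V_nonneg[of x] V_nonneg[of x'] by simp
    then show ?thesis
      using transition_diff_le_small[OF f h h_nonneg True _ a le0, of N] 0(1)[of 0]
      by (simp add: F_def G_def)
  next
    case False
    \<comment> \<open>No drift is spent on the last step of the block: the \<open>V\<close> term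
      alone is at least \<open>\<alpha> N * a\<close>, so the second bound follows from the first.
      Hence the exponent is \<open>H\<close> although the block has \<open>Suc H\<close>
      steps.\<close>
    then have "24 \<le> V x + V x'" using threshold_ge[of "lev (y 0)"] by linarith
    then have "\<alpha> N * a / 24 * 24 \<le> \<alpha> N * a / 24 * (V x + V x')"
      using a \<alpha>_bounds(1)[of N] by (intro mult_left_mono) auto
    moreover have "(1 - \<alpha> N) * a = a - \<alpha> N * a" by (simp add: algebra_simps)
    ultimately show ?thesis using 1 by linarith
  qed
  with 1 show ?case by (simp add: min_def)
next
  case (Suc H)
  let ?R = "8 * K (lev (y 0)) / lam (lev (y 0))" and ?q = "1 - 3 * lam N / 4"
  have lev': "lev (shift y (int i)) \<le> N" if "i \<le> H" for i
    using Suc.prems(1)[of "Suc i"] that by (simp add: shift_def add.commute)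
  have le': "f ((shift ^^ Suc H) (shift y)) z - f ((shift ^^ Suc H) (shift y)) z'
      \<le> a + h ((shift ^^ Suc H) (shift y)) z + h ((shift ^^ Suc H) (shift y)) z'" for z z'
    using Suc.prems(2)[of z z'] by (simp only: funpow_Suc_right[of "Suc H"] o_apply)
  have F: "bounded_measurable (F n)" and G: "bounded_measurable (G n)" and G_nonneg: "0 \<le> G n y x" for n y x
    unfolding F_def G_def using f h h_nonneg by (auto intro: bounded_measurable_funpow funpow_nonneg)
  have F_Suc: "F (Suc n) = transition Q (F n)" and G_Suc: "G (Suc n) = transition Q (G n)" for n
    by (simp_all add: F_def G_def)
  have IH1: "F (Suc H) (shift y) z - F (Suc H) (shift y) z'
      \<le> a + G (Suc H) (shift y) z + G (Suc H) (shift y) z'" for z z'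
    using Suc.IH[OF lev' le', of z z'] by linarith
  have IH2: "F (Suc H) (shift y) z - F (Suc H) (shift y) z'
      \<le> (1 - \<alpha> N) * a + \<alpha> N * a / 24 * ?q ^ H * (V z + V z')
        + G (Suc H) (shift y) z + G (Suc H) (shift y) z'" for z z'
    using Suc.IH[OF lev' le', of z z'] by linarith
  have 1: "F (Suc (Suc H)) y x - F (Suc (Suc H)) y x'
      \<le> a + G (Suc (Suc H)) y x + G (Suc (Suc H)) y x'"
    unfolding F_Suc[of "Suc H"] G_Suc[of "Suc H"]
    by (rule transition_diff_le[OF F G G_nonneg IH1])
  have q: "0 \<le> ?q" using lam_bounds(2)[of N] by simp
  have b: "0 \<le> \<alpha> N * a / 24 * ?q ^ n" for n using a \<alpha>_bounds(1)[of N] q by simp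
  have "F (Suc (Suc H)) y x - F (Suc (Suc H)) y x'
      \<le> (1 - \<alpha> N) * a + \<alpha> N * a / 24 * ?q ^ Suc H * (V x + V x')
        + G (Suc (Suc H)) y x + G (Suc (Suc H)) y x'"
  proof (cases "V x + V x' \<le> ?R")
    case True
    have "0 \<le> \<alpha> N * a / 24 * ?q ^ Suc H * (V x + V x')"
      by (intro mult_nonneg_nonneg[OF b] add_nonneg_nonneg V_nonneg)
    moreover have "transition Q (F (Suc H)) y x - transition Q (F (Suc H)) y x'
        \<le> (1 - \<alpha> N) * a + transition Q (G (Suc H)) y x + transition Q (G (Suc H)) y x'"
      using Suc.prems(1)[of 0] by (intro transition_diff_le_small[OF F G G_nonneg True _ a IH1]) auto
    ultimately show ?thesis unfolding F_Suc[of "Suc H"] G_Suc[of "Suc H"] by linarith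
  next
    case False
    then have "transition Q (F (Suc H)) y x - transition Q (F (Suc H)) y x'
        \<le> (1 - \<alpha> N) * a + \<alpha> N * a / 24 * ?q ^ H * ?q * (V x + V x')
          + transition Q (G (Suc H)) y x + transition Q (G (Suc H)) y x'"
      using Suc.prems(1)[of 0]
      by (intro transition_diff_le_drift[OF F G G_nonneg _ _ b IH2]) auto
    then show ?thesis
      unfolding F_Suc[of "Suc H"] G_Suc[of "Suc H"] by (simp add: mult.assoc mult.commute[of ?q])
  qed
  with 1 show ?case by (simp add: min_def)
qed

lemma funpow_diff_le:
  assumes f: "bounded_measurable f" and h: "bounded_measurable h" and h_nonneg: "\<And>y x. 0 \<le> h y x"
    and le: "\<And>y z z'. f y z - f y z' \<le> a + h y z + h y z'"
  shows "(transition Q ^^ n) f y x - (transition Q ^^ n) f y x'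
    \<le> a + (transition Q ^^ n) h y x + (transition Q ^^ n) h y x'"
proof (induction n arbitrary: y x x')
  case (Suc n)
  show ?case
    unfolding funpow.simps o_apply
    by (intro transition_diff_le bounded_measurable_funpow funpow_nonneg f h h_nonneg Suc.IH)
qed (simp add: le)

text \<open>The state is tested only at the start of the block, since the drift estimate takes over
  from there. The environment is tested at all \<open>H + 1\<close> times whose kernels are
  used.\<close>

definition bad_block :: "real \<Rightarrow> nat \<Rightarrow> nat \<Rightarrow> (int \<Rightarrow> 'y) \<Rightarrow> 'x \<Rightarrow> real" where
  "bad_block L N H y x = of_bool (L < V x) + of_bool (\<exists>j\<le>H. N < lev (y (int j)))"

lemma bounded_measurable_bad_block: "bounded_measurable (bad_block L N H)"
proof -
  have "\<bar>bad_block L N H y x\<bar> \<le> 2" for y x by (simp add: bad_block_def)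
  then show ?thesis unfolding bounded_measurable_def bad_block_def split_beta' by (intro conjI exI) (measurable, auto)
qed

lemma bad_block_nonneg: "0 \<le> bad_block L N H y x"
  by (simp add: bad_block_def)

text \<open>In a good block the \<open>V\<close> term is at most \<open>\<alpha> N / 2 * a\<close>,
  so half of the gain \<open>\<alpha> N * a\<close> survives. Otherwise \<open>bad_block\<close> is
  at least 1 for one of the two states, and adding \<open>\<alpha> N / 2 * a\<close> times it brings
  the trivial bound \<open>a\<close> into the same form.\<close>

lemma block_contraction:
  assumes f: "bounded_measurable f" and h: "bounded_measurable h" and h_nonneg: "\<And>y x. 0 \<le> h y x"
    and a: "0 \<le> a" and le: "\<And>y z z'. f y z - f y z' \<le> a + h y z + h y z'"
    and L: "0 < L" and decay: "(1 - 3 * lam N / 4) ^ H \<le> 6 / L"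
  defines "g \<equiv> \<lambda>y x. (transition Q ^^ Suc H) h y x + \<alpha> N / 2 * a * bad_block L N H y x"
  shows "(transition Q ^^ Suc H) f y x - (transition Q ^^ Suc H) f y x' \<le> (1 - \<alpha> N / 2) * a + g y x + g y x'"
proof -
  define F where "F = (transition Q ^^ Suc H) f"
  define G where "G = (transition Q ^^ Suc H) h"
  have \<alpha>a: "0 \<le> \<alpha> N / 2 * a" using a \<alpha>_bounds(1)[of N] by simp
  have weak: "F y x - F y x' \<le> a + G y x + G y x'"
    unfolding F_def G_def by (rule funpow_diff_le[OF f h h_nonneg le])
  have "F y x - F y x' \<le> (1 - \<alpha> N / 2) * a + (G y x + \<alpha> N / 2 * a * bad_block L N H y x)
      + (G y x' + \<alpha> N / 2 * a * bad_block L N H y x')"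
  proof (cases "bad_block L N H y x = 0 \<and> bad_block L N H y x' = 0")
    case True
    then have V: "V x \<le> L" "V x' \<le> L" and lev: "\<And>j. j \<le> H \<Longrightarrow> lev (y (int j)) \<le> N"
      by (auto simp: bad_block_def of_bool_def not_less split: if_splits)
    \<comment> \<open>Both states satisfy \<open>V \<le> L\<close>, so the threshold
      \<open>6 / L\<close> on the power produces the factor 12 / 24, that is 1/2.\<close>
    have "\<alpha> N * a / 24 * (1 - 3 * lam N / 4) ^ H * (V x + V x') \<le> \<alpha> N * a / 24 * (6 / L) * (2 * L)"
      using \<alpha>a decay V V_nonneg[of x] V_nonneg[of x'] lam_bounds(2)[of N] L
      by (intro mult_mono mult_left_mono mult_nonneg_nonneg zero_le_power) auto
    also have "\<dots> = \<alpha> N / 2 * a" using L by simp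
    finally have "F y x - F y x' \<le> (1 - \<alpha> N) * a + \<alpha> N / 2 * a + G y x + G y x'"
      using block_diff_le[where H = H and N = N and y = y, OF f h h_nonneg a lev le, of x x']
      unfolding F_def G_def by linarith
    then show ?thesis using True by (simp add: algebra_simps)
  next
    case False
    have ge1: "bad_block L N H y z = 0 \<or> 1 \<le> bad_block L N H y z" for z
      by (auto simp: bad_block_def)
    have "1 \<le> bad_block L N H y x + bad_block L N H y x'"
      using False ge1[of x] ge1[of x'] bad_block_nonneg[of L N H y x] bad_block_nonneg[of L N H y x'] by linarith
    then have "\<alpha> N / 2 * a * 1 \<le> \<alpha> N / 2 * a * (bad_block L N H y x + bad_block L N H y x')"
      by (rule mult_left_mono) (rule \<alpha>a)
    then show ?thesis using weak by (simp add: algebra_simps)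
  qed
  then show ?thesis by (simp add: F_def G_def g_def)
qed

end

section \<open>The process in the environment\<close>

locale chain_in_environment = prob_space M + env_kernels Q
  for M :: "'w measure" and Q :: "'y::polish_space \<Rightarrow> 'x::polish_space \<Rightarrow> 'x measure" +
  fixes Y :: "int \<Rightarrow> 'w \<Rightarrow> 'y" and X :: "nat \<Rightarrow> 'w \<Rightarrow> 'x"
  assumes Y_measurable [measurable]: "Y t \<in> borel_measurable M"
    and process: "process_in_environment M Y X Q"
begin

lemma X_measurable [measurable]: "X i \<in> borel_measurable M"
  using process by (simp add: process_in_environment_def)

definition path :: "nat \<Rightarrow> 'w \<Rightarrow> int \<Rightarrow> 'y" where
  "path i \<omega> t = Y (t + int i) \<omega>"

lemma path_measurable [measurable]: "path i \<in> measurable M path_space"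
  unfolding path_def[abs_def] by (rule measurable_PiM_single') auto

lemma path_add: "path (i + n) \<omega> = (shift ^^ n) (path i \<omega>)"
  by (rule ext) (simp add: path_def shift_pow algebra_simps)

lemma path_Suc: "path (Suc i) \<omega> = shift (path i \<omega>)"
  using path_add[of i 1] by simp

abbreviation history :: "nat \<Rightarrow> 'w measure" where
  "history \<equiv> env_filtration M Y X"

lemma env_filtration_generators:
  "{Y j -` B \<inter> space M | j B. B \<in> sets borel} \<union> {X j -` B \<inter> space M | j B. j \<le> t \<and> B \<in> sets borel}
    \<subseteq> sets M"
  by auto

lemma space_history [simp]: "space (history t) = space M"
  by (simp add: env_filtration_def space_measure_of_conv)

lemma sets_history: "sets (history t) = sigma_sets (space M)
    ({Y j -` B \<inter> space M | j B. B \<in> sets borel} \<union> {X j -` B \<inter> space M | j B. j \<le> t \<and> B \<in> sets borel})"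
  unfolding env_filtration_def by (rule sets_measure_of) auto

lemma subalgebra_history: "subalgebra M (history t)"
  using sets.sigma_sets_subset[OF env_filtration_generators]
  by (simp add: subalgebra_def sets_history)

sublocale history: finite_measure_subalgebra M "history t" for t
  by standard (rule subalgebra_history)

lemma history_mono:
  assumes "s \<le> t"
  shows "sets (history s) \<subseteq> sets (history t)"
  unfolding sets_history
  by (intro sigma_sets_mono' Un_mono order_refl) (use assms in \<open>blast intro: order_trans\<close>)

lemma measurable_history_mono:
  "s \<le> t \<Longrightarrow> f \<in> borel_measurable (history s) \<Longrightarrow> f \<in> borel_measurable (history t)"
  using history_mono by (auto simp: measurable_def)

lemma measurable_history_M: "f \<in> measurable (history t) N \<Longrightarrow> f \<in> measurable M N"
  by (rule measurable_from_subalg[OF subalgebra_history])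

lemma Y_history [measurable]: "Y j \<in> borel_measurable (history t)"
  by (rule measurableI) (auto simp: sets_history intro!: sigma_sets.Basic)

lemma X_history: "j \<le> t \<Longrightarrow> X j \<in> borel_measurable (history t)"
  by (rule measurableI) (auto simp: sets_history intro!: sigma_sets.Basic)

lemma X_history_self [measurable]: "X t \<in> borel_measurable (history t)"
  by (rule X_history) simp

lemma path_history [measurable]: "path i \<in> measurable (history t) path_space"
  unfolding path_def[abs_def] by (rule measurable_PiM_single') auto

lemma bounded_measurable_compose:
  assumes "bounded_measurable f" and "g \<in> measurable N path_space" and "X' \<in> borel_measurable N"
  shows "(\<lambda>\<omega>. f (g \<omega>) (X' \<omega>)) \<in> borel_measurable N"
  using measurable_compose[OF measurable_Pair[OF assms(2,3)], of "\<lambda>(y, x). f y x" borel] assms(1)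
  by (simp add: bounded_measurable_def)

lemma integrable_bounded_measurable:
  assumes f: "bounded_measurable f"
  shows "integrable M (\<lambda>\<omega>. f (path i \<omega>) (X j \<omega>))"
proof -
  obtain C where "\<And>y x. \<bar>f y x\<bar> \<le> C" using f by (auto simp: bounded_measurable_def)
  then show ?thesis
    by (intro integrable_const_bound[where B = C] bounded_measurable_compose[OF f]) auto
qed

lemma kernel_history [measurable]: "(\<lambda>\<omega>. Q (Y (int t) \<omega>) (X t \<omega>)) \<in> measurable (history t) (subprob_algebra borel)"
  using measurable_compose[OF _ Q_measurable, of "\<lambda>\<omega>. (Y (int t) \<omega>, X t \<omega>)" "history t"] by simp

text \<open>Tested on an event of the history, the almost sure identity for one \<open>A\<close>
  becomes an identity of numbers. Such identities can be collected over all \<open>A\<close> without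
  a common null set.\<close>

lemma one_step_sets:
  assumes E: "E \<in> sets (history t)" and A: "A \<in> sets borel"
  shows "emeasure M {\<omega> \<in> E. X (Suc t) \<omega> \<in> A}
    = (\<integral>\<^sup>+\<omega>. indicator E \<omega> * emeasure (Q (Y (int t) \<omega>) (X t \<omega>)) A \<partial>M)"
proof -
  have E_M [measurable]: "E \<in> sets M" using E subalgebra_history by (auto simp: subalgebra_def)
  note A [measurable]
  have E_sub: "E \<subseteq> space M" using sets.sets_into_space[OF E_M] .
  have indE: "indicator E \<in> borel_measurable (history t)" using E by simp
  have meas_Q: "(\<lambda>\<omega>. measure (Q (Y (int t) \<omega>) (X t \<omega>)) A) \<in> borel_measurable M"
    by (intro measurable_history_M[of _ t] measurable_compose[OF kernel_history] measurable_measure_subprob_algebra A)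
  have int: "integrable M (\<lambda>\<omega>. indicator E \<omega> * indicator A (X (Suc t) \<omega>) :: real)"
    by (rule integrable_const_bound[where B = 1]) (auto simp: indicator_def)
  have "measure M {\<omega> \<in> E. X (Suc t) \<omega> \<in> A} = (\<integral>\<omega>. indicator E \<omega> * indicator A (X (Suc t) \<omega>) \<partial>M)"
  proof -
    have eq: "indicator E \<omega> * indicator A (X (Suc t) \<omega>) = (indicator {\<omega> \<in> E. X (Suc t) \<omega> \<in> A} \<omega> :: real)" for \<omega>
      by (auto simp: indicator_def)
    have "{\<omega> \<in> E. X (Suc t) \<omega> \<in> A} = E \<inter> (X (Suc t) -` A \<inter> space M)" using E_sub by auto
    then have "{\<omega> \<in> E. X (Suc t) \<omega> \<in> A} \<in> sets M" by simp
    then show ?thesis unfolding eq by simp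
  qed
  also have "\<dots> = (\<integral>\<omega>. indicator E \<omega> * real_cond_exp M (history t) (\<lambda>\<omega>. indicator A (X (Suc t) \<omega>)) \<omega> \<partial>M)"
    by (intro history.real_cond_exp_intg(2)[symmetric] int indE) measurable
  also have "\<dots> = (\<integral>\<omega>. indicator E \<omega> * measure (Q (Y (int t) \<omega>) (X t \<omega>)) A \<partial>M)"
  proof (rule integral_cong_AE)
    have "AE \<omega> in M. real_cond_exp M (history t) (\<lambda>\<omega>'. indicator A (X (Suc t) \<omega>')) \<omega>
        = measure (Q (Y (int t) \<omega>) (X t \<omega>)) A"
      using process A by (simp add: process_in_environment_def)
    then show "AE \<omega> in M. indicator E \<omega> * real_cond_exp M (history t) (\<lambda>\<omega>. indicator A (X (Suc t) \<omega>)) \<omega>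
        = indicator E \<omega> * measure (Q (Y (int t) \<omega>) (X t \<omega>)) A"
      by eventually_elim simp
  qed (use meas_Q in measurable)
  also have "\<dots> = enn2real (\<integral>\<^sup>+\<omega>. indicator E \<omega> * emeasure (Q (Y (int t) \<omega>) (X t \<omega>)) A \<partial>M)"
    using meas_Q by (subst integral_eq_nn_integral)
      (auto intro!: nn_integral_cong arg_cong[where f = enn2real] simp: indicator_def
        finite_measure.emeasure_eq_measure[OF prob_space.finite_measure[OF prob_space_Q]])
  finally have eq: "measure M {\<omega> \<in> E. X (Suc t) \<omega> \<in> A}
      = enn2real (\<integral>\<^sup>+\<omega>. indicator E \<omega> * emeasure (Q (Y (int t) \<omega>) (X t \<omega>)) A \<partial>M)" .
  have "(\<integral>\<^sup>+\<omega>. indicator E \<omega> * emeasure (Q (Y (int t) \<omega>) (X t \<omega>)) A \<partial>M) \<le> (\<integral>\<^sup>+\<omega>. 1 \<partial>M)"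
    by (intro nn_integral_mono) (auto simp: indicator_def prob_space.emeasure_le_1[OF prob_space_Q])
  also have "\<dots> < \<infinity>" by (simp add: emeasure_space_1)
  finally show ?thesis using eq by (simp add: emeasure_eq_measure ennreal_enn2real)
qed

text \<open>Every history contains the whole environment, so a condition on
  \<open>path (Suc t)\<close> can be absorbed into the event \<open>E\<close>. Hence two finite
  measures on pairs of environment and new state agree on rectangles, and therefore give equal
  integrals.\<close>

lemma one_step_nn_integral:
  assumes E: "E \<in> sets (history t)" and f [measurable]: "f \<in> borel_measurable (path_space \<Otimes>\<^sub>M borel)"
  shows "(\<integral>\<^sup>+\<omega>. indicator E \<omega> * f (path (Suc t) \<omega>, X (Suc t) \<omega>) \<partial>M)
    = (\<integral>\<^sup>+\<omega>. indicator E \<omega> * (\<integral>\<^sup>+z. f (path (Suc t) \<omega>, z) \<partial>Q (Y (int t) \<omega>) (X t \<omega>)) \<partial>M)"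
proof -
  have E_M [measurable]: "E \<in> sets M" using E subalgebra_history by (auto simp: subalgebra_def)
  have E_sub: "E \<subseteq> space M" using sets.sets_into_space[OF E_M] .
  define ME where "ME = density M (indicator E)"
  have [measurable_cong]: "sets ME = sets M" and [simp]: "space ME = space M" by (simp_all add: ME_def)
  define k where "k \<omega> = distr (Q (Y (int t) \<omega>) (X t \<omega>)) (path_space \<Otimes>\<^sub>M borel) (\<lambda>z. (path (Suc t) \<omega>, z))" for \<omega>
  have [measurable]: "(\<lambda>\<omega>. Q (Y (int t) \<omega>) (X t \<omega>)) \<in> measurable M (subprob_algebra borel)"
    by (rule measurable_history_M[OF kernel_history])
  have k_meas [measurable]: "k \<in> measurable M (subprob_algebra (path_space \<Otimes>\<^sub>M borel))"
    unfolding k_def[abs_def] by (rule measurable_distr2[where M = borel]) measurable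
  have k_meas': "k \<in> measurable ME (subprob_algebra (path_space \<Otimes>\<^sub>M borel))" by measurable
  have eq: "distr ME (path_space \<Otimes>\<^sub>M borel) (\<lambda>\<omega>. (path (Suc t) \<omega>, X (Suc t) \<omega>)) = ME \<bind> k"
  proof (rule measure_eqI_generator_eq[where E = "{B \<times> A | B A. B \<in> sets path_space \<and> A \<in> sets borel}"
        and \<Omega> = UNIV and A = "\<lambda>_. UNIV"])
    show "Int_stable {B \<times> A | B A. B \<in> sets path_space \<and> A \<in> sets (borel :: 'x measure)}"
      by (rule Int_stable_pair_measure_generator)
    have UNIV_path: "space (path_space :: (int \<Rightarrow> 'y) measure) = UNIV" by (simp add: space_PiM)
    show "{B \<times> A | B A. B \<in> sets path_space \<and> A \<in> sets (borel :: 'x measure)} \<subseteq> Pow (UNIV :: ((int \<Rightarrow> 'y) \<times> 'x) set)" by auto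
    have sets_eq: "sets (path_space \<Otimes>\<^sub>M borel)
        = sigma_sets (UNIV :: ((int \<Rightarrow> 'y) \<times> 'x) set) {B \<times> A | B A. B \<in> sets path_space \<and> A \<in> sets borel}"
      unfolding sets_pair_measure by (simp add: UNIV_path)
    show "sets (distr ME (path_space \<Otimes>\<^sub>M borel) (\<lambda>\<omega>. (path (Suc t) \<omega>, X (Suc t) \<omega>)))
        = sigma_sets UNIV {B \<times> A | B A. B \<in> sets path_space \<and> A \<in> sets borel}"
      by (simp add: sets_eq)
    show "sets (ME \<bind> k) = sigma_sets UNIV {B \<times> A | B A. B \<in> sets path_space \<and> A \<in> sets borel}"
      using sets_bind[of ME k "path_space \<Otimes>\<^sub>M borel"] not_empty by (simp add: k_def sets_eq)
    show "range (\<lambda>_. UNIV :: ((int \<Rightarrow> 'y) \<times> 'x) set) \<subseteq> {B \<times> A | B A. B \<in> sets path_space \<and> A \<in> sets (borel :: 'x measure)}"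
    proof -
      have "UNIV = (UNIV :: (int \<Rightarrow> 'y) set) \<times> (UNIV :: 'x set)" by simp
      moreover have "(UNIV :: (int \<Rightarrow> 'y) set) \<in> sets path_space"
        using sets.top[of "path_space :: (int \<Rightarrow> 'y) measure"] by (simp add: UNIV_path)
      moreover have "(UNIV :: 'x set) \<in> sets borel" by simp
      ultimately have "(UNIV :: ((int \<Rightarrow> 'y) \<times> 'x) set) \<in> {B \<times> A | B A. B \<in> sets path_space \<and> A \<in> sets borel}"
        unfolding mem_Collect_eq by blast
      then show ?thesis by (intro image_subsetI)
    qed
    show "emeasure (distr ME (path_space \<Otimes>\<^sub>M borel) (\<lambda>\<omega>. (path (Suc t) \<omega>, X (Suc t) \<omega>))) UNIV \<noteq> \<infinity>"
    proof -
      have "(UNIV :: ((int \<Rightarrow> 'y) \<times> 'x) set) \<in> sets (path_space \<Otimes>\<^sub>M borel)"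
        using sets.top[of "path_space \<Otimes>\<^sub>M borel :: ((int \<Rightarrow> 'y) \<times> 'x) measure"]
        by (simp add: space_pair_measure UNIV_path)
      then have "emeasure (distr ME (path_space \<Otimes>\<^sub>M borel) (\<lambda>\<omega>. (path (Suc t) \<omega>, X (Suc t) \<omega>))) UNIV
          = emeasure ME (space M)"
        by (simp add: emeasure_distr)
      also have "\<dots> = (\<integral>\<^sup>+\<omega>. indicator E \<omega> * indicator (space M) \<omega> \<partial>M)"
        unfolding ME_def by (rule emeasure_density) auto
      also have "\<dots> = (\<integral>\<^sup>+\<omega>. indicator E \<omega> \<partial>M)" by (intro nn_integral_cong) simp
      also have "\<dots> = emeasure M E" by simp
      finally have "emeasure (distr ME (path_space \<Otimes>\<^sub>M borel) (\<lambda>\<omega>. (path (Suc t) \<omega>, X (Suc t) \<omega>))) UNIV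
          = emeasure M E" .
      then show ?thesis by (simp add: emeasure_eq_measure)
    qed
    fix W :: "((int \<Rightarrow> 'y) \<times> 'x) set" assume "W \<in> {B \<times> A | B A. B \<in> sets path_space \<and> A \<in> sets (borel :: 'x measure)}"
    then obtain B A where W: "W = B \<times> A" and [measurable]: "B \<in> sets path_space" "A \<in> sets borel" by blast
    define E' where "E' = E \<inter> (path (Suc t) -` B \<inter> space M)"
    have E': "E' \<in> sets (history t)"
      unfolding E'_def using E measurable_sets[OF path_history[of "Suc t" t] \<open>B \<in> sets path_space\<close>] by auto
    have "emeasure (distr ME (path_space \<Otimes>\<^sub>M borel) (\<lambda>\<omega>. (path (Suc t) \<omega>, X (Suc t) \<omega>))) W
        = (\<integral>\<^sup>+\<omega>. indicator E \<omega> * indicator ((\<lambda>\<omega>. (path (Suc t) \<omega>, X (Suc t) \<omega>)) -` W \<inter> space M) \<omega> \<partial>M)"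
      unfolding W by (subst emeasure_distr) (simp_all add: ME_def emeasure_density)
    also have "\<dots> = (\<integral>\<^sup>+\<omega>. indicator {\<omega> \<in> E'. X (Suc t) \<omega> \<in> A} \<omega> \<partial>M)"
      using E_sub by (intro nn_integral_cong) (auto simp: indicator_def W E'_def)
    also have "\<dots> = emeasure M {\<omega> \<in> E'. X (Suc t) \<omega> \<in> A}"
    proof -
      have "{\<omega> \<in> E'. X (Suc t) \<omega> \<in> A} = E' \<inter> (X (Suc t) -` A \<inter> space M)" by (auto simp: E'_def)
      moreover have "E' \<in> sets M" using E' subalgebra_history by (auto simp: subalgebra_def)
      ultimately show ?thesis by simp
    qed
    also have "\<dots> = (\<integral>\<^sup>+\<omega>. indicator E' \<omega> * emeasure (Q (Y (int t) \<omega>) (X t \<omega>)) A \<partial>M)"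
      by (rule one_step_sets[OF E']) simp
    also have "\<dots> = (\<integral>\<^sup>+\<omega>. indicator E \<omega> * emeasure (k \<omega>) W \<partial>M)"
    proof (rule nn_integral_cong)
      fix \<omega> assume "\<omega> \<in> space M"
      have "emeasure (k \<omega>) W = emeasure (Q (Y (int t) \<omega>) (X t \<omega>))
          ((\<lambda>z. (path (Suc t) \<omega>, z)) -` W \<inter> space (Q (Y (int t) \<omega>) (X t \<omega>)))"
        unfolding k_def W by (rule emeasure_distr) (auto simp: UNIV_path cong: measurable_cong_sets[OF sets_Q])
      also have "(\<lambda>z. (path (Suc t) \<omega>, z)) -` W \<inter> space (Q (Y (int t) \<omega>) (X t \<omega>))
          = (if path (Suc t) \<omega> \<in> B then A else {})"
        using sets_eq_imp_space_eq[OF sets_Q] by (auto simp: W)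
      finally show "indicator E' \<omega> * emeasure (Q (Y (int t) \<omega>) (X t \<omega>)) A = indicator E \<omega> * emeasure (k \<omega>) W"
        using \<open>\<omega> \<in> space M\<close> by (auto simp: E'_def indicator_def)
    qed
    also have "\<dots> = (\<integral>\<^sup>+\<omega>. emeasure (k \<omega>) W \<partial>ME)"
      unfolding ME_def
    proof (rule nn_integral_density[symmetric])
      show "(\<lambda>\<omega>. emeasure (k \<omega>) W) \<in> borel_measurable M"
        by (rule measurable_compose[OF k_meas measurable_emeasure_subprob_algebra]) (simp add: W)
    qed measurable
    also have "\<dots> = emeasure (ME \<bind> k) W"
      using not_empty by (intro emeasure_bind[symmetric, OF _ k_meas']) (auto simp: W)
    finally show "emeasure (distr ME (path_space \<Otimes>\<^sub>M borel) (\<lambda>\<omega>. (path (Suc t) \<omega>, X (Suc t) \<omega>))) W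
        = emeasure (ME \<bind> k) W" .
  qed auto
  have "(\<integral>\<^sup>+\<omega>. indicator E \<omega> * f (path (Suc t) \<omega>, X (Suc t) \<omega>) \<partial>M)
      = (\<integral>\<^sup>+w. f w \<partial>distr ME (path_space \<Otimes>\<^sub>M borel) (\<lambda>\<omega>. (path (Suc t) \<omega>, X (Suc t) \<omega>)))"
    by (simp add: nn_integral_distr ME_def nn_integral_density)
  also have "\<dots> = (\<integral>\<^sup>+\<omega>. \<integral>\<^sup>+w. f w \<partial>k \<omega> \<partial>ME)"
    unfolding eq by (rule nn_integral_bind[OF f k_meas'])
  also have "\<dots> = (\<integral>\<^sup>+\<omega>. indicator E \<omega> * (\<integral>\<^sup>+w. f w \<partial>k \<omega>) \<partial>M)"
    unfolding ME_def by (rule nn_integral_density) measurable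
  also have "\<dots> = (\<integral>\<^sup>+\<omega>. indicator E \<omega> * (\<integral>\<^sup>+z. f (path (Suc t) \<omega>, z) \<partial>Q (Y (int t) \<omega>) (X t \<omega>)) \<partial>M)"
    unfolding k_def by (subst nn_integral_distr) (auto simp: space_PiM cong: measurable_cong_sets[OF sets_Q])
  finally show ?thesis .
qed

lemma cond_exp_transition:
  assumes f: "bounded_measurable f"
  shows "AE \<omega> in M. real_cond_exp M (history t) (\<lambda>\<omega>. f (path (Suc t) \<omega>) (X (Suc t) \<omega>)) \<omega>
    = transition Q f (path t \<omega>) (X t \<omega>)"
proof (rule history.real_cond_exp_charact)
  show "integrable M (\<lambda>\<omega>. f (path (Suc t) \<omega>) (X (Suc t) \<omega>))"
    by (rule integrable_bounded_measurable[OF f])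
  show int: "integrable M (\<lambda>\<omega>. transition Q f (path t \<omega>) (X t \<omega>))"
    by (rule integrable_bounded_measurable[OF bounded_measurable_transition[OF f]])
  show "(\<lambda>\<omega>. transition Q f (path t \<omega>) (X t \<omega>)) \<in> borel_measurable (history t)"
    by (intro bounded_measurable_compose[OF bounded_measurable_transition[OF f]]) measurable
  fix E assume E: "E \<in> sets (history t)"
  then have [measurable]: "E \<in> sets M" using subalgebra_history by (auto simp: subalgebra_def)
  obtain C where C: "\<And>y x. \<bar>f y x\<bar> \<le> C" using f by (auto simp: bounded_measurable_def)
  \<comment> \<open>Adding the bound \<open>C\<close> makes the function nonnegative, so that the
    identity for nonnegative integrals applies; the constant cancels at the end.\<close>
  have nonneg: "0 \<le> f y x + C" for y x using C[of y x] by simp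
  have f_meas [measurable]: "(\<lambda>(y, x). f y x) \<in> borel_measurable (path_space \<Otimes>\<^sub>M borel)"
    using f by (simp add: bounded_measurable_def)
  have intQ: "(\<integral>\<^sup>+z. ennreal (f (path (Suc t) \<omega>) z + C) \<partial>Q (Y (int t) \<omega>) (X t \<omega>))
      = ennreal (transition Q f (path t \<omega>) (X t \<omega>) + C)" for \<omega>
  proof -
    interpret Q: prob_space "Q (Y (int t) \<omega>) (X t \<omega>)" by (rule prob_space_Q)
    have "(\<integral>\<^sup>+z. ennreal (f (path (Suc t) \<omega>) z + C) \<partial>Q (Y (int t) \<omega>) (X t \<omega>))
        = ennreal (\<integral>z. f (path (Suc t) \<omega>) z + C \<partial>Q (Y (int t) \<omega>) (X t \<omega>))"
      using integrable_Q[OF f] nonneg by (intro nn_integral_eq_integral) auto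
    then show ?thesis
      using integrable_Q[OF f] by (simp add: transition_def path_Suc Q.prob_space) (simp add: path_def)
  qed
  have nonneg': "0 \<le> transition Q f y x + C" for y x using abs_transition_le[OF f C, of y x] by simp
  have ind: "integrable M (\<lambda>\<omega>. indicator E \<omega> * g \<omega>)" if "integrable M g" for g :: "'w \<Rightarrow> real"
    using integrable_mult_indicator[OF \<open>E \<in> sets M\<close> that] by simp
  have int1: "integrable M (\<lambda>\<omega>. indicator E \<omega> * (f (path (Suc t) \<omega>) (X (Suc t) \<omega>) + C))"
    and int2: "integrable M (\<lambda>\<omega>. indicator E \<omega> * (transition Q f (path t \<omega>) (X t \<omega>) + C))"
    using integrable_bounded_measurable[OF f] int by (auto intro!: ind)
  have "ennreal (\<integral>\<omega>. indicator E \<omega> * (f (path (Suc t) \<omega>) (X (Suc t) \<omega>) + C) \<partial>M)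
      = (\<integral>\<^sup>+\<omega>. indicator E \<omega> * ennreal (f (path (Suc t) \<omega>) (X (Suc t) \<omega>) + C) \<partial>M)"
    using nonneg by (subst nn_integral_eq_integral[symmetric, OF int1])
      (auto intro!: nn_integral_cong simp: indicator_def)
  also have "\<dots> = (\<integral>\<^sup>+\<omega>. indicator E \<omega> * (\<integral>\<^sup>+z. ennreal (f (path (Suc t) \<omega>) z + C) \<partial>Q (Y (int t) \<omega>) (X t \<omega>)) \<partial>M)"
    using one_step_nn_integral[OF E, of "\<lambda>w. ennreal (f (fst w) (snd w) + C)"] f_meas
    by (simp add: split_beta')
  also have "\<dots> = ennreal (\<integral>\<omega>. indicator E \<omega> * (transition Q f (path t \<omega>) (X t \<omega>) + C) \<partial>M)"
    unfolding intQ using nonneg' by (subst nn_integral_eq_integral[symmetric, OF int2])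
      (auto intro!: nn_integral_cong simp: indicator_def)
  finally have "(\<integral>\<omega>. indicator E \<omega> * (f (path (Suc t) \<omega>) (X (Suc t) \<omega>) + C) \<partial>M)
      = (\<integral>\<omega>. indicator E \<omega> * (transition Q f (path t \<omega>) (X t \<omega>) + C) \<partial>M)"
    using nonneg nonneg' by (subst (asm) ennreal_inj) (auto intro!: integral_nonneg_AE)
  moreover have "integrable M (\<lambda>\<omega>. indicator E \<omega> * f (path (Suc t) \<omega>) (X (Suc t) \<omega>))"
    "integrable M (\<lambda>\<omega>. indicator E \<omega> * transition Q f (path t \<omega>) (X t \<omega>))"
    "integrable M (\<lambda>\<omega>. indicator E \<omega> * C)"
    by (intro ind integrable_bounded_measurable[OF f] int integrable_const)+
  ultimately show "(\<integral>\<omega>\<in>E. f (path (Suc t) \<omega>) (X (Suc t) \<omega>) \<partial>M) = (\<integral>\<omega>\<in>E. transition Q f (path t \<omega>) (X t \<omega>) \<partial>M)"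
    by (simp add: set_lebesgue_integral_def distrib_left)
qed

text \<open>The last step is peeled off: conditioning on the history just before it replaces
  \<open>f\<close> by \<open>transition Q f\<close>, so the induction runs over all \<open>f\<close>
  at once. The weight \<open>G\<close> stays measurable because histories increase.\<close>

lemma markov_property:
  assumes f: "bounded_measurable f" and G: "G \<in> borel_measurable (history t)" "\<And>\<omega>. \<bar>G \<omega>\<bar> \<le> B"
  shows "(\<integral>\<omega>. G \<omega> * f (path (t + n) \<omega>) (X (t + n) \<omega>) \<partial>M)
    = (\<integral>\<omega>. G \<omega> * (transition Q ^^ n) f (path t \<omega>) (X t \<omega>) \<partial>M)"
  using f
proof (induction n arbitrary: f)
  case (Suc n)
  let ?t = "t + n"
  obtain C where C: "\<And>y x. \<bar>f y x\<bar> \<le> C" using Suc.prems by (auto simp: bounded_measurable_def)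
  have G_n: "G \<in> borel_measurable (history ?t)" by (rule measurable_history_mono[OF _ G(1)]) simp
  have G_M [measurable]: "G \<in> borel_measurable M" by (rule measurable_history_M[OF G(1)])
  have [measurable]: "(\<lambda>\<omega>. f (path (Suc ?t) \<omega>) (X (Suc ?t) \<omega>)) \<in> borel_measurable M"
    "(\<lambda>\<omega>. transition Q f (path ?t \<omega>) (X ?t \<omega>)) \<in> borel_measurable M"
    by (rule bounded_measurable_compose[OF Suc.prems path_measurable X_measurable],
        rule bounded_measurable_compose[OF bounded_measurable_transition[OF Suc.prems] path_measurable X_measurable])
  have "\<bar>G \<omega> * f y x\<bar> \<le> B * C" for \<omega> y x
    unfolding abs_mult using G(2)[of \<omega>] C[of y x] by (intro mult_mono) auto
  then have int: "integrable M (\<lambda>\<omega>. G \<omega> * f (path (Suc ?t) \<omega>) (X (Suc ?t) \<omega>))"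
    by (intro integrable_const_bound[where B = "B * C"]) auto
  have "(\<integral>\<omega>. G \<omega> * f (path (t + Suc n) \<omega>) (X (t + Suc n) \<omega>) \<partial>M)
      = (\<integral>\<omega>. G \<omega> * real_cond_exp M (history ?t) (\<lambda>\<omega>. f (path (Suc ?t) \<omega>) (X (Suc ?t) \<omega>)) \<omega> \<partial>M)"
    using history.real_cond_exp_intg(2)[OF int G_n] by simp
  also have "\<dots> = (\<integral>\<omega>. G \<omega> * transition Q f (path ?t \<omega>) (X ?t \<omega>) \<partial>M)"
    using cond_exp_transition[OF Suc.prems, of ?t] by (intro integral_cong_AE) auto
  also have "\<dots> = (\<integral>\<omega>. G \<omega> * (transition Q ^^ n) (transition Q f) (path t \<omega>) (X t \<omega>) \<partial>M)"
    by (rule Suc.IH[OF bounded_measurable_transition[OF Suc.prems]])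
  finally show ?case by (simp only: funpow_Suc_right o_apply)
qed simp

text \<open>It serves to move an error function through a block: the mean of the transported
  function at time \<open>t\<close> is the mean of the original one at a later time of the actual
  process.\<close>

lemma expectation_funpow:
  assumes "bounded_measurable f"
  shows "(\<integral>\<omega>. (transition Q ^^ n) f (path t \<omega>) (X t \<omega>) \<partial>M) = (\<integral>\<omega>. f (path (t + n) \<omega>) (X (t + n) \<omega>) \<partial>M)"
  using markov_property[OF assms, of "\<lambda>_. 1" t 1 n] by simp

end

section \<open>Forgetting the initial state\<close>

lemma bounded_measurable_add:
  assumes "bounded_measurable f" "bounded_measurable g"
  shows "bounded_measurable (\<lambda>y x. f y x + c * g y x)"
proof -
  obtain C D where "\<And>y x. \<bar>f y x\<bar> \<le> C" "\<And>y x. \<bar>g y x\<bar> \<le> D"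
    using assms by (auto simp: bounded_measurable_def)
  then have "\<bar>f y x + c * g y x\<bar> \<le> C + \<bar>c\<bar> * D" for y x
    by (intro order_trans[OF abs_triangle_ineq] add_mono) (auto simp: abs_mult intro: mult_left_mono)
  then show ?thesis using assms by (auto simp: bounded_measurable_def split_beta')
qed

text \<open>\<open>H\<close> and \<open>N\<close> have to be found together. Raising
  \<open>N\<close> makes the environment exceed it less often but may weaken the drift, and the
  longer block which this calls for gives the environment more occasions to exceed
  \<open>N\<close>.\<close>

locale contractive_chain = chain_in_environment M Q Y X + contractive_kernels Q V lev lam K \<alpha> \<nu>
  for M :: "'w measure" and Q :: "'y::polish_space \<Rightarrow> 'x::polish_space \<Rightarrow> 'x measure"
    and Y X V lev lam K \<alpha> \<nu> +
  assumes tight: "0 < \<epsilon> \<Longrightarrow> \<exists>L>0. \<forall>i. prob {\<omega> \<in> space M. L < V (X i \<omega>)} \<le> \<epsilon>"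
    and decay: "0 < \<epsilon> \<Longrightarrow> 0 < c \<Longrightarrow> \<exists>H N. (1 - 3 * lam N / 4) ^ H \<le> c \<and>
      (\<forall>i. prob {\<omega> \<in> space M. \<exists>j\<le>H. N < lev (Y (int (i + j)) \<omega>)} \<le> \<epsilon>)"
begin

text \<open>The expression \<open>D - D * q ^ n\<close> is the telescoped sum of the weights
  \<open>\<alpha> N / 2 * D * q ^ k\<close> over \<open>k < n\<close>. The factor
  \<open>2 * \<epsilon>\<close> bounds the mean of \<open>bad_block\<close>, one
  \<open>\<epsilon>\<close> for the state and one for the environment.\<close>

lemma forgetting_geometric:
  assumes f: "bounded_measurable f" and D: "0 \<le> D" "\<And>y z z'. f y z - f y z' \<le> D"
    and L: "0 < L" and L_tight: "\<And>i. prob {\<omega> \<in> space M. L < V (X i \<omega>)} \<le> \<epsilon>"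
    and H: "(1 - 3 * lam N / 4) ^ H \<le> 6 / L"
    and N: "\<And>i. prob {\<omega> \<in> space M. \<exists>j\<le>H. N < lev (Y (int (i + j)) \<omega>)} \<le> \<epsilon>"
  defines "q \<equiv> 1 - \<alpha> N / 2"
  shows "\<exists>h. bounded_measurable h \<and> (\<forall>y x. 0 \<le> h y x)
    \<and> (\<forall>y x x'. (transition Q ^^ (n * Suc H)) f y x - (transition Q ^^ (n * Suc H)) f y x'
          \<le> D * q ^ n + h y x + h y x')
    \<and> (\<forall>i. (\<integral>\<omega>. h (path i \<omega>) (X i \<omega>) \<partial>M) \<le> 2 * \<epsilon> * (D - D * q ^ n))"
proof (induction n)
  case 0
  have "bounded_measurable (\<lambda>(y :: int \<Rightarrow> 'y) (x :: 'x). 0)"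
    unfolding bounded_measurable_def by (intro conjI exI[of _ 0]) auto
  then show ?case using D(2) by (intro exI[of _ "\<lambda>_ _. 0"]) simp
next
  case (Suc n)
  then obtain h where h: "bounded_measurable h" and h_nonneg: "\<And>y x. 0 \<le> h y x"
    and le: "\<And>y x x'. (transition Q ^^ (n * Suc H)) f y x - (transition Q ^^ (n * Suc H)) f y x'
          \<le> D * q ^ n + h y x + h y x'"
    and Eh: "\<And>i. (\<integral>\<omega>. h (path i \<omega>) (X i \<omega>) \<partial>M) \<le> 2 * \<epsilon> * (D - D * q ^ n)"
    by blast
  define \<kappa> where "\<kappa> = \<alpha> N / 2"
  have q: "q = 1 - \<kappa>" and \<kappa>: "0 < \<kappa>" "\<kappa> < 1" using \<alpha>_bounds[of N] by (simp_all add: q_def \<kappa>_def)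
  define a where "a = D * q ^ n"
  have a: "0 \<le> a" using D(1) \<kappa> by (simp add: a_def q)
  define g where "g = (\<lambda>y x. (transition Q ^^ Suc H) h y x + \<kappa> * a * bad_block L N H y x)"
  show ?case
  proof (intro exI[of _ g] conjI allI)
    show "bounded_measurable g"
      unfolding g_def by (intro bounded_measurable_add bounded_measurable_funpow h bounded_measurable_bad_block)
    show "0 \<le> g y x" for y x
      unfolding g_def using \<kappa> a
      by (intro add_nonneg_nonneg mult_nonneg_nonneg funpow_nonneg h_nonneg bad_block_nonneg) auto
    show "(transition Q ^^ (Suc n * Suc H)) f y x - (transition Q ^^ (Suc n * Suc H)) f y x'
        \<le> D * q ^ Suc n + g y x + g y x'" for y x x'
    proof -
      have "D * q ^ Suc n = (1 - \<alpha> N / 2) * a" by (simp add: q \<kappa>_def a_def)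
      then show ?thesis
        using block_contraction[OF bounded_measurable_funpow[OF f] h h_nonneg a le[folded a_def] L H, of y x x']
        unfolding mult_Suc funpow_add o_apply g_def \<kappa>_def by simp
    qed
    fix i
    have bad: "(\<integral>\<omega>. bad_block L N H (path i \<omega>) (X i \<omega>) \<partial>M) \<le> 2 * \<epsilon>"
    proof -
      let ?A = "{\<omega> \<in> space M. L < V (X i \<omega>)}"
      let ?B = "{\<omega> \<in> space M. \<exists>j\<le>H. N < lev (Y (int (i + j)) \<omega>)}"
      have [measurable]: "?A \<in> sets M" "?B \<in> sets M" by measurable
      have "(\<integral>\<omega>. bad_block L N H (path i \<omega>) (X i \<omega>) \<partial>M) = (\<integral>\<omega>. indicator ?A \<omega> + indicator ?B \<omega> \<partial>M)"
        by (intro Bochner_Integration.integral_cong)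
          (auto simp: bad_block_def path_def indicator_def add.commute)
      also have "\<dots> = prob ?A + prob ?B"
        by (subst Bochner_Integration.integral_add) (auto simp: emeasure_eq_measure)
      finally show ?thesis using L_tight[of i] N[of i] by linarith
    qed
    \<comment> \<open>Transporting \<open>h\<close> through the block evaluates its mean at time
      \<open>i + Suc H\<close>, which is why the induction bounds the means at all times
      simultaneously.\<close>
    have "(\<integral>\<omega>. g (path i \<omega>) (X i \<omega>) \<partial>M)
        = (\<integral>\<omega>. h (path (i + Suc H) \<omega>) (X (i + Suc H) \<omega>) \<partial>M)
          + \<kappa> * a * (\<integral>\<omega>. bad_block L N H (path i \<omega>) (X i \<omega>) \<partial>M)"
      unfolding g_def expectation_funpow[OF h, of "Suc H" i, symmetric]
      using integrable_bounded_measurable[OF bounded_measurable_funpow[OF h]]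
        integrable_bounded_measurable[OF bounded_measurable_bad_block]
      by (subst Bochner_Integration.integral_add) (simp_all del: funpow.simps)
    also have "\<dots> \<le> 2 * \<epsilon> * (D - a) + \<kappa> * a * (2 * \<epsilon>)"
      using Eh[of "i + Suc H"] bad \<kappa> a by (intro add_mono mult_left_mono) (auto simp: a_def)
    also have "\<dots> = 2 * \<epsilon> * (D - D * q ^ Suc n)" by (simp add: a_def q algebra_simps)
    finally show "(\<integral>\<omega>. g (path i \<omega>) (X i \<omega>) \<partial>M) \<le> 2 * \<epsilon> * (D - D * q ^ Suc n)" .
  qed
qed

lemma forgetting:
  assumes f: "bounded_measurable f" and \<epsilon>: "0 < \<epsilon>"
  obtains T h where "T0 \<le> T" "bounded_measurable h" "\<And>y x. 0 \<le> h y x"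
    "\<And>y x x'. (transition Q ^^ T) f y x - (transition Q ^^ T) f y x' \<le> \<epsilon> + h y x + h y x'"
    "\<And>i. (\<integral>\<omega>. h (path i \<omega>) (X i \<omega>) \<partial>M) \<le> \<epsilon>"
proof -
  obtain C where C: "\<And>y x. \<bar>f y x\<bar> \<le> C" using f by (auto simp: bounded_measurable_def)
  have C0: "0 \<le> C" using C[of undefined undefined] by linarith
  define D where "D = 2 * C"
  have D: "0 \<le> D" "f y z - f y z' \<le> D" for y z z'
    using C0 C[of y z] C[of y z'] by (auto simp: D_def)
  \<comment> \<open>Chosen from \<open>D\<close> and \<open>\<epsilon>\<close> alone, before
    \<open>H\<close> and \<open>N\<close> are known. The summand 1 covers
    \<open>D = 0\<close>.\<close>
  define \<delta> where "\<delta> = \<epsilon> / (2 * D + 1)"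
  have \<delta>: "0 < \<delta>" "2 * \<delta> * D \<le> \<epsilon>"
    using \<epsilon> D(1) by (auto simp: \<delta>_def field_simps intro: mult_nonneg_nonneg)
  obtain L where L: "0 < L" "\<And>i. prob {\<omega> \<in> space M. L < V (X i \<omega>)} \<le> \<delta>"
    using tight[OF \<delta>(1)] by blast
  have "0 < 6 / L" using L by simp
  from decay[OF \<delta>(1) this] obtain H N where HN: "(1 - 3 * lam N / 4) ^ H \<le> 6 / L"
    "\<And>i. prob {\<omega> \<in> space M. \<exists>j\<le>H. N < lev (Y (int (i + j)) \<omega>)} \<le> \<delta>"
    by blast
  define q where "q = 1 - \<alpha> N / 2"
  have q: "0 \<le> q" "q < 1" using \<alpha>_bounds[of N] by (auto simp: q_def)
  have "(\<lambda>n. D * q ^ n) \<longlonglongrightarrow> D * 0" using q by (intro tendsto_mult LIMSEQ_realpow_zero) auto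
  then have "\<forall>\<^sub>F n in sequentially. D * q ^ n < \<epsilon>" using \<epsilon> by (intro order_tendstoD(2)) auto
  then obtain n0 where n0: "\<And>n. n0 \<le> n \<Longrightarrow> D * q ^ n < \<epsilon>" by (auto simp: eventually_sequentially)
  \<comment> \<open>At least \<open>T0\<close> blocks of positive length make the total time at
    least \<open>T0\<close>.\<close>
  define n where "n = max n0 T0"
  obtain h where h: "bounded_measurable h" "\<And>y x. 0 \<le> h y x"
    "\<And>y x x'. (transition Q ^^ (n * Suc H)) f y x - (transition Q ^^ (n * Suc H)) f y x'
          \<le> D * q ^ n + h y x + h y x'"
    "\<And>i. (\<integral>\<omega>. h (path i \<omega>) (X i \<omega>) \<partial>M) \<le> 2 * \<delta> * (D - D * q ^ n)"
    using forgetting_geometric[OF f D L(1,2) HN, of n, folded q_def] by blast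
  have "T0 \<le> n * Suc H" by (simp add: n_def)
  moreover have "(transition Q ^^ (n * Suc H)) f y x - (transition Q ^^ (n * Suc H)) f y x'
      \<le> \<epsilon> + h y x + h y x'" for y x x'
    using h(3)[of y x x'] n0[of n] by (simp add: n_def)
  moreover have "(\<integral>\<omega>. h (path i \<omega>) (X i \<omega>) \<partial>M) \<le> \<epsilon>" for i
  proof -
    have "2 * \<delta> * (D - D * q ^ n) \<le> 2 * \<delta> * D" using \<delta> D(1) q by (intro mult_left_mono) auto
    with h(4)[of i] \<delta>(2) show ?thesis by linarith
  qed
  ultimately show ?thesis using h(1,2) that by blast
qed

end

section \<open>The law of large numbers\<close>

text \<open>Young's inequality with a free parameter takes the place of the Cauchy-Schwarz
  inequality and avoids square roots; \<open>s\<close> will be of the order of the target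
  accuracy.\<close>

lemma (in prob_space) expectation_abs_le_square:
  fixes Z :: "'a \<Rightarrow> real"
  assumes [measurable]: "Z \<in> borel_measurable M" and bd: "\<And>\<omega>. \<bar>Z \<omega>\<bar> \<le> B" and s: "0 < s"
  shows "(\<integral>\<omega>. \<bar>Z \<omega>\<bar> \<partial>M) \<le> (\<integral>\<omega>. (Z \<omega>)\<^sup>2 \<partial>M) / (2 * s) + s / 2"
proof -
  have int: "integrable M (\<lambda>\<omega>. \<bar>Z \<omega>\<bar>)" "integrable M (\<lambda>\<omega>. (Z \<omega>)\<^sup>2)"
    using bd power_mono[OF bd abs_ge_zero, of _ 2]
    by (auto intro: integrable_const_bound[where B = B] integrable_const_bound[where B = "B\<^sup>2"])
  have pt: "\<bar>z\<bar> \<le> z\<^sup>2 / (2 * s) + s / 2" for z :: real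
  proof -
    have "0 \<le> (\<bar>z\<bar> - s)\<^sup>2" by simp
    then have "\<bar>z\<bar> * (2 * s) \<le> z\<^sup>2 + s * s" by (simp add: power2_diff power2_eq_square algebra_simps)
    then show ?thesis using s by (simp add: field_simps power2_eq_square)
  qed
  have "(\<integral>\<omega>. \<bar>Z \<omega>\<bar> \<partial>M) \<le> (\<integral>\<omega>. (Z \<omega>)\<^sup>2 / (2 * s) + s / 2 \<partial>M)"
    using int by (intro integral_mono pt) auto
  also have "\<dots> = (\<integral>\<omega>. (Z \<omega>)\<^sup>2 \<partial>M) / (2 * s) + s / 2"
    using int by (simp add: prob_space)
  finally show ?thesis .
qed

text \<open>For each index at most \<open>2 * T\<close> indices, itself included, lie at distance
  less than \<open>T\<close>. Their products cost \<open>B\<^sup>2\<close> each in addition; all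
  other products contribute at most \<open>\<delta>\<close>.\<close>

lemma (in prob_space) second_moment_sum_le:
  fixes Z :: "nat \<Rightarrow> 'a \<Rightarrow> real"
  assumes [measurable]: "\<And>i. Z i \<in> borel_measurable M" and bd: "\<And>i \<omega>. \<bar>Z i \<omega>\<bar> \<le> B"
    and corr: "\<And>i j. i + T \<le> j \<Longrightarrow> \<bar>\<integral>\<omega>. Z i \<omega> * Z j \<omega> \<partial>M\<bar> \<le> \<delta>" and \<delta>: "0 \<le> \<delta>"
  shows "(\<integral>\<omega>. (\<Sum>i<t. Z i \<omega>)\<^sup>2 \<partial>M) \<le> (real t)\<^sup>2 * \<delta> + 2 * real T * B\<^sup>2 * real t"
proof -
  have prod_bd: "\<bar>Z i \<omega> * Z j \<omega>\<bar> \<le> B\<^sup>2" for i j \<omega>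
    unfolding abs_mult power2_eq_square using bd[of i \<omega>] bd[of j \<omega>] by (intro mult_mono) auto
  then have int: "integrable M (\<lambda>\<omega>. Z i \<omega> * Z j \<omega>)" for i j
    by (intro integrable_const_bound[where B = "B\<^sup>2"]) auto
  have le: "(\<integral>\<omega>. Z i \<omega> * Z j \<omega> \<partial>M) \<le> \<delta> + B\<^sup>2 * of_bool (i < j + T \<and> j < i + T)" for i j
  proof (cases "i < j + T \<and> j < i + T")
    case True
    have "(\<integral>\<omega>. Z i \<omega> * Z j \<omega> \<partial>M) \<le> (\<integral>\<omega>. B\<^sup>2 \<partial>M)"
      using int prod_bd by (intro integral_mono) (auto intro: order_trans[OF abs_ge_self])
    with True \<delta> show ?thesis by (simp add: prob_space)
  next
    case False
    then consider "i + T \<le> j" | "j + T \<le> i" by linarith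
    then have "\<bar>\<integral>\<omega>. Z i \<omega> * Z j \<omega> \<partial>M\<bar> \<le> \<delta>"
      by cases (use corr[of i j] corr[of j i] in \<open>simp_all add: mult.commute\<close>)
    moreover have "of_bool (i < j + T \<and> j < i + T) = (0 :: real)" using False by simp
    ultimately show ?thesis by (simp only: mult_zero_right)
  qed
  have count: "(\<Sum>j<t. of_bool (i < j + T \<and> j < i + T) :: real) \<le> 2 * real T" for i
  proof -
    have "(\<Sum>j<t. of_bool (i < j + T \<and> j < i + T) :: real) = real (card {j \<in> {..<t}. i < j + T \<and> j < i + T})"
      by (simp add: of_bool_def sum.If_cases Int_def conj_commute)
    also have "\<dots> \<le> real (card {i - T..<i + T})"
      by (intro of_nat_mono card_mono) auto
    also have "\<dots> \<le> 2 * real T" by simp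
    finally show ?thesis .
  qed
  have "(\<integral>\<omega>. (\<Sum>i<t. Z i \<omega>)\<^sup>2 \<partial>M) = (\<integral>\<omega>. (\<Sum>i<t. \<Sum>j<t. Z i \<omega> * Z j \<omega>) \<partial>M)"
    by (simp add: power2_eq_square sum_product)
  also have "\<dots> = (\<Sum>i<t. \<Sum>j<t. \<integral>\<omega>. Z i \<omega> * Z j \<omega> \<partial>M)"
    using int by (simp add: Bochner_Integration.integral_sum)
  also have "\<dots> \<le> (\<Sum>i<t. \<Sum>j<t. \<delta> + B\<^sup>2 * of_bool (i < j + T \<and> j < i + T))"
    by (intro sum_mono le)
  also have "\<dots> = (\<Sum>i<t. real t * \<delta> + B\<^sup>2 * (\<Sum>j<t. of_bool (i < j + T \<and> j < i + T)))"
    by (simp only: sum.distrib sum_distrib_left) simp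
  also have "\<dots> \<le> (\<Sum>i<t. real t * \<delta> + B\<^sup>2 * (2 * real T))"
    by (intro sum_mono add_mono mult_left_mono count) auto
  also have "\<dots> = (real t)\<^sup>2 * \<delta> + 2 * real T * B\<^sup>2 * real t"
    by (simp add: power2_eq_square algebra_simps)
  finally show ?thesis .
qed

text \<open>A shift by one exchanges one end term for another, a change of at most
  \<open>2 * C\<close>.\<close>

lemma abs_sum_shift_le:
  fixes a :: "nat \<Rightarrow> real"
  assumes "\<And>i. \<bar>a i\<bar> \<le> C"
  shows "\<bar>(\<Sum>i<t. a (i + T)) - (\<Sum>i<t. a i)\<bar> \<le> 2 * C * real T"
proof (induction T)
  case (Suc T)
  have "(\<Sum>i<t. a (i + Suc T)) = (\<Sum>i<t. a (i + T)) + a (t + T) - a T"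
    by (induction t) auto
  then show ?case using Suc assms[of T] assms[of "t + T"] by (simp add: algebra_simps)
qed simp

section \<open>The environment as an ergodic system\<close>

locale ergodic_chain = contractive_chain M Q Y X V lev lam K \<alpha> \<nu>
  for M :: "'w measure" and Q :: "'y::polish_space \<Rightarrow> 'x::polish_space \<Rightarrow> 'x measure"
    and Y X V lev lam K \<alpha> \<nu> +
  assumes stationary: "strongly_stationary M Y" and ergodic: "ergodic_process M Y"
begin

abbreviation path_law :: "(int \<Rightarrow> 'y) measure" where
  "path_law \<equiv> distr M path_space (path 0)"

lemma distr_path: "distr M path_space (path i) = path_law"
  using stationary by (simp add: strongly_stationary_def path_def[abs_def])

sublocale env: ergodic_system path_law shift
proof -
  interpret P: prob_space path_law by (rule prob_space_distr) simp
  show "ergodic_system path_law shift"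
  proof unfold_locales
    show "shift \<in> measurable path_law path_law" by simp
    have "distr path_law path_law shift = distr path_law path_space shift"
      by (rule distr_cong) auto
    also have "\<dots> = distr M path_space (shift \<circ> path 0)" by (rule distr_distr) auto
    also have "shift \<circ> path 0 = path 1" using path_Suc[of 0] by (auto simp: fun_eq_iff)
    finally show "distr path_law path_law shift = path_law" by (simp only: distr_path[of 1])
    fix B assume B: "B \<in> sets path_law" "shift -` B \<inter> space path_law = B"
    then have "measure M {\<omega> \<in> space M. path 0 \<omega> \<in> B} \<in> {0, 1}"
      using ergodic by (auto simp: ergodic_process_def path_def[abs_def] shift_def[abs_def] space_PiM)
    moreover have "measure path_law B = measure M {\<omega> \<in> space M. path 0 \<omega> \<in> B}"
      using B(1) by (subst measure_distr) (auto intro!: arg_cong[where f = "measure M"])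
    ultimately show "measure path_law B = 0 \<or> measure path_law B = 1" by simp
  qed
qed

lemma integral_path:
  fixes f :: "(int \<Rightarrow> 'y) \<Rightarrow> real"
  assumes "f \<in> borel_measurable path_space"
  shows "(\<integral>\<omega>. f (path i \<omega>) \<partial>M) = (\<integral>\<omega>. f (path 0 \<omega>) \<partial>M)"
  using integral_distr[OF path_measurable assms, of i] integral_distr[OF path_measurable assms, of 0]
  by (simp only: distr_path[of i])

lemma birkhoff_sum_path: "env.birkhoff_sum f t (path 0 \<omega>) = (\<Sum>i<t. f (path i \<omega>))"
  by (simp add: env.birkhoff_sum_def path_add[of 0 _ \<omega>, simplified, symmetric])

theorem environment_average_L1:
  assumes f [measurable]: "f \<in> borel_measurable path_space" and bd: "\<And>y. \<bar>f y\<bar> \<le> C"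
  shows "(\<lambda>t. \<integral>\<omega>. \<bar>(\<Sum>i<t. f (path i \<omega>)) / real t - (\<integral>\<omega>. f (path 0 \<omega>) \<partial>M)\<bar> \<partial>M) \<longlonglongrightarrow> 0"
proof -
  have [measurable]: "env.birkhoff_sum f t \<in> borel_measurable path_space" for t
    using env.birkhoff_sum_measurable[of f t] f by simp
  have "(\<integral>y. f y \<partial>path_law) = (\<integral>\<omega>. f (path 0 \<omega>) \<partial>M)" by (rule integral_distr) auto
  moreover have "(\<integral>y. \<bar>env.birkhoff_sum f t y / real t - c\<bar> \<partial>path_law)
      = (\<integral>\<omega>. \<bar>(\<Sum>i<t. f (path i \<omega>)) / real t - c\<bar> \<partial>M)" for t c
    unfolding birkhoff_sum_path[of f, symmetric] by (rule integral_distr) measurable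
  moreover have "f \<in> borel_measurable path_law" by simp
  ultimately show ?thesis using env.birkhoff_average_L1[where f = f, OF _ bd] by (simp only:)
qed

end

section \<open>Replacing the state by a function of the environment\<close>

context ergodic_chain begin

text \<open>Conditioning is on the entire environment, past and future. This one kernel, taken at
  time 0, will be evaluated along all shifted environments.\<close>

lemma initial_kernel:
  obtains \<rho> :: "(int \<Rightarrow> 'y) \<Rightarrow> 'x measure"
  where "\<rho> \<in> measurable path_space (subprob_algebra borel)" "\<And>y. prob_space (\<rho> y)"
    "\<And>k. bounded_measurable k \<Longrightarrow>
      (\<integral>\<omega>. k (path 0 \<omega>) (X 0 \<omega>) \<partial>M) = (\<integral>\<omega>. (\<integral>x. k (path 0 \<omega>) x \<partial>\<rho> (path 0 \<omega>)) \<partial>M)"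
proof -
  obtain \<rho> where \<rho> [measurable]: "\<rho> \<in> measurable path_space (subprob_algebra borel)"
    and prob: "\<And>y. prob_space (\<rho> y)"
    and dis: "\<And>f. f \<in> borel_measurable (path_space \<Otimes>\<^sub>M borel) \<Longrightarrow>
       (\<integral>\<^sup>+\<omega>. f (path 0 \<omega>, X 0 \<omega>) \<partial>M) = (\<integral>\<^sup>+\<omega>. \<integral>\<^sup>+x. f (path 0 \<omega>, x) \<partial>\<rho> (path 0 \<omega>) \<partial>M)"
    by (rule disintegration[OF path_measurable[of 0] X_measurable[of 0]]) (erule that, blast+)
  have sets: "sets (\<rho> y) = sets borel" for y
    using sets_kernel[OF \<rho>, of y] by (simp add: space_PiM)
  have meas: "(\<lambda>y. \<integral>x. k y x \<partial>\<rho> y) \<in> borel_measurable path_space" if "bounded_measurable k" for k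
    using that by (intro integral_measurable_kernel[OF _ \<rho>]) (auto simp: bounded_measurable_def)
  have "(\<integral>\<omega>. k (path 0 \<omega>) (X 0 \<omega>) \<partial>M) = (\<integral>\<omega>. (\<integral>x. k (path 0 \<omega>) x \<partial>\<rho> (path 0 \<omega>)) \<partial>M)"
    if k: "bounded_measurable k" for k
  proof -
    obtain C where C: "\<And>y x. \<bar>k y x\<bar> \<le> C" using k by (auto simp: bounded_measurable_def)
    have nonneg: "0 \<le> k y x + C" for y x using C[of y x] by simp
    have [measurable]: "(\<lambda>(y, x). k y x) \<in> borel_measurable (path_space \<Otimes>\<^sub>M borel)"
      using k by (simp add: bounded_measurable_def)
    have int_\<rho>: "integrable (\<rho> y) (k y)" for y
      using bounded_measurable_section[OF k] C
      by (intro finite_measure.integrable_const_bound[OF prob_space.finite_measure[OF prob], where B = C])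
        (auto cong: measurable_cong_sets[OF sets])
    have abs_le: "\<bar>\<integral>x. k y x \<partial>\<rho> y\<bar> \<le> C" for y
    proof -
      interpret R: prob_space "\<rho> y" by (rule prob)
      have "\<bar>\<integral>x. k y x \<partial>\<rho> y\<bar> \<le> (\<integral>x. \<bar>k y x\<bar> \<partial>\<rho> y)" by (rule integral_abs_bound)
      also have "\<dots> \<le> (\<integral>x. C \<partial>\<rho> y)" using int_\<rho> C by (intro integral_mono) auto
      finally show ?thesis by (simp add: R.prob_space)
    qed
    have int_mean: "integrable M (\<lambda>\<omega>. \<integral>x. k (path 0 \<omega>) x \<partial>\<rho> (path 0 \<omega>))"
      using abs_le measurable_compose[OF path_measurable meas[OF k]]
      by (intro integrable_const_bound[where B = C]) auto
    have inner: "(\<integral>\<^sup>+x. ennreal (k y x + C) \<partial>\<rho> y) = ennreal ((\<integral>x. k y x \<partial>\<rho> y) + C)" for y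
    proof -
      interpret R: prob_space "\<rho> y" by (rule prob)
      have "(\<integral>\<^sup>+x. ennreal (k y x + C) \<partial>\<rho> y) = ennreal (\<integral>x. k y x + C \<partial>\<rho> y)"
        using int_\<rho> nonneg by (intro nn_integral_eq_integral) auto
      then show ?thesis using int_\<rho> by (simp add: R.prob_space)
    qed
    have nonneg': "0 \<le> (\<integral>x. k y x \<partial>\<rho> y) + C" for y using abs_le[of y] by simp
    have "ennreal (\<integral>\<omega>. k (path 0 \<omega>) (X 0 \<omega>) + C \<partial>M) = (\<integral>\<^sup>+\<omega>. ennreal (k (path 0 \<omega>) (X 0 \<omega>) + C) \<partial>M)"
      using integrable_bounded_measurable[OF k] nonneg by (intro nn_integral_eq_integral[symmetric]) auto
    also have "\<dots> = (\<integral>\<^sup>+\<omega>. ennreal ((\<integral>x. k (path 0 \<omega>) x \<partial>\<rho> (path 0 \<omega>)) + C) \<partial>M)"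
      using dis[of "\<lambda>w. ennreal (k (fst w) (snd w) + C)"] by (simp add: inner)
    also have "\<dots> = ennreal (\<integral>\<omega>. (\<integral>x. k (path 0 \<omega>) x \<partial>\<rho> (path 0 \<omega>)) + C \<partial>M)"
      using int_mean nonneg' by (intro nn_integral_eq_integral) auto
    finally have "(\<integral>\<omega>. k (path 0 \<omega>) (X 0 \<omega>) + C \<partial>M) = (\<integral>\<omega>. (\<integral>x. k (path 0 \<omega>) x \<partial>\<rho> (path 0 \<omega>)) + C \<partial>M)"
      using nonneg nonneg' by (subst (asm) ennreal_inj) (auto intro!: integral_nonneg_AE)
    then show ?thesis
      using integrable_bounded_measurable[OF k] int_mean by (simp add: prob_space)
  qed
  with \<rho> prob show ?thesis by (rule that)
qed

text \<open>Conditionally on the environment, averaging over the initial law given the environment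
  turns the forgotten state into a function of the environment alone.\<close>
lemma environment_approximation:
  assumes f: "bounded_measurable f" and C: "\<And>y x. \<bar>f y x\<bar> \<le> C" and \<epsilon>: "0 < \<epsilon>"
  obtains T \<Psi> where "T0 \<le> T" "\<Psi> \<in> borel_measurable path_space" "\<And>y. \<bar>\<Psi> y\<bar> \<le> C"
    "(\<integral>\<omega>. \<Psi> (path 0 \<omega>) \<partial>M) = (\<integral>\<omega>. f (path T \<omega>) (X T \<omega>) \<partial>M)"
    "\<And>i. (\<integral>\<omega>. \<bar>(transition Q ^^ T) f (path i \<omega>) (X i \<omega>) - \<Psi> (path i \<omega>)\<bar> \<partial>M) \<le> 3 * \<epsilon>"
proof -
  obtain T h where T: "T0 \<le> T" and h: "bounded_measurable h" and h_nonneg: "\<And>y x. 0 \<le> h y x"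
    and diff: "\<And>y x x'. (transition Q ^^ T) f y x - (transition Q ^^ T) f y x' \<le> \<epsilon> + h y x + h y x'"
    and Eh: "\<And>i. (\<integral>\<omega>. h (path i \<omega>) (X i \<omega>) \<partial>M) \<le> \<epsilon>"
    by (rule forgetting[OF f \<epsilon>, of T0]) (erule that, assumption, blast+)
  obtain \<rho> where \<rho>: "\<rho> \<in> measurable path_space (subprob_algebra borel)"
    and prob: "\<And>y. prob_space (\<rho> y)"
    and dis: "\<And>k. bounded_measurable k \<Longrightarrow>
      (\<integral>\<omega>. k (path 0 \<omega>) (X 0 \<omega>) \<partial>M) = (\<integral>\<omega>. (\<integral>x. k (path 0 \<omega>) x \<partial>\<rho> (path 0 \<omega>)) \<partial>M)"
    by (rule initial_kernel) (erule that, blast+)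
  have sets: "sets (\<rho> y) = sets borel" for y
    using sets_kernel[OF \<rho>, of y] by (simp add: space_PiM)
  have meas: "(\<lambda>y. \<integral>x. k y x \<partial>\<rho> y) \<in> borel_measurable path_space" if "bounded_measurable k" for k
    using that by (intro integral_measurable_kernel[OF _ \<rho>]) (auto simp: bounded_measurable_def)
  have int_\<rho>: "integrable (\<rho> y) (k y)" if k: "bounded_measurable k" for k y
  proof -
    obtain D where "\<And>y x. \<bar>k y x\<bar> \<le> D" using k by (auto simp: bounded_measurable_def)
    then show ?thesis
      using bounded_measurable_section[OF k]
      by (intro finite_measure.integrable_const_bound[OF prob_space.finite_measure[OF prob], where B = D])
        (auto cong: measurable_cong_sets[OF sets])
  qed
  have mean_le: "\<bar>\<integral>x. k y x \<partial>\<rho> y\<bar> \<le> D" if k: "bounded_measurable k" and D: "\<And>y x. \<bar>k y x\<bar> \<le> D" for k D y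
  proof -
    interpret R: prob_space "\<rho> y" by (rule prob)
    have "\<bar>\<integral>x. k y x \<partial>\<rho> y\<bar> \<le> (\<integral>x. \<bar>k y x\<bar> \<partial>\<rho> y)" by (rule integral_abs_bound)
    also have "\<dots> \<le> (\<integral>x. D \<partial>\<rho> y)" using int_\<rho>[OF k] D by (intro integral_mono) auto
    finally show ?thesis by (simp add: R.prob_space)
  qed
  define u where "u = (transition Q ^^ T) f"
  have u: "bounded_measurable u" "\<And>y x. \<bar>u y x\<bar> \<le> C"
    unfolding u_def using f C by (auto intro: bounded_measurable_funpow abs_funpow_le)
  define \<Psi> where "\<Psi> y = (\<integral>x. u y x \<partial>\<rho> y)" for y
  \<comment> \<open>This is the share of the error that belongs to the averaged state. Being a
    function of the environment alone, it is accessible to stationarity.\<close>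
  define \<eta> where "\<eta> y = (\<integral>x. h y x \<partial>\<rho> y)" for y
  have \<Psi>_meas [measurable]: "\<Psi> \<in> borel_measurable path_space" and \<eta>_meas [measurable]: "\<eta> \<in> borel_measurable path_space"
    unfolding \<Psi>_def[abs_def] \<eta>_def[abs_def] by (intro meas u h)+
  have \<Psi>_le: "\<bar>\<Psi> y\<bar> \<le> C" for y unfolding \<Psi>_def by (rule mean_le[OF u])
  obtain D where D: "\<And>y x. \<bar>h y x\<bar> \<le> D" using h by (auto simp: bounded_measurable_def)
  have \<eta>_le: "\<bar>\<eta> y\<bar> \<le> D" for y unfolding \<eta>_def by (rule mean_le[OF h D])
  have pt: "\<bar>u y x - \<Psi> y\<bar> \<le> \<epsilon> + h y x + \<eta> y" for y x
  proof -
    interpret R: prob_space "\<rho> y" by (rule prob)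
    have "u y x - \<Psi> y = (\<integral>x'. u y x - u y x' \<partial>\<rho> y)"
      using int_\<rho>[OF u(1)] by (simp add: \<Psi>_def R.prob_space)
    also have "\<dots> \<le> (\<integral>x'. \<epsilon> + h y x + h y x' \<partial>\<rho> y)"
      using int_\<rho>[OF u(1)] int_\<rho>[OF h] diff[of y x] by (intro integral_mono) (auto simp: u_def)
    finally have 1: "u y x - \<Psi> y \<le> \<epsilon> + h y x + \<eta> y"
      using int_\<rho>[OF h] by (simp add: \<eta>_def R.prob_space)
    have "\<Psi> y - u y x = (\<integral>x'. u y x' - u y x \<partial>\<rho> y)"
      using int_\<rho>[OF u(1)] by (simp add: \<Psi>_def R.prob_space)
    also have "\<dots> \<le> (\<integral>x'. \<epsilon> + h y x' + h y x \<partial>\<rho> y)"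
      using int_\<rho>[OF u(1)] int_\<rho>[OF h] diff[of y _ x] by (intro integral_mono) (auto simp: u_def)
    finally have "\<Psi> y - u y x \<le> \<epsilon> + h y x + \<eta> y"
      using int_\<rho>[OF h] by (simp add: \<eta>_def R.prob_space)
    with 1 show ?thesis by simp
  qed
  show ?thesis
  proof (rule that[OF T \<Psi>_meas \<Psi>_le])
    show "(\<integral>\<omega>. \<Psi> (path 0 \<omega>) \<partial>M) = (\<integral>\<omega>. f (path T \<omega>) (X T \<omega>) \<partial>M)"
      using dis[OF u(1)] expectation_funpow[OF f, of T 0] by (simp add: \<Psi>_def u_def)
    fix i
    have int_\<eta>: "integrable M (\<lambda>\<omega>. \<eta> (path i \<omega>))"
      using \<eta>_le by (intro integrable_const_bound[where B = D]) auto
    have [measurable]: "(\<lambda>\<omega>. u (path i \<omega>) (X i \<omega>)) \<in> borel_measurable M"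
      by (rule bounded_measurable_compose[OF u(1) path_measurable X_measurable])
    have int_\<Psi>: "integrable M (\<lambda>\<omega>. \<Psi> (path i \<omega>))"
      using \<Psi>_le by (intro integrable_const_bound[where B = C]) auto
    have "(\<integral>\<omega>. \<bar>u (path i \<omega>) (X i \<omega>) - \<Psi> (path i \<omega>)\<bar> \<partial>M)
        \<le> (\<integral>\<omega>. \<epsilon> + h (path i \<omega>) (X i \<omega>) + \<eta> (path i \<omega>) \<partial>M)"
      using int_\<eta> int_\<Psi> integrable_bounded_measurable[OF h] integrable_bounded_measurable[OF u(1)]
      by (intro integral_mono pt) auto
    also have "\<dots> = \<epsilon> + (\<integral>\<omega>. h (path i \<omega>) (X i \<omega>) \<partial>M) + (\<integral>\<omega>. \<eta> (path i \<omega>) \<partial>M)"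
      using int_\<eta> integrable_bounded_measurable[OF h] by (simp add: prob_space)
    \<comment> \<open>By stationarity the mean of \<open>\<eta>\<close> at time \<open>i\<close> is
      that at time 0, where the disintegration turns it back into the mean of \<open>h\<close> along
      the process.\<close>
    also have "(\<integral>\<omega>. \<eta> (path i \<omega>) \<partial>M) = (\<integral>\<omega>. h (path 0 \<omega>) (X 0 \<omega>) \<partial>M)"
      unfolding integral_path[OF \<eta>_meas, of i] dis[OF h] by (simp add: \<eta>_def)
    finally show "(\<integral>\<omega>. \<bar>(transition Q ^^ T) f (path i \<omega>) (X i \<omega>) - \<Psi> (path i \<omega>)\<bar> \<partial>M) \<le> 3 * \<epsilon>"
      using Eh[of i] Eh[of 0] unfolding u_def by linarith
  qed
qed

end

section \<open>Convergence of averages in mean\<close>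

context ergodic_chain begin

text \<open>Three errors are separated: delaying the sum by \<open>T\<close> costs boundary terms,
  the average of the differences \<open>Z\<close> is small by its second moment, and the average of
  \<open>\<Psi>\<close> is close to its mean, which in turn is close to \<open>m\<close> because
  \<open>T\<close> is late.\<close>

theorem law_of_large_numbers_L1:
  assumes \<phi> [measurable]: "\<phi> \<in> borel_measurable borel" and C: "\<And>x. \<bar>\<phi> x\<bar> \<le> C"
    and mean: "(\<lambda>i. \<integral>\<omega>. \<phi> (X i \<omega>) \<partial>M) \<longlonglongrightarrow> m"
  shows "(\<lambda>t. \<integral>\<omega>. \<bar>(\<Sum>i=1..t. \<phi> (X i \<omega>)) / real t - m\<bar> \<partial>M) \<longlonglongrightarrow> 0"
proof (rule LIMSEQ_I)
  fix r :: real assume r: "0 < r"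
  have C0: "0 \<le> C" using C[of undefined] by linarith
  \<comment> \<open>In the limit the errors add up to
    \<open>3 * C * \<epsilon> + 3 / 2 * \<epsilon>\<close>, which is strictly below
    \<open>r\<close>.\<close>
  define \<epsilon> where "\<epsilon> = r / (3 * C + 2)"
  have \<epsilon>: "0 < \<epsilon>" "(3 * C + 2) * \<epsilon> = r" using r C0 by (simp_all add: \<epsilon>_def)
  define f where "f = (\<lambda>(y :: int \<Rightarrow> 'y) x. \<phi> x)"
  have f: "bounded_measurable f" and f_le: "\<bar>f y x\<bar> \<le> C" for y x
    unfolding bounded_measurable_def f_def using C by (auto simp: split_beta')
  obtain T0 where T0: "\<And>T. T0 \<le> T \<Longrightarrow> \<bar>(\<integral>\<omega>. \<phi> (X T \<omega>) \<partial>M) - m\<bar> < \<epsilon>"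
    using LIMSEQ_D[OF mean \<epsilon>(1)] by auto
  \<comment> \<open>The accuracy is \<open>\<epsilon>\<^sup>2\<close>, because passing from the
    second to the first moment with parameter \<open>\<epsilon>\<close> divides by
    \<open>2 * \<epsilon>\<close>.\<close>
  have "0 < \<epsilon>\<^sup>2" using \<epsilon> by simp
  then obtain T \<Psi> where T: "T0 \<le> T" and \<Psi> [measurable]: "\<Psi> \<in> borel_measurable path_space"
    and \<Psi>_le: "\<And>y. \<bar>\<Psi> y\<bar> \<le> C"
    and \<Psi>_mean: "(\<integral>\<omega>. \<Psi> (path 0 \<omega>) \<partial>M) = (\<integral>\<omega>. f (path T \<omega>) (X T \<omega>) \<partial>M)"
    and approx: "\<And>i. (\<integral>\<omega>. \<bar>(transition Q ^^ T) f (path i \<omega>) (X i \<omega>) - \<Psi> (path i \<omega>)\<bar> \<partial>M) \<le> 3 * \<epsilon>\<^sup>2"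
    by (rule environment_approximation[OF f f_le, of "\<epsilon>\<^sup>2" T0]) (erule that, assumption, blast+)
  define B where "B = 2 * C"
  have B0: "0 \<le> B" using C0 by (simp add: B_def)
  define Z where "Z i \<omega> = \<phi> (X (i + T) \<omega>) - \<Psi> (path i \<omega>)" for i \<omega>
  have Z_meas [measurable]: "Z i \<in> borel_measurable M" for i
    unfolding Z_def[abs_def] by measurable
  have Z_le: "\<bar>Z i \<omega>\<bar> \<le> B" for i \<omega>
    using C[of "X (i + T) \<omega>"] \<Psi>_le[of "path i \<omega>"] unfolding Z_def B_def by linarith
  define u where "u = (transition Q ^^ T) f"
  have u: "bounded_measurable u" "\<And>y x. \<bar>u y x\<bar> \<le> C"
    unfolding u_def using f f_le by (auto intro: bounded_measurable_funpow abs_funpow_le)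
  have u_meas [measurable]: "(\<lambda>\<omega>. u (path i \<omega>) (X i \<omega>)) \<in> borel_measurable M" for i
    by (rule bounded_measurable_compose[OF u(1) path_measurable X_measurable])
  \<comment> \<open>At distance \<open>T\<close> the factor \<open>Z i\<close> is known at time
    \<open>j\<close>: it involves the state at time \<open>i + T \<le> j\<close> and the
    environment. The Markov property then replaces \<open>Z j\<close> by \<open>u - \<Psi>\<close>
    at time \<open>j\<close>, which is small in mean.\<close>
  have corr: "\<bar>\<integral>\<omega>. Z i \<omega> * Z j \<omega> \<partial>M\<bar> \<le> B * (3 * \<epsilon>\<^sup>2)" if "i + T \<le> j" for i j
  proof -
    have [measurable]: "X (i + T) \<in> borel_measurable (history j)" by (rule X_history[OF that])
    have Z_hist: "Z i \<in> borel_measurable (history j)" unfolding Z_def[abs_def] by measurable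
    have int: "integrable M (\<lambda>\<omega>. Z i \<omega> * W \<omega>)" if "W \<in> borel_measurable M" "\<And>\<omega>. \<bar>W \<omega>\<bar> \<le> C" for W
    proof (rule integrable_const_bound[where B = "B * C"])
      show "AE \<omega> in M. norm (Z i \<omega> * W \<omega>) \<le> B * C"
        using Z_le that(2) B0 by (auto simp: abs_mult intro!: mult_mono)
    qed (use that(1) in measurable)
    have int1: "integrable M (\<lambda>\<omega>. Z i \<omega> * \<phi> (X (j + T) \<omega>))" by (rule int) (auto intro: C)
    have int2: "integrable M (\<lambda>\<omega>. Z i \<omega> * \<Psi> (path j \<omega>))" by (rule int) (auto intro: \<Psi>_le)
    have int3: "integrable M (\<lambda>\<omega>. Z i \<omega> * u (path j \<omega>) (X j \<omega>))" by (rule int) (auto intro: u(2))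
    have int4: "integrable M (\<lambda>\<omega>. \<bar>u (path j \<omega>) (X j \<omega>) - \<Psi> (path j \<omega>)\<bar>)"
      using \<Psi>_le by (intro integrable_abs Bochner_Integration.integrable_diff
        integrable_bounded_measurable[OF u(1)] integrable_const_bound[where B = C]) auto
    have "(\<integral>\<omega>. Z i \<omega> * Z j \<omega> \<partial>M) = (\<integral>\<omega>. Z i \<omega> * \<phi> (X (j + T) \<omega>) \<partial>M) - (\<integral>\<omega>. Z i \<omega> * \<Psi> (path j \<omega>) \<partial>M)"
      using int1 int2 unfolding Z_def[of j] right_diff_distrib by (rule Bochner_Integration.integral_diff)
    also have "(\<integral>\<omega>. Z i \<omega> * \<phi> (X (j + T) \<omega>) \<partial>M) = (\<integral>\<omega>. Z i \<omega> * u (path j \<omega>) (X j \<omega>) \<partial>M)"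
      using markov_property[OF f Z_hist Z_le, of T] by (simp add: f_def u_def)
    also have "\<dots> - (\<integral>\<omega>. Z i \<omega> * \<Psi> (path j \<omega>) \<partial>M)
        = (\<integral>\<omega>. Z i \<omega> * (u (path j \<omega>) (X j \<omega>) - \<Psi> (path j \<omega>)) \<partial>M)"
      using int3 int2 unfolding right_diff_distrib by (rule Bochner_Integration.integral_diff[symmetric])
    also have "\<bar>\<dots>\<bar> \<le> (\<integral>\<omega>. \<bar>Z i \<omega> * (u (path j \<omega>) (X j \<omega>) - \<Psi> (path j \<omega>))\<bar> \<partial>M)"
      by (rule integral_abs_bound)
    also have "\<dots> \<le> (\<integral>\<omega>. B * \<bar>u (path j \<omega>) (X j \<omega>) - \<Psi> (path j \<omega>)\<bar> \<partial>M)"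
    proof (rule integral_mono)
      show "integrable M (\<lambda>\<omega>. \<bar>Z i \<omega> * (u (path j \<omega>) (X j \<omega>) - \<Psi> (path j \<omega>))\<bar>)"
        using int3 int2 unfolding right_diff_distrib by (intro integrable_abs Bochner_Integration.integrable_diff)
      show "integrable M (\<lambda>\<omega>. B * \<bar>u (path j \<omega>) (X j \<omega>) - \<Psi> (path j \<omega>)\<bar>)"
        using int4 by (rule integrable_mult_right)
      show "\<bar>Z i \<omega> * (u (path j \<omega>) (X j \<omega>) - \<Psi> (path j \<omega>))\<bar> \<le> B * \<bar>u (path j \<omega>) (X j \<omega>) - \<Psi> (path j \<omega>)\<bar>" for \<omega>
        unfolding abs_mult by (intro mult_right_mono Z_le) auto
    qed
    also have "\<dots> = B * (\<integral>\<omega>. \<bar>u (path j \<omega>) (X j \<omega>) - \<Psi> (path j \<omega>)\<bar> \<partial>M)" by simp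
    also have "\<dots> \<le> B * (3 * \<epsilon>\<^sup>2)" using approx[of j] B0 unfolding u_def by (rule mult_left_mono)
    finally show ?thesis .
  qed
  define e where "e t = (\<integral>\<omega>. \<bar>(\<Sum>i<t. \<Psi> (path i \<omega>)) / real t - (\<integral>\<omega>. \<Psi> (path 0 \<omega>) \<partial>M)\<bar> \<partial>M)" for t
  have e_lim: "e \<longlonglongrightarrow> 0" unfolding e_def[abs_def] by (rule environment_average_L1[OF \<Psi> \<Psi>_le])
  define R where "R t = (3 * C * \<epsilon> + real T * B\<^sup>2 / \<epsilon> / real t + \<epsilon> / 2) + e t + (\<epsilon> + 2 * C * (1 + real T) / real t)" for t
  have R_lim: "R \<longlonglongrightarrow> (3 * C * \<epsilon> + 0 + \<epsilon> / 2) + 0 + (\<epsilon> + 0)"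
    unfolding R_def[abs_def] by (intro tendsto_add tendsto_const lim_const_over_n e_lim)
  have bound: "(\<integral>\<omega>. \<bar>(\<Sum>i=1..t. \<phi> (X i \<omega>)) / real t - m\<bar> \<partial>M) \<le> R t" if t: "1 \<le> t" for t
  proof -
    have t0: "0 < real t" using t by simp
    define W where "W \<omega> = (\<Sum>i<t. Z i \<omega>) / real t" for \<omega>
    have W_meas [measurable]: "W \<in> borel_measurable M" unfolding W_def[abs_def] by measurable
    have W_le: "\<bar>W \<omega>\<bar> \<le> B" for \<omega>
    proof -
      have "\<bar>\<Sum>i<t. Z i \<omega>\<bar> \<le> (\<Sum>i<t. B)" by (rule order_trans[OF sum_abs sum_mono[OF Z_le]])
      then show ?thesis using t0 by (simp add: W_def abs_divide field_simps)
    qed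
    have "(\<integral>\<omega>. (W \<omega>)\<^sup>2 \<partial>M) = (\<integral>\<omega>. (\<Sum>i<t. Z i \<omega>)\<^sup>2 \<partial>M) / (real t)\<^sup>2"
      by (simp add: W_def power_divide)
    also have "\<dots> \<le> ((real t)\<^sup>2 * (B * (3 * \<epsilon>\<^sup>2)) + 2 * real T * B\<^sup>2 * real t) / (real t)\<^sup>2"
      using B0 by (intro divide_right_mono second_moment_sum_le Z_le corr) auto
    also have "\<dots> = B * (3 * \<epsilon>\<^sup>2) + 2 * real T * B\<^sup>2 / real t"
      using t0 by (simp add: field_simps power2_eq_square)
    finally have W2: "(\<integral>\<omega>. (W \<omega>)\<^sup>2 \<partial>M) \<le> B * (3 * \<epsilon>\<^sup>2) + 2 * real T * B\<^sup>2 / real t" .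
    have "(\<integral>\<omega>. \<bar>W \<omega>\<bar> \<partial>M) \<le> (\<integral>\<omega>. (W \<omega>)\<^sup>2 \<partial>M) / (2 * \<epsilon>) + \<epsilon> / 2"
      by (rule expectation_abs_le_square[OF W_meas W_le \<epsilon>(1)])
    also have "\<dots> \<le> (B * (3 * \<epsilon>\<^sup>2) + 2 * real T * B\<^sup>2 / real t) / (2 * \<epsilon>) + \<epsilon> / 2"
      using W2 \<epsilon>(1) by (intro add_mono divide_right_mono) auto
    also have "\<dots> = 3 * C * \<epsilon> + real T * B\<^sup>2 / \<epsilon> / real t + \<epsilon> / 2"
      using t0 \<epsilon>(1) by (simp add: B_def field_simps power2_eq_square)
    finally have EW: "(\<integral>\<omega>. \<bar>W \<omega>\<bar> \<partial>M) \<le> 3 * C * \<epsilon> + real T * B\<^sup>2 / \<epsilon> / real t + \<epsilon> / 2" .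
    define c where "c = (\<integral>\<omega>. \<Psi> (path 0 \<omega>) \<partial>M)"
    have c_m: "\<bar>c - m\<bar> \<le> \<epsilon>" using T0[OF T] unfolding c_def \<Psi>_mean f_def by simp
    let ?A = "\<lambda>\<omega>. (\<Sum>i<t. \<Psi> (path i \<omega>)) / real t"
    have A_le: "\<bar>?A \<omega>\<bar> \<le> C" for \<omega>
    proof -
      have "\<bar>\<Sum>i<t. \<Psi> (path i \<omega>)\<bar> \<le> (\<Sum>i<t. C)" by (rule order_trans[OF sum_abs sum_mono[OF \<Psi>_le]])
      then show ?thesis using t0 by (simp add: abs_divide field_simps)
    qed
    have pt: "\<bar>(\<Sum>i=1..t. \<phi> (X i \<omega>)) / real t - m\<bar>
        \<le> \<bar>W \<omega>\<bar> + \<bar>?A \<omega> - c\<bar> + (\<epsilon> + 2 * C * (1 + real T) / real t)" for \<omega>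
    proof -
      define a where "a i = \<phi> (X i \<omega>)" for i
      have a: "\<bar>a i\<bar> \<le> C" for i using C by (simp add: a_def)
      \<comment> \<open>Both the sum over \<open>1..t\<close> and the sum delayed by
        \<open>T\<close> are shifts of the sum over \<open>i < t\<close>, by 1 and by
        \<open>T\<close>; hence the factor \<open>1 + T\<close>.\<close>
      have "(\<Sum>i=1..t. a i) = (\<Sum>i<t. a (i + 1))"
        by (simp add: lessThan_atLeast0 sum.atLeast_Suc_atMost_Suc_shift atLeastLessThanSuc_atLeastAtMost
            flip: sum.shift_bounds_Suc_ivl)
      then have "\<bar>(\<Sum>i=1..t. a i) - (\<Sum>i<t. a (i + T))\<bar> \<le> 2 * C * (1 + real T)"
        using abs_sum_shift_le[where a = a and C = C and t = t and T = 1, OF a]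
          abs_sum_shift_le[where a = a and C = C and t = t and T = T, OF a]
        unfolding distrib_left by simp
      then have "\<bar>((\<Sum>i=1..t. a i) - (\<Sum>i<t. a (i + T))) / real t\<bar> \<le> 2 * C * (1 + real T) / real t"
        using t0 by (simp add: abs_divide divide_right_mono)
      moreover have "(\<Sum>i=1..t. a i) / real t - m
          = ((\<Sum>i=1..t. a i) - (\<Sum>i<t. a (i + T))) / real t + W \<omega> + (?A \<omega> - c) + (c - m)"
        by (simp add: W_def Z_def a_def sum_subtractf diff_divide_distrib)
      ultimately show ?thesis using c_m unfolding a_def by linarith
    qed
    have int_W: "integrable M (\<lambda>\<omega>. \<bar>W \<omega>\<bar>)"
      using W_le by (intro integrable_const_bound[where B = B]) auto
    have "integrable M (\<lambda>\<omega>. ?A \<omega>)"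
      using A_le by (intro integrable_const_bound[where B = C]) auto
    then have int_A: "integrable M (\<lambda>\<omega>. \<bar>?A \<omega> - c\<bar>)" by simp
    have "(\<integral>\<omega>. \<bar>(\<Sum>i=1..t. \<phi> (X i \<omega>)) / real t - m\<bar> \<partial>M)
        \<le> (\<integral>\<omega>. \<bar>W \<omega>\<bar> + \<bar>?A \<omega> - c\<bar> + (\<epsilon> + 2 * C * (1 + real T) / real t) \<partial>M)"
    proof (intro integral_mono_AE' always_eventually allI pt)
      have "0 \<le> \<epsilon> + 2 * C * (1 + real T) / real t" using C0 \<epsilon>(1) by simp
      then show "0 \<le> \<bar>W \<omega>\<bar> + \<bar>?A \<omega> - c\<bar> + (\<epsilon> + 2 * C * (1 + real T) / real t)" for \<omega>
        by (rule add_nonneg_nonneg[OF add_nonneg_nonneg[OF abs_ge_zero abs_ge_zero]])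
    qed (use int_W int_A in auto)
    also have "\<dots> = (\<integral>\<omega>. \<bar>W \<omega>\<bar> \<partial>M) + e t + (\<epsilon> + 2 * C * (1 + real T) / real t)"
      using int_W int_A by (simp add: prob_space e_def c_def[symmetric])
    also have "\<dots> \<le> R t" unfolding R_def using EW by simp
    finally show ?thesis .
  qed
  have "(3 * C * \<epsilon> + 0 + \<epsilon> / 2) + 0 + (\<epsilon> + 0) < r"
    using \<epsilon> by (simp add: algebra_simps)
  then have "\<forall>\<^sub>F t in sequentially. R t < r" by (rule order_tendstoD(2)[OF R_lim])
  moreover have "\<forall>\<^sub>F t in sequentially. (1 :: nat) \<le> t" by (rule eventually_ge_at_top)
  ultimately have "\<forall>\<^sub>F t in sequentially. norm ((\<integral>\<omega>. \<bar>(\<Sum>i=1..t. \<phi> (X i \<omega>)) / real t - m\<bar> \<partial>M) - 0) < r"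
    by eventually_elim (use bound in force)
  then show "\<exists>no. \<forall>t\<ge>no. norm ((\<integral>\<omega>. \<bar>(\<Sum>i=1..t. \<phi> (X i \<omega>)) / real t - m\<bar> \<partial>M) - 0) < r"
    by (simp only: eventually_sequentially)
qed

end

section \<open>Consequences of the hypotheses\<close>

lemma abs_measure_diff_le_tv_dist:
  assumes "prob_space P" "prob_space P'" and A: "A \<in> sets P"
  shows "\<bar>measure P A - measure P' A\<bar> \<le> tv_dist P P'"
  unfolding tv_dist_def
proof (rule cSUP_upper[OF A], rule bdd_aboveI2)
  fix B
  have "0 \<le> measure P B" "measure P B \<le> 1" "0 \<le> measure P' B" "measure P' B \<le> 1"
    using assms by (auto simp: prob_space.prob_le_1)
  then show "\<bar>measure P B - measure P' B\<bar> \<le> 1" by linarith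
qed

lemma (in finite_measure) exists_tail_less:
  fixes V :: "'a \<Rightarrow> real"
  assumes [measurable]: "V \<in> borel_measurable M" and \<epsilon>: "0 < \<epsilon>"
  shows "\<exists>n::nat. measure M {x \<in> space M. real n < V x} < \<epsilon>"
proof -
  have "(\<lambda>n. measure M {x \<in> space M. real n < V x}) \<longlonglongrightarrow> measure M (\<Inter>n. {x \<in> space M. real n < V x})"
    by (rule finite_Lim_measure_decseq) (auto simp: decseq_def intro: le_less_trans)
  also have "(\<Inter>n. {x \<in> space M. real n < V x}) = {}"
    using reals_Archimedean2 by (auto simp: not_less dest: less_asym)
  finally have "\<forall>\<^sub>F n in sequentially. measure M {x \<in> space M. real n < V x} < \<epsilon>"
    using \<epsilon> by (intro order_tendstoD(2)) auto
  then show ?thesis by (auto simp: eventually_sequentially)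
qed

text \<open>The limit law provides one level for all late indices; the finitely many early laws have
  levels of their own, and a maximum of finitely many levels remains.\<close>

lemma tight_of_tv_convergent:
  fixes V :: "'x::topological_space \<Rightarrow> real"
  assumes P: "\<And>i :: nat. prob_space (P i)" "\<And>i. sets (P i) = sets borel"
    and \<mu>: "prob_space \<mu>" "sets \<mu> = sets borel"
    and tv: "(\<lambda>i. tv_dist (P i) \<mu>) \<longlonglongrightarrow> 0" and V: "V \<in> borel_measurable borel" and \<epsilon>: "0 < \<epsilon>"
  shows "\<exists>L>0. \<forall>i. measure (P i) {x. L < V x} \<le> \<epsilon>"
proof -
  have space: "space (P i) = UNIV" "space \<mu> = UNIV" for i
    using sets_eq_imp_space_eq[OF P(2)] sets_eq_imp_space_eq[OF \<mu>(2)] by auto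
  have meas: "{x. c < V x} \<in> sets borel" for c :: real
    using V by (simp add: borel_measurable_iff_greater)
  have V_P: "V \<in> borel_measurable (P i)" "V \<in> borel_measurable \<mu>" for i
    using V measurable_cong_sets[OF P(2) refl] measurable_cong_sets[OF \<mu>(2) refl] by blast+
  have "\<exists>n::nat. measure (P i) {x. real n < V x} < \<epsilon>" for i
    using finite_measure.exists_tail_less[OF prob_space.finite_measure[OF P(1)] V_P(1) \<epsilon>] by (simp add: space)
  then obtain n :: "nat \<Rightarrow> nat" where n: "\<And>i. measure (P i) {x. real (n i) < V x} < \<epsilon>" by metis
  obtain k :: nat where k: "measure \<mu> {x. real k < V x} < \<epsilon> / 2"
    using finite_measure.exists_tail_less[OF prob_space.finite_measure[OF \<mu>(1)] V_P(2), of "\<epsilon> / 2"] \<epsilon>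
    by (auto simp: space)
  have "\<forall>\<^sub>F i in sequentially. tv_dist (P i) \<mu> < \<epsilon> / 2"
    using \<epsilon> by (intro order_tendstoD(2)[OF tv]) auto
  then obtain i0 where i0: "\<And>i. i0 \<le> i \<Longrightarrow> tv_dist (P i) \<mu> < \<epsilon> / 2" by (auto simp: eventually_sequentially)
  define L where "L = real (Suc (max k (Max (n ` {..i0}))))"
  have anti: "measure (P i) {x. L < V x} \<le> measure (P i) {x. c < V x}" if "c \<le> L" for c i
    using that meas by (intro finite_measure.finite_measure_mono prob_space.finite_measure P) (auto simp: P(2))
  have "measure (P i) {x. L < V x} \<le> \<epsilon>" for i
  proof (cases "i \<le> i0")
    case True
    then have "n i \<le> Max (n ` {..i0})" by (intro Max_ge) auto
    then have "real (n i) \<le> L" unfolding L_def by (simp add: max_def)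
    from anti[OF this, of i] n[of i] show ?thesis by linarith
  next
    case False
    have "measure (P i) {x. L < V x} \<le> measure (P i) {x. real k < V x}"
      by (rule anti) (simp add: L_def)
    moreover have "\<bar>measure (P i) {x. real k < V x} - measure \<mu> {x. real k < V x}\<bar> \<le> tv_dist (P i) \<mu>"
      by (rule abs_measure_diff_le_tv_dist[OF P(1) \<mu>(1)]) (use meas P(2) in auto)
    ultimately show ?thesis using k i0[of i] False by simp
  qed
  moreover have "0 < L" by (simp add: L_def)
  ultimately show ?thesis by blast
qed

text \<open>Total variation controls sets only, so \<phi> is replaced by a step function on finitely
  many level sets \<open>S k\<close>, with an error of at most \<open>1 / N\<close> under every law
  at once.\<close>

lemma tendsto_expectation_of_tv:
  fixes \<phi> :: "'x::topological_space \<Rightarrow> real"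
  assumes P: "\<And>i :: nat. prob_space (P i)" "\<And>i. sets (P i) = sets borel"
    and \<mu>: "prob_space \<mu>" "sets \<mu> = sets borel"
    and tv: "(\<lambda>i. tv_dist (P i) \<mu>) \<longlonglongrightarrow> 0"
    and \<phi>: "\<phi> \<in> borel_measurable borel" "\<And>x. \<bar>\<phi> x\<bar> \<le> C"
  shows "(\<lambda>i. \<integral>x. \<phi> x \<partial>P i) \<longlonglongrightarrow> (\<integral>x. \<phi> x \<partial>\<mu>)"
proof (rule LIMSEQ_I)
  fix r :: real assume r: "0 < r"
  have "0 \<le> C" using \<phi>(2)[of undefined] by linarith
  obtain N :: nat where N: "0 < N" "2 * (1 / real N) < r / 2"
  proof -
    obtain n where "inverse (real (Suc n)) < r / 4" using reals_Archimedean[of "r / 4"] r by auto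
    then show ?thesis using that[of "Suc n"] by (simp add: field_simps)
  qed
  define S where "S k = {x. \<lfloor>real N * \<phi> x\<rfloor> = k}" for k
  have S_meas: "S k \<in> sets borel" for k
  proof -
    have "{x \<in> space borel. \<lfloor>real N * \<phi> x\<rfloor> = k} \<in> sets borel" using \<phi>(1) by measurable
    then show ?thesis by (simp add: S_def)
  qed
  define I where "I = {- \<lceil>real N * C\<rceil> - 1..\<lceil>real N * C\<rceil>}"
  define \<psi> where "\<psi> x = (\<Sum>k\<in>I. real_of_int k / real N * indicator (S k) x)" for x
  have \<psi>: "\<bar>\<phi> x - \<psi> x\<bar> \<le> 1 / real N" for x
  proof -
    let ?k = "\<lfloor>real N * \<phi> x\<rfloor>"
    have "\<bar>real N * \<phi> x\<bar> \<le> real N * C" using \<phi>(2)[of x] by (simp add: abs_mult mult_left_mono)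
    then have "?k \<in> I" unfolding I_def atLeastAtMost_iff by linarith
    have "\<psi> x = (\<Sum>k\<in>I. if k = ?k then real_of_int k / real N else 0)"
      unfolding \<psi>_def S_def by (intro sum.cong) (auto simp: indicator_def)
    also have "\<dots> = real_of_int ?k / real N"
      using \<open>?k \<in> I\<close> by (simp add: I_def)
    finally have "\<phi> x - \<psi> x = (real N * \<phi> x - real_of_int ?k) / real N"
      using N(1) by (simp add: field_simps)
    moreover have "\<bar>real N * \<phi> x - real_of_int ?k\<bar> \<le> 1" by linarith
    ultimately show ?thesis using N(1) by (simp add: abs_divide divide_right_mono)
  qed
  have close: "\<bar>(\<integral>x. \<phi> x \<partial>R) - (\<Sum>k\<in>I. real_of_int k / real N * measure R (S k))\<bar> \<le> 1 / real N"
    if R: "prob_space R" "sets R = sets borel" for R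
  proof -
    interpret R: prob_space R by fact
    have [measurable_cong]: "sets R = sets borel" by fact
    note \<phi>(1)[measurable] S_meas[measurable]
    have int_ind: "integrable R (\<lambda>x. real_of_int k / real N * indicator (S k) x)" for k
      using S_meas by (intro integrable_mult_right integrable_real_indicator) (auto simp: R(2) R.emeasure_eq_measure)
    have int_\<phi>: "integrable R \<phi>" using \<phi>(2) by (intro R.integrable_const_bound[where B = C]) auto
    have int_\<psi>: "integrable R \<psi>" unfolding \<psi>_def[abs_def] by (intro Bochner_Integration.integrable_sum int_ind)
    have "space R = UNIV" using sets_eq_imp_space_eq[OF R(2)] by simp
    then have "(\<integral>x. \<psi> x \<partial>R) = (\<Sum>k\<in>I. real_of_int k / real N * measure R (S k))"
      unfolding \<psi>_def[abs_def] by (subst Bochner_Integration.integral_sum) (use int_ind in auto)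
    then have "(\<integral>x. \<phi> x \<partial>R) - (\<Sum>k\<in>I. real_of_int k / real N * measure R (S k)) = (\<integral>x. \<phi> x - \<psi> x \<partial>R)"
      using int_\<phi> int_\<psi> by simp
    also have "\<bar>\<dots>\<bar> \<le> (\<integral>x. \<bar>\<phi> x - \<psi> x\<bar> \<partial>R)" by (rule integral_abs_bound)
    also have "\<dots> \<le> (\<integral>x. 1 / real N \<partial>R)" using int_\<phi> int_\<psi> by (intro integral_mono \<psi>) auto
    finally show ?thesis by (simp add: R.prob_space)
  qed
  have "(\<lambda>i. measure (P i) (S k)) \<longlonglongrightarrow> measure \<mu> (S k)" for k
  proof (rule LIM_zero_cancel, rule Lim_null_comparison[OF _ tv], intro always_eventually allI)
    show "norm (measure (P i) (S k) - measure \<mu> (S k)) \<le> tv_dist (P i) \<mu>" for i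
      using abs_measure_diff_le_tv_dist[OF P(1) \<mu>(1), of "S k" i] S_meas by (simp add: P(2))
  qed
  then have "(\<lambda>i. \<Sum>k\<in>I. real_of_int k / real N * measure (P i) (S k))
      \<longlonglongrightarrow> (\<Sum>k\<in>I. real_of_int k / real N * measure \<mu> (S k))"
    by (intro tendsto_intros)
  from LIMSEQ_D[OF this, of "r / 2"] r obtain n0 where n0: "\<And>i. n0 \<le> i \<Longrightarrow>
      \<bar>(\<Sum>k\<in>I. real_of_int k / real N * measure (P i) (S k)) - (\<Sum>k\<in>I. real_of_int k / real N * measure \<mu> (S k))\<bar> < r / 2"
    by auto
  have "norm ((\<integral>x. \<phi> x \<partial>P i) - (\<integral>x. \<phi> x \<partial>\<mu>)) < r" if "n0 \<le> i" for i
    using n0[OF that] close[OF P(1) P(2), of i] close[OF \<mu>] N(2)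
    unfolding real_norm_def by linarith
  then show "\<exists>no. \<forall>i\<ge>no. norm ((\<integral>x. \<phi> x \<partial>P i) - (\<integral>x. \<phi> x \<partial>\<mu>)) < r" by blast
qed

text \<open>By \<open>1 - x \<le> exp (- x)\<close> the power decays at rate
  \<open>3 * lam / 4\<close>, which is at least the rate \<open>\<alpha> * lam / 2\<close> of the
  hypothesis because \<open>\<alpha> \<le> 1/3\<close>. The exponent \<open>k - 1\<close> in place
  of \<open>k\<close> costs at most \<open>exp (1/4)\<close>, since
  \<open>3 * lam / 4 \<le> 1/4\<close>.\<close>

lemma power_decay_tendsto_0:
  fixes lam \<alpha> :: "nat \<Rightarrow> real"
  assumes lam: "\<And>n. 0 < lam n" "\<And>n. lam n \<le> 1/3" and \<alpha>: "\<And>n. 0 < \<alpha> n" "\<And>n. \<alpha> n \<le> 1/3"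
    and lim: "(\<lambda>k. exp (- (real k * \<alpha> k * lam k / 2))) \<longlonglongrightarrow> 0"
  shows "(\<lambda>k. (1 - 3 * lam k / 4) ^ (k - 1)) \<longlonglongrightarrow> 0"
proof (rule Lim_null_comparison)
  show "(\<lambda>k. exp (1/4) * exp (- (real k * \<alpha> k * lam k / 2))) \<longlonglongrightarrow> 0"
    using tendsto_mult[OF tendsto_const lim, of "exp (1/4)"] by simp
  show "\<forall>\<^sub>F k in sequentially. norm ((1 - 3 * lam k / 4) ^ (k - 1)) \<le> exp (1/4) * exp (- (real k * \<alpha> k * lam k / 2))"
    using eventually_ge_at_top[of 1]
  proof eventually_elim
    case (elim k)
    have q: "0 \<le> 1 - 3 * lam k / 4" using lam(2)[of k] by simp
    have "1 - 3 * lam k / 4 \<le> exp (- (3 * lam k / 4))" using exp_ge_add_one_self[of "- (3 * lam k / 4)"] by simp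
    then have "(1 - 3 * lam k / 4) ^ (k - 1) \<le> exp (- (3 * lam k / 4)) ^ (k - 1)"
      using q by (rule power_mono)
    also have "\<dots> = exp (- (real (k - 1) * (3 * lam k / 4)))" by (simp flip: exp_of_nat_mult)
    also have "\<dots> \<le> exp (1 / 4 - real k * \<alpha> k * lam k / 2)"
    proof -
      have "real k * lam k * \<alpha> k \<le> real k * lam k * (1/3)"
        using lam(1)[of k] \<alpha>(2)[of k] by (intro mult_left_mono) auto
      moreover have "0 \<le> real k * lam k" using lam(1)[of k] by simp
      ultimately have "real k * lam k * \<alpha> k / 2 \<le> 3 / 4 * (real k * lam k)" by linarith
      moreover have "real (k - 1) * (3 * lam k / 4) = 3 / 4 * (real k * lam k) - 3 * lam k / 4"
        using elim by (simp add: of_nat_diff field_simps)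
      ultimately have "- (real (k - 1) * (3 * lam k / 4)) \<le> 1 / 4 - real k * lam k * \<alpha> k / 2"
        using lam(2)[of k] by linarith
      then show ?thesis by (simp add: mult.assoc mult.commute[of "lam k"])
    qed
    also have "\<dots> = exp (1/4) * exp (- (real k * \<alpha> k * lam k / 2))" by (simp flip: exp_add)
    finally show ?case using q by simp
  qed
qed

lemma env_norm_measurable:
  assumes "\<And>n. A n \<in> sets borel"
  shows "env_norm A \<in> measurable borel (count_space UNIV)"
proof -
  have [measurable]: "Measurable.pred borel (\<lambda>y. y \<in> A n)" for n
    using assms by (simp add: pred_sets2)
  show ?thesis unfolding env_norm_def[abs_def] by measurable
qed

text \<open>The bound on the maximal process concerns windows that start at time 1; stationarity
  carries it to windows starting anywhere. A block with \<open>j \<le> H\<close> covers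
  \<open>H + 1\<close> times, hence \<open>Suc H\<close>.\<close>

lemma strongly_stationary_window:
  assumes Y [measurable]: "\<And>t. Y t \<in> borel_measurable M" and st: "strongly_stationary M Y"
    and lev [measurable]: "lev \<in> measurable borel (count_space UNIV)"
  shows "measure M {\<omega> \<in> space M. \<exists>j\<le>H. (N :: nat) < lev (Y (int (i + j)) \<omega>)}
    = measure M {\<omega> \<in> space M. \<exists>j\<in>{1..Suc H}. N < lev (Y (int j) \<omega>)}"
proof -
  define S where "S = {y \<in> space (path_space :: (int \<Rightarrow> 'b) measure). \<exists>j\<le>H. N < lev (y (1 + int j))}"
  have S_meas [measurable]: "S \<in> sets path_space" unfolding S_def by measurable
  have path_meas [measurable]: "(\<lambda>\<omega> t. Y (t + k) \<omega>) \<in> measurable M path_space" for k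
    by (rule measurable_PiM_single') auto
  have window: "measure (distr M path_space (\<lambda>\<omega> t. Y (t + k) \<omega>)) S
      = measure M {\<omega> \<in> space M. \<exists>j\<le>H. N < lev (Y (1 + int j + k) \<omega>)}" for k
    by (subst measure_distr[OF path_meas S_meas]) (auto simp: S_def space_PiM intro!: arg_cong[where f = "measure M"])
  \<comment> \<open>For \<open>i = 0\<close> this is a shift by -1, which two-sided time
    permits.\<close>
  have "measure (distr M path_space (\<lambda>\<omega> t. Y (t + (int i - 1)) \<omega>)) S
      = measure (distr M path_space (\<lambda>\<omega> t. Y (t + 0) \<omega>)) S"
    using st unfolding strongly_stationary_def by simp
  then have eq: "measure M {\<omega> \<in> space M. \<exists>j\<le>H. N < lev (Y (int (i + j)) \<omega>)}
      = measure M {\<omega> \<in> space M. \<exists>j\<le>H. N < lev (Y (1 + int j) \<omega>)}"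
    unfolding window by (simp add: algebra_simps)
  have window_1: "(\<exists>j\<le>H. N < lev (Y (1 + int j) \<omega>)) \<longleftrightarrow> (\<exists>j\<in>{1..Suc H}. N < lev (Y (int j) \<omega>))" for \<omega>
  proof
    assume "\<exists>j\<in>{1..Suc H}. N < lev (Y (int j) \<omega>)"
    then obtain j where "j \<in> {1..Suc H}" "N < lev (Y (int j) \<omega>)" by blast
    then show "\<exists>j\<le>H. N < lev (Y (1 + int j) \<omega>)"
      by (intro exI[of _ "j - 1"]) (auto simp: of_nat_diff)
  next
    assume "\<exists>j\<le>H. N < lev (Y (1 + int j) \<omega>)"
    then obtain j where "j \<le> H" "N < lev (Y (1 + int j) \<omega>)" by blast
    then show "\<exists>j\<in>{1..Suc H}. N < lev (Y (int j) \<omega>)" by (intro bexI[of _ "Suc j"]) auto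
  qed
  show ?thesis unfolding eq window_1 ..
qed

section \<open>From convergence in mean to all exponents, and the conclusion\<close>

lemma (in prob_space) tendsto_Lp_of_L1:
  assumes f [measurable]: "\<And>n. f n \<in> borel_measurable M" and f_le: "\<And>n \<omega>. \<bar>f n \<omega>\<bar> \<le> C" and m: "\<bar>m\<bar> \<le> C"
    and lim: "(\<lambda>n. \<integral>\<omega>. \<bar>f n \<omega> - m\<bar> \<partial>M) \<longlonglongrightarrow> 0" and p: "1 \<le> p"
  shows "tendsto_Lp M p f (\<lambda>_. m)"
proof -
  have bd: "\<bar>f n \<omega> - m\<bar> \<le> 2 * C" for n \<omega> using f_le[of n \<omega>] m by linarith
  have C0: "0 \<le> C" using m by linarith
  have integrable_powr: "integrable M (\<lambda>\<omega>. \<bar>g \<omega>\<bar> powr p)"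
    if [measurable]: "g \<in> borel_measurable M" and "\<And>\<omega>. \<bar>g \<omega>\<bar> \<le> D" for g :: "'a \<Rightarrow> real" and D
    using that(2) p by (intro integrable_const_bound[where B = "D powr p"]) (auto intro!: powr_mono2)
  \<comment> \<open>On the bounded range of the differences the power \<open>p\<close> is dominated
    by a multiple of the absolute value, which reduces the claim to convergence in mean.\<close>
  have powr_le: "\<bar>x\<bar> powr p \<le> (2 * C) powr (p - 1) * \<bar>x\<bar>" if "\<bar>x\<bar> \<le> 2 * C" for x :: real
  proof (cases "x = 0")
    case False
    have "\<bar>x\<bar> powr p = \<bar>x\<bar> powr (p - 1) * \<bar>x\<bar>" using False by (simp add: powr_diff)
    also have "\<dots> \<le> (2 * C) powr (p - 1) * \<bar>x\<bar>" using p that by (intro mult_right_mono powr_mono2) auto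
    finally show ?thesis .
  qed simp
  have "(\<lambda>n. \<integral>\<omega>. \<bar>f n \<omega> - m\<bar> powr p \<partial>M) \<longlonglongrightarrow> 0"
  proof (rule tendsto_sandwich)
    show "\<forall>\<^sub>F n in sequentially. 0 \<le> (\<integral>\<omega>. \<bar>f n \<omega> - m\<bar> powr p \<partial>M)" by simp
    show "\<forall>\<^sub>F n in sequentially. (\<integral>\<omega>. \<bar>f n \<omega> - m\<bar> powr p \<partial>M)
        \<le> (2 * C) powr (p - 1) * (\<integral>\<omega>. \<bar>f n \<omega> - m\<bar> \<partial>M)"
    proof (intro always_eventually allI)
      fix n
      have "integrable M (\<lambda>\<omega>. \<bar>f n \<omega> - m\<bar>)"
        using bd by (intro integrable_const_bound[where B = "2 * C"]) auto
      then have "(\<integral>\<omega>. \<bar>f n \<omega> - m\<bar> powr p \<partial>M) \<le> (\<integral>\<omega>. (2 * C) powr (p - 1) * \<bar>f n \<omega> - m\<bar> \<partial>M)"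
        using bd by (intro integral_mono powr_le integrable_powr integrable_mult_right) auto
      then show "(\<integral>\<omega>. \<bar>f n \<omega> - m\<bar> powr p \<partial>M) \<le> (2 * C) powr (p - 1) * (\<integral>\<omega>. \<bar>f n \<omega> - m\<bar> \<partial>M)"
        by simp
    qed
    show "(\<lambda>n. (2 * C) powr (p - 1) * (\<integral>\<omega>. \<bar>f n \<omega> - m\<bar> \<partial>M)) \<longlonglongrightarrow> 0"
      using tendsto_mult[OF tendsto_const lim] by simp
  qed simp
  then have "(\<lambda>n. (\<integral>\<omega>. \<bar>f n \<omega> - m\<bar> powr p \<partial>M) powr (1 / p)) \<longlonglongrightarrow> 0"
    using p by (intro tendsto_zero_powrI[where b = "1 / p"] tendsto_const) auto
  then show ?thesis
    using integrable_powr[OF f f_le] by (simp add: tendsto_Lp_def)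
qed

theorem theorem2p15:
  fixes M :: "'w measure"
    and Y :: "int \<Rightarrow> 'w \<Rightarrow> 'y::polish_space"
    and X :: "nat \<Rightarrow> 'w \<Rightarrow> 'x::polish_space"
    and Q :: "'y \<Rightarrow> 'x \<Rightarrow> 'x measure"
    and V :: "'x \<Rightarrow> real"
    and A :: "nat \<Rightarrow> 'y set"
    and lam K \<alpha> l :: "nat \<Rightarrow> real"
    and \<nu> :: "nat \<Rightarrow> 'x measure"
    and g :: "nat \<Rightarrow> nat"
    and \<mu> :: "'x measure"
  assumes "prob_space M"
    and "\<And>t. Y t \<in> borel_measurable M"
    and "strongly_stationary M Y"
    and "ergodic_process M Y"
    and "prob_kernels Q"
    and "process_in_environment M Y X Q"
    \<comment> \<open>(i) drift\<close>
    and "V \<in> borel_measurable borel" and "\<And>x. 0 \<le> V x"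
    and "\<And>n. A n \<in> sets borel" and "mono A" and "A 0 \<noteq> {}" and "(\<Union>n. A n) = UNIV"
    and "antimono lam" and "\<And>n. 0 < lam n \<and> lam n \<le> 1/3"
    and "mono K" and "\<And>n. 1 \<le> K n"
    and "\<And>x y. (\<integral>\<^sup>+ z. ennreal (V z) \<partial>(Q y x))
           \<le> ennreal ((1 - lam (env_norm A y)) * V x + K (env_norm A y))"
    \<comment> \<open>(ii) minorization\<close>
    and "antimono \<alpha>" and "\<And>n. 0 < \<alpha> n \<and> \<alpha> n \<le> 1/3"
    and "\<And>n. prob_space (\<nu> n) \<and> sets (\<nu> n) = sets borel"
    and "\<And>y x B. V x \<le> 8 * K (env_norm A y) / lam (env_norm A y) \<Longrightarrow> B \<in> sets borel \<Longrightarrow>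
           measure (Q y x) B \<ge> \<alpha> (env_norm A y) * measure (\<nu> (env_norm A y)) B"
    \<comment> \<open>(iii) maximal process\<close>
    and "mono g" and "antimono l" and "\<And>n. 0 \<le> l n \<and> l n \<le> 1"
    and "\<And>t. t \<ge> 1 \<Longrightarrow>
           measure M {\<omega> \<in> space M. (MAX i\<in>{1..t}. env_norm A (Y (int i) \<omega>)) \<ge> g t} \<le> l t"
    \<comment> \<open>(iv)\<close>
    and "(\<integral>\<^sup>+ \<omega>. ennreal (V (X 0 \<omega>) + V (X 1 \<omega>)) \<partial>M) < \<infinity>"
    \<comment> \<open>(v)\<close>
    and "summable (\<lambda>k. exp (- (real k * \<alpha> (g k) * lam (g k) / 2)))" and "summable l"
    \<comment> \<open>(vi)\<close>
    and "(\<lambda>t. \<bar>ln (lam (g t))\<bar> / (\<alpha> (g t) * lam (g t)) / real t) \<longlonglongrightarrow> 0"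
    \<comment> \<open>\<open>\<mu>\<close> is the total variation limit of the laws of the process\<close>
    and "prob_space \<mu>" and "sets \<mu> = sets borel"
    and "(\<lambda>t. tv_dist (distr M borel (X t)) \<mu>) \<longlonglongrightarrow> 0"
  shows "\<forall>\<phi> :: 'x \<Rightarrow> real. \<phi> \<in> borel_measurable borel \<longrightarrow> bounded (range \<phi>) \<longrightarrow>
           (\<forall>p\<ge>1. tendsto_Lp M p (\<lambda>t \<omega>. (\<Sum>i=1..t. \<phi> (X i \<omega>)) / real t) (\<lambda>_. \<integral>z. \<phi> z \<partial>\<mu>))"
proof -
  have prob_M: "prob_space M" and Y: "\<And>t. Y t \<in> borel_measurable M" and st: "strongly_stationary M Y"
    and process: "process_in_environment M Y X Q" by fact+
  interpret prob_space M by (rule prob_M)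
  have X [measurable]: "X i \<in> borel_measurable M" for i
    using process by (simp add: process_in_environment_def)
  have V [measurable]: "V \<in> borel_measurable borel" by fact
  have lev [measurable]: "env_norm A \<in> measurable borel (count_space UNIV)"
    by (rule env_norm_measurable) fact
  have lam: "0 < lam n" "lam n \<le> 1/3" and \<alpha>: "0 < \<alpha> n" "\<alpha> n \<le> 1/3" for n
    using assms(14) assms(19) by blast+
  have \<mu>: "prob_space \<mu>" "sets \<mu> = sets borel" by fact+
  have P: "prob_space (distr M borel (X i))" "sets (distr M borel (X i)) = sets borel" for i
    by (auto intro: prob_space_distr)
  have tv: "(\<lambda>t. tv_dist (distr M borel (X t)) \<mu>) \<longlonglongrightarrow> 0" by fact
  interpret \<nu>: prob_space "\<nu> n" for n using assms(20) by blast
  interpret ergodic_chain M Q Y X V "env_norm A" lam K \<alpha> \<nu>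
  proof unfold_locales
    show "prob_kernels Q" "Y t \<in> borel_measurable M" "process_in_environment M Y X Q"
      "V \<in> borel_measurable borel" "0 \<le> V x" "env_norm A \<in> measurable borel (count_space UNIV)"
      "antimono lam" "0 < lam n" "lam n \<le> 1/3" "1 \<le> K n" "antimono \<alpha>" "0 < \<alpha> n" "\<alpha> n \<le> 1/3"
      "strongly_stationary M Y" "ergodic_process M Y" for t x n
      using assms lam \<alpha> lev by blast+
    show "sets (\<nu> n) = sets borel" for n using assms(20) by blast
    show "(\<integral>\<^sup>+z. ennreal (V z) \<partial>Q y x) \<le> ennreal ((1 - lam (env_norm A y)) * V x + K (env_norm A y))" for y x
      by (rule assms(17))
    show "\<alpha> (env_norm A y) * measure (\<nu> (env_norm A y)) B \<le> measure (Q y x) B"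
      if "V x \<le> 8 * K (env_norm A y) / lam (env_norm A y)" "B \<in> sets borel" for y x B
      using assms(21)[OF that] .
    show "\<exists>L>0. \<forall>i. prob {\<omega> \<in> space M. L < V (X i \<omega>)} \<le> \<epsilon>" if \<epsilon>: "0 < \<epsilon>" for \<epsilon>
    proof -
      have "measure (distr M borel (X i)) {x. L < V x} = prob {\<omega> \<in> space M. L < V (X i \<omega>)}" for i L
      proof -
        have "{x \<in> space borel. L < V x} \<in> sets borel" by measurable
        then show ?thesis by (subst measure_distr) (auto intro!: arg_cong[where f = prob])
      qed
      then show ?thesis using tight_of_tv_convergent[OF P \<mu> tv V \<epsilon>] by simp
    qed
    fix \<epsilon> c :: real assume \<epsilon>: "0 < \<epsilon>" and c: "0 < c"
    \<comment> \<open>One large \<open>k\<close> serves both demands of \<open>decay\<close>: the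
      block has \<open>k\<close> times, so \<open>H = k - 1\<close>, and the level is
      \<open>N = g k\<close>. The terms of both series in (v) tend to 0, which makes the power small
      and also the exceedance bound \<open>l k\<close>.\<close>
    have "(\<lambda>k. (1 - 3 * lam (g k) / 4) ^ (k - 1)) \<longlonglongrightarrow> 0"
      using summable_LIMSEQ_zero[OF assms(27)]
      by (intro power_decay_tendsto_0[of "\<lambda>k. lam (g k)" "\<lambda>k. \<alpha> (g k)"] lam \<alpha>)
    then have "\<forall>\<^sub>F k in sequentially. (1 - 3 * lam (g k) / 4) ^ (k - 1) < c"
      using c by (intro order_tendstoD(2))
    moreover have "\<forall>\<^sub>F k in sequentially. l k < \<epsilon>"
      using summable_LIMSEQ_zero[OF assms(28)] \<epsilon> by (intro order_tendstoD(2))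
    moreover have "\<forall>\<^sub>F k in sequentially. (1 :: nat) \<le> k" by (rule eventually_ge_at_top)
    ultimately have "\<forall>\<^sub>F k in sequentially. (1 - 3 * lam (g k) / 4) ^ (k - 1) < c \<and> l k < \<epsilon> \<and> 1 \<le> k"
      by eventually_elim simp
    then obtain k where k: "(1 - 3 * lam (g k) / 4) ^ (k - 1) < c" "l k < \<epsilon>" "1 \<le> k"
      by (auto simp: eventually_sequentially)
    have "prob {\<omega> \<in> space M. \<exists>j\<le>k - 1. g k < env_norm A (Y (int (i + j)) \<omega>)} \<le> \<epsilon>" for i
    proof -
      have "prob {\<omega> \<in> space M. \<exists>j\<le>k - 1. g k < env_norm A (Y (int (i + j)) \<omega>)}
          = prob {\<omega> \<in> space M. \<exists>j\<in>{1..k}. g k < env_norm A (Y (int j) \<omega>)}"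
        using strongly_stationary_window[OF Y st lev, of "k - 1" "g k" i] k(3) by simp
      \<comment> \<open>The event in (iii) includes a maximum equal to \<open>g k\<close>, so it
        contains the strict exceedance; \<open>k \<ge> 1\<close> keeps the range of the maximum
        nonempty.\<close>
      also have "\<dots> \<le> prob {\<omega> \<in> space M. g k \<le> (MAX i\<in>{1..k}. env_norm A (Y (int i) \<omega>))}"
      proof (rule finite_measure_mono)
        show "{\<omega> \<in> space M. \<exists>j\<in>{1..k}. g k < env_norm A (Y (int j) \<omega>)}
            \<subseteq> {\<omega> \<in> space M. g k \<le> (MAX i\<in>{1..k}. env_norm A (Y (int i) \<omega>))}"
          by (auto intro!: order_trans[OF less_imp_le Max_ge])
        have [measurable]: "Y t \<in> borel_measurable M" for t by (rule Y)
        have "{\<omega> \<in> space M. \<exists>i\<in>{1..k}. g k \<le> env_norm A (Y (int i) \<omega>)} \<in> sets M" by measurable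
        also have "{\<omega> \<in> space M. \<exists>i\<in>{1..k}. g k \<le> env_norm A (Y (int i) \<omega>)}
            = {\<omega> \<in> space M. g k \<le> (MAX i\<in>{1..k}. env_norm A (Y (int i) \<omega>))}"
          using k(3) by (subst Max_ge_iff) auto
        finally show "{\<omega> \<in> space M. g k \<le> (MAX i\<in>{1..k}. env_norm A (Y (int i) \<omega>))} \<in> sets M" .
      qed
      also have "\<dots> \<le> l k" by (rule assms(25)[OF k(3)])
      finally show ?thesis using k(2) by simp
    qed
    then show "\<exists>H N. (1 - 3 * lam N / 4) ^ H \<le> c \<and>
        (\<forall>i. prob {\<omega> \<in> space M. \<exists>j\<le>H. N < env_norm A (Y (int (i + j)) \<omega>)} \<le> \<epsilon>)"
      using k(1) by (intro exI[of _ "k - 1"] exI[of _ "g k"]) auto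
  qed
  show ?thesis
  proof (intro allI impI)
    fix \<phi> :: "'x \<Rightarrow> real" and p :: real
    assume \<phi> [measurable]: "\<phi> \<in> borel_measurable borel" and "bounded (range \<phi>)" and p: "1 \<le> p"
    then obtain C where C: "\<And>x. \<bar>\<phi> x\<bar> \<le> C" by (auto simp: bounded_iff)
    have C0: "0 \<le> C" using C[of undefined] by linarith
    define m where "m = (\<integral>z. \<phi> z \<partial>\<mu>)"
    have "(\<lambda>i. \<integral>x. \<phi> x \<partial>distr M borel (X i)) \<longlonglongrightarrow> m"
      unfolding m_def by (rule tendsto_expectation_of_tv[OF P \<mu> tv \<phi> C])
    then have mean: "(\<lambda>i. \<integral>\<omega>. \<phi> (X i \<omega>) \<partial>M) \<longlonglongrightarrow> m" by (simp add: integral_distr)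
    have "\<bar>m\<bar> \<le> C"
    proof (rule LIMSEQ_le_const2[OF tendsto_rabs[OF mean]], intro exI allI impI)
      fix i
      have "\<bar>\<integral>\<omega>. \<phi> (X i \<omega>) \<partial>M\<bar> \<le> (\<integral>\<omega>. \<bar>\<phi> (X i \<omega>)\<bar> \<partial>M)" by (rule integral_abs_bound)
      also have "\<dots> \<le> (\<integral>\<omega>. C \<partial>M)"
        using C C0 by (intro integral_mono integrable_abs integrable_const_bound[where B = C]) auto
      finally show "\<bar>\<integral>\<omega>. \<phi> (X i \<omega>) \<partial>M\<bar> \<le> C" by (simp add: prob_space)
    qed
    moreover have "\<bar>(\<Sum>i=1..t. \<phi> (X i \<omega>)) / real t\<bar> \<le> C" for t \<omega>
    \<comment> \<open>At \<open>t = 0\<close> the average is 0 by the convention for division by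
      0.\<close>
    proof (cases "t = 0")
      case False
      have "\<bar>\<Sum>i=1..t. \<phi> (X i \<omega>)\<bar> \<le> (\<Sum>i=1..t. C)"
        by (rule order_trans[OF sum_abs sum_mono[OF C]])
      with False show ?thesis by (simp add: abs_divide field_simps)
    qed (use C0 in simp)
    ultimately show "tendsto_Lp M p (\<lambda>t \<omega>. (\<Sum>i=1..t. \<phi> (X i \<omega>)) / real t) (\<lambda>_. \<integral>z. \<phi> z \<partial>\<mu>)"
      unfolding m_def[symmetric]
      by (intro tendsto_Lp_of_L1[OF _ _ _ law_of_large_numbers_L1[OF \<phi> C mean] p]) auto
  qed
qed

end
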